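(* Let $F$ be a graph of order $r$ with $\chi(F)\geq 3$, $\beta_1(F)=1$ and without isolated vertices. Let $k\geq 2$, $\ell\geq 4$, $r\geq 3$ and $n\geq 4k^2\ell^2(k\ell+r)\left(\lfloor\frac{\ell}{2}\rfloor+1\right)\binom{\ell}{\lfloor \ell/2\rfloor}$. Then $$ex(n,\{F,kP_\ell\})=\left(n-k\left\lfloor\frac{\ell}{2}\right\rfloor+1\right)\left(k\left\lfloor\frac{\ell}{2}\right\rfloor-1\right)+C_{F,k,\ell},$$ where $C_{F,k,\ell}=0$ if the triple $(F,k,\ell)$ has property $\mathscr{P}$ and $C_{F,k,\ell}=1$ otherwise.
   Context: All graphs are finite and simple. $ex(n,\mathscr{F})$ is the maximum number of edges of an $n$-vertex graph containing no member of $\mathscr{F}$ as a subgraph. $P_\ell$ is the path on $\ell$ vertices and $kP_\ell$ is $k$ vertex-disjoint copies of it. $\chi$ is the chromatic number. An edge control set of $F$ is a set $E'\subseteq E(F)$ such that every edge not in $E'$ shares an endpoint with some edge in $E'$; $\beta_1(F)$ is the minimum size of an edge control set. When $\beta_1(F)=1$, let $\{u_1u_2\}$ be the edge control set of $F$ and set $f(F)=\min\{d_F(u_1),d_F(u_2)\}$. $N(F,K_3)$ is the number of triangles in $F$. The triple $(F,k,\ell)$ has property $\mathscr{P}$ if at least one of the following holds: (1) $\ell$ is even; (2) $v(F)=r\leq k\lfloor\frac{\ell}{2}\rfloor+1$; (3) $N(F,K_3)=1$ and $f(F)\leq k\lfloor\frac{\ell}{2}\rfloor$. *)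

theory Defs
  imports Main
begin

definition graph :: "'a set \<Rightarrow> 'a set set \<Rightarrow> bool" where
  "graph V E \<longleftrightarrow> finite V \<and> (\<forall>e\<in>E. e \<subseteq> V \<and> card e = 2)"

definition contains :: "'a set \<Rightarrow> 'a set set \<Rightarrow> 'b set \<Rightarrow> 'b set set \<Rightarrow> bool" where
  "contains V E W D \<longleftrightarrow> (\<exists>\<phi>. inj_on \<phi> W \<and> \<phi> ` W \<subseteq> V \<and> (\<forall>e\<in>D. \<phi> ` e \<in> E))"

definition kP_verts :: "nat \<Rightarrow> nat \<Rightarrow> (nat \<times> nat) set" where
  "kP_verts k l = {0..<k} \<times> {0..<l}"

definition kP_edges :: "nat \<Rightarrow> nat \<Rightarrow> (nat \<times> nat) set set" where
  "kP_edges k l = {{(j, i), (j, Suc i)} | j i. j < k \<and> Suc i < l}"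

definition ex2 :: "nat \<Rightarrow> 'a set \<Rightarrow> 'a set set \<Rightarrow> 'b set \<Rightarrow> 'b set set \<Rightarrow> nat" where
  "ex2 n V1 E1 V2 E2 = Max {card E | E. graph {0..<n} E \<and>
      \<not> contains {0..<n} E V1 E1 \<and> \<not> contains {0..<n} E V2 E2}"

definition colorable :: "'a set \<Rightarrow> 'a set set \<Rightarrow> nat \<Rightarrow> bool" where
  "colorable V E m \<longleftrightarrow> (\<exists>c. (\<forall>v\<in>V. c v < m) \<and>
      (\<forall>e\<in>E. \<forall>u\<in>e. \<forall>v\<in>e. u \<noteq> v \<longrightarrow> c u \<noteq> c v))"

definition chromatic_number :: "'a set \<Rightarrow> 'a set set \<Rightarrow> nat" where
  "chromatic_number V E = (LEAST m. colorable V E m)"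

definition edge_control_set :: "'a set set \<Rightarrow> 'a set set \<Rightarrow> bool" where
  "edge_control_set E S \<longleftrightarrow> S \<subseteq> E \<and> (\<forall>e\<in>E - S. \<exists>s\<in>S. e \<inter> s \<noteq> {})"

definition beta1 :: "'a set set \<Rightarrow> nat" where
  "beta1 E = (LEAST m. \<exists>S. edge_control_set E S \<and> card S = m)"

definition degree :: "'a set set \<Rightarrow> 'a \<Rightarrow> nat" where
  "degree E v = card {e\<in>E. v \<in> e}"

text \<open>f(F) = min(d(u1), d(u2)) for the edge control set {u1u2} (taken as a minimum over all
  single-edge control sets; under the hypotheses of the theorem the value is unambiguous).\<close>
definition f_val :: "'a set set \<Rightarrow> nat" where
  "f_val E = Min {min (degree E u1) (degree E u2) | u1 u2.
      u1 \<noteq> u2 \<and> edge_control_set E {{u1, u2}}}"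

definition num_triangles :: "'a set \<Rightarrow> 'a set set \<Rightarrow> nat" where
  "num_triangles V E = card {T. T \<subseteq> V \<and> card T = 3 \<and>
      (\<forall>u\<in>T. \<forall>v\<in>T. u \<noteq> v \<longrightarrow> {u, v} \<in> E)}"

definition property_P :: "'a set \<Rightarrow> 'a set set \<Rightarrow> nat \<Rightarrow> nat \<Rightarrow> bool" where
  "property_P V E k l \<longleftrightarrow> even l \<or> card V \<le> k * (l div 2) + 1 \<or>
      (num_triangles V E = 1 \<and> f_val E \<le> k * (l div 2))"

end

(* Put m = l div 2 and s = k m. An edge control set {u v} forces F to be the edge uv together with
   common neighbours of u and v and pendant vertices at u and v; chi(F) >= 3 supplies at least one
   triangle. The lower bound is the complete bipartite graph with s - 1 vertices on the small side:
   a path on l vertices uses m of them. If l is odd, one edge inside the large side creates no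
   kP_l, and it creates F exactly in cases (2) and (3) of the property.

   Upper bound, for a graph H with at least (s - 1)(n - s + 1) edges and no kP_l. Deleting a P_l
   loses so many edges that some m of its vertices have many common neighbours; those m vertices
   can replace a P_l, so they may be split off, and k - 1 rounds give a set U of (k - 1) m vertices
   with H - U free of P_l. Repeatedly discarding vertices of degree < m from H - U leaves only
   components with at most 2m vertices (Dirac), and few of them meet the common neighbourhood W of
   U, because two disjoint P_m starting in W form a P_l with a vertex of U. Counting edges
   then shows that all but a bounded number of vertices lie in W. Let B be the set of vertices
   outside U with many neighbours in W. If |B| >= m, alternating B and U gives kP_l; if |B| < m - 1,
   or if many vertices of W miss a vertex of B, then W spans many edges at bounded degree and
   the resulting disjoint paths in W again complete a kP_l. So A = U + B has s - 1 vertices and many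
   common neighbours. Finally A is independent (otherwise F occurs), and peeling off vertices of
   total degree at most s - 1 leaves at most one edge in the common neighbourhood of A, and no
   such edge if the property holds. *)
theory Submission
  imports Defs
begin

section \<open>Paths and edge counts\<close>

text \<open>The recurring unit is a set of \<open>m\<close> vertices with many common neighbours:
  alternating with \<open>m + 1\<close> of those, it yields a path on \<open>2 * m + 1\<close>
  vertices, which is at least \<open>l\<close>. So \<open>j * m\<close> such linkers are worth
  \<open>j\<close> disjoint paths. The obstacle is odd \<open>l\<close>. There Erdos-Gallai permits
  \<open>m - 1/2\<close> edges per vertex off \<open>U\<close>, whereas the extremal graph has only
  \<open>m - 1\<close>, so the plain bound reveals no structure. Two defects are charged against
  each other: a vertex outside \<open>W\<close> may carry the extra half edge, but it misses at
  least one edge to \<open>U\<close>, a net cost of one half, so the number of such vertices is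
  bounded. Most inequalities are doubled to keep the halves integral, and additive because
  subtraction on \<open>nat\<close> truncates. The error terms are compared with the bound on
  \<open>n\<close> only at the very end, as powers of \<open>k * l\<close>.\<close>

locale sgraph =
  fixes E :: "'v set set"
  assumes card2: "e \<in> E \<Longrightarrow> card e = 2"
begin

abbreviation adj :: "'v \<Rightarrow> 'v \<Rightarrow> bool" where "adj x y \<equiv> {x, y} \<in> E"

definition nb :: "'v set \<Rightarrow> 'v \<Rightarrow> 'v set" where "nb X x = {y \<in> X. adj x y}"

definition ne :: "'v set \<Rightarrow> nat" where "ne X = card {e \<in> E. e \<subseteq> X}"

definition path :: "'v list \<Rightarrow> bool" where "path p \<longleftrightarrow> distinct p \<and> successively adj p"

lemma adj_sym: "adj x y \<longleftrightarrow> adj y x"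
  by (simp add: insert_commute)

lemma adj_irrefl: "\<not> adj x x"
  using card2 by fastforce

lemma finite_nb: "finite X \<Longrightarrow> finite (nb X x)"
  by (simp add: nb_def)

lemma nb_subset: "nb X x \<subseteq> X"
  by (auto simp: nb_def)

lemma nb_mono: "X \<subseteq> Y \<Longrightarrow> nb X x \<subseteq> nb Y x"
  by (auto simp: nb_def)

lemma card_nb_le: "finite X \<Longrightarrow> card (nb X x) \<le> card X"
  by (simp add: card_mono nb_subset)

lemma card_nb_mono: "finite Y \<Longrightarrow> X \<subseteq> Y \<Longrightarrow> card (nb X x) \<le> card (nb Y x)"
  by (simp add: card_mono finite_nb nb_mono)

lemma card_nb_Un: "finite X \<Longrightarrow> finite Y \<Longrightarrow> card (nb (X \<union> Y) x) \<le> card (nb X x) + card (nb Y x)"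
proof -
  assume "finite X" "finite Y"
  have "nb (X \<union> Y) x = nb X x \<union> nb Y x" by (auto simp: nb_def)
  then show ?thesis by (simp add: card_Un_le)
qed

lemma finite_edges: "finite X \<Longrightarrow> finite {e \<in> E. e \<subseteq> X}"
  by (rule finite_subset[of _ "Pow X"]) auto

lemma ne_empty [simp]: "ne {} = 0"
proof -
  have "{e \<in> E. e \<subseteq> {}} = {}" using card2 by fastforce
  then show ?thesis by (simp add: ne_def del: subset_empty)
qed

lemma ne_insert:
  assumes "finite X" "x \<notin> X"
  shows "ne (insert x X) = ne X + card (nb X x)"
proof -
  have eq: "{e \<in> E. e \<subseteq> insert x X} = {e \<in> E. e \<subseteq> X} \<union> (\<lambda>y. {x, y}) ` nb X x" (is "?L = ?R")
  proof
    show "?L \<subseteq> ?R"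
    proof
      fix e assume e: "e \<in> ?L"
      show "e \<in> ?R"
      proof (cases "x \<in> e")
        case True
        from e have "card e = 2" using card2 by auto
        then obtain a b where ab: "e = {a, b}" "a \<noteq> b" by (auto simp: card_2_iff)
        then have "\<exists>y. e = {x, y} \<and> y \<noteq> x" using True by auto
        then obtain y where y: "e = {x, y}" "y \<noteq> x" by auto
        then have "y \<in> nb X x" using e by (auto simp: nb_def)
        then show ?thesis using y by auto
      next
        case False
        then show ?thesis using e by auto
      qed
    qed
    show "?R \<subseteq> ?L" by (auto simp: nb_def)
  qed
  have disj: "{e \<in> E. e \<subseteq> X} \<inter> (\<lambda>y. {x, y}) ` nb X x = {}" using assms by auto
  have inj: "inj_on (\<lambda>y. {x, y}) (nb X x)"
    using assms(2) by (auto simp: inj_on_def nb_def doubleton_eq_iff)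
  show ?thesis
    unfolding ne_def eq
    by (subst card_Un_disjoint[OF finite_edges[OF assms(1)] _ disj])
       (auto simp: finite_nb assms card_image[OF inj])
qed

lemma ne_remove:
  assumes "finite X" "x \<in> X"
  shows "ne X = ne (X - {x}) + card (nb (X - {x}) x)"
  using ne_insert[of "X - {x}" x] assms by (simp add: insert_absorb)

lemma nb_remove_self: "nb (X - {x}) x = nb X x"
  using adj_irrefl by (auto simp: nb_def)

lemma ne_Un:
  assumes "finite X" "finite Y" "X \<inter> Y = {}"
  shows "ne (X \<union> Y) = ne X + ne Y + (\<Sum>y\<in>Y. card (nb X y))"
  using assms(2,3)
proof (induction Y rule: finite_induct)
  case empty
  then show ?case by simp
next
  case (insert y Y)
  have "nb (X \<union> Y) y = nb X y \<union> nb Y y" "nb X y \<inter> nb Y y = {}"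
    using insert.prems by (auto simp: nb_def)
  then have c: "card (nb (X \<union> Y) y) = card (nb X y) + card (nb Y y)"
    by (simp add: card_Un_disjoint finite_nb assms insert.hyps)
  have "ne (X \<union> insert y Y) = ne (X \<union> Y) + card (nb (X \<union> Y) y)"
    using insert assms by (simp add: ne_insert)
  then show ?case using insert c by (simp add: ne_insert)
qed

lemma ne_le: "finite X \<Longrightarrow> 2 * ne X \<le> card X * (card X - 1)"
proof (induction X rule: finite_induct)
  case empty
  then show ?case by simp
next
  case (insert x X)
  have "card (nb X x) \<le> card X" using insert card_nb_le by blast
  then have "2 * ne (insert x X) \<le> card X * (card X - 1) + 2 * card X"
    using insert by (simp add: ne_insert)
  also have "\<dots> = card (insert x X) * (card (insert x X) - 1)"
    using insert by (cases "card X") (auto simp: algebra_simps)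
  finally show ?case .
qed

section \<open>Paths as vertex lists\<close>

lemma path_Nil [simp]: "path []" by (simp add: path_def)

lemma path_single [simp]: "path [x]" by (simp add: path_def)

lemma path_Cons: "path (x # p) \<longleftrightarrow> x \<notin> set p \<and> path p \<and> (p = [] \<or> adj x (hd p))"
  by (cases p) (auto simp: path_def)

lemma path_append:
  "path (p @ q) \<longleftrightarrow> path p \<and> path q \<and> set p \<inter> set q = {} \<and>
     (p = [] \<or> q = [] \<or> adj (last p) (hd q))"
  by (auto simp: path_def successively_append_iff)

lemma path_rev [simp]: "path (rev p) \<longleftrightarrow> path p"
  by (simp add: path_def adj_sym)

lemma path_take: "path p \<Longrightarrow> path (take n p)"
  using path_append[of "take n p" "drop n p"] by simp

lemma path_drop: "path p \<Longrightarrow> path (drop n p)"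
  using path_append[of "take n p" "drop n p"] by simp

lemma path_length: "path p \<Longrightarrow> length p = card (set p)"
  by (simp add: path_def distinct_card)

text \<open>A longest path closes up to a cycle when the minimum degree is at least half its
  number of vertices (Dirac, Posa), and maximality makes that cycle span a component.\<close>
lemma component_of_short_paths:
  assumes ne: "X \<noteq> {}"
    and deg: "\<And>x. x \<in> X \<Longrightarrow> d \<le> card (nb X x)"
    and short: "\<And>p. path p \<Longrightarrow> set p \<subseteq> X \<Longrightarrow> length p \<le> 2 * d"
  obtains K where "K \<subseteq> X" "K \<noteq> {}" "\<And>x. x \<in> K \<Longrightarrow> nb X x \<subseteq> K"
    "\<And>w. w \<in> K \<Longrightarrow> \<exists>p. path p \<and> set p = K \<and> hd p = w"
proof -
  define Q where "Q = (\<lambda>p. path p \<and> set p \<subseteq> X)"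
  obtain x0 where "x0 \<in> X" using ne by auto
  then have "Q [x0]" by (simp add: Q_def)
  then obtain p where p: "Q p" and pmax: "\<And>q. Q q \<Longrightarrow> length q \<le> length p"
    using ex_has_greatest_nat[of Q "[x0]" length "2 * d + 1"] short
    unfolding Q_def by (metis less_Suc_eq_le Suc_eq_plus1)
  have pp: "path p" "set p \<subseteq> X" "distinct p" using p by (auto simp: Q_def path_def)
  have "length p \<ge> 1" using pmax[OF \<open>Q [x0]\<close>] by simp
  then have pne: "p \<noteq> []" by auto
  have hdn: "nb X (hd p) \<subseteq> set p"
  proof
    fix y assume y: "y \<in> nb X (hd p)"
    show "y \<in> set p"
    proof (rule ccontr)
      assume "y \<notin> set p"
      then have "Q (y # p)" using y pp pne by (auto simp: Q_def path_Cons nb_def adj_sym[of y])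
      from pmax[OF this] show False by simp
    qed
  qed
  have lastn: "nb X (last p) \<subseteq> set p"
  proof
    fix y assume y: "y \<in> nb X (last p)"
    show "y \<in> set p"
    proof (rule ccontr)
      assume "y \<notin> set p"
      then have "Q (p @ [y])" using y pp pne by (auto simp: Q_def path_append nb_def)
      from pmax[OF this] show False by simp
    qed
  qed
  let ?q = "length p"
  \<comment> \<open>Crossing argument: both index sets lie in \<open>{..<?q - 1}\<close>, which has
    at most \<open>2 * d - 1\<close> elements, and each has at least \<open>d\<close>, so they meet.
    At a common \<open>i\<close>, the edges from \<open>hd p\<close> to \<open>p ! Suc i\<close> and
    from \<open>last p\<close> to \<open>p ! i\<close> replace the path edge between positions
    \<open>i\<close> and \<open>Suc i\<close> and close a cycle.\<close>
  define I1 where "I1 = {i. Suc i < ?q \<and> adj (hd p) (p ! Suc i)}"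
  define I2 where "I2 = {i. Suc i < ?q \<and> adj (last p) (p ! i)}"
  have fI3: "I1 \<subseteq> {..<?q - 1}" "I2 \<subseteq> {..<?q - 1}" unfolding I1_def I2_def by auto
  then have fI: "finite I1" "finite I2" "I1 \<union> I2 \<subseteq> {..<?q - 1}"
    using finite_subset[OF fI3(1)] finite_subset[OF fI3(2)] by auto
  have "nb X (hd p) \<subseteq> (\<lambda>i. p ! Suc i) ` I1"
  proof
    fix y assume y: "y \<in> nb X (hd p)"
    then have "y \<in> set p" using hdn by auto
    then obtain j where j: "j < ?q" "p ! j = y" by (auto simp: in_set_conv_nth)
    have "y \<noteq> hd p" using y adj_irrefl by (auto simp: nb_def)
    then have "j \<noteq> 0" using j(2) hd_conv_nth[OF pne] by metis
    then obtain i where "j = Suc i" by (cases j) auto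
    then show "y \<in> (\<lambda>i. p ! Suc i) ` I1" using j y by (auto simp: I1_def nb_def)
  qed
  then have c1: "d \<le> card I1"
    using deg[of "hd p"] pp pne fI surj_card_le[of I1 "nb X (hd p)"] hd_in_set[OF pne]
    by (metis le_trans subsetD)
  have "nb X (last p) \<subseteq> (\<lambda>i. p ! i) ` I2"
  proof
    fix y assume y: "y \<in> nb X (last p)"
    then have "y \<in> set p" using lastn by auto
    then obtain j where j: "j < ?q" "p ! j = y" by (auto simp: in_set_conv_nth)
    have "y \<noteq> last p" using y adj_irrefl by (auto simp: nb_def)
    then have "j \<noteq> ?q - 1" using j(2) last_conv_nth[OF pne] by metis
    then show "y \<in> (\<lambda>i. p ! i) ` I2" using j y by (auto simp: I2_def nb_def)
  qed
  then have c2: "d \<le> card I2"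
    using deg[of "last p"] pp pne fI surj_card_le[of I2 "nb X (last p)"] last_in_set[OF pne]
    by (metis le_trans subsetD)
  have "I1 \<inter> I2 \<noteq> {}"
  proof
    assume "I1 \<inter> I2 = {}"
    then have "card (I1 \<union> I2) = card I1 + card I2" using fI by (simp add: card_Un_disjoint)
    then have "2 * d \<le> ?q - 1" using c1 c2 card_mono[OF _ fI(3)] by simp
    then show False using short[OF pp(1,2)] pne by (cases p) auto
  qed
  then obtain i where i: "Suc i < ?q" "adj (hd p) (p ! Suc i)" "adj (last p) (p ! i)"
    by (auto simp: I1_def I2_def)
  define c where "c = take (Suc i) p @ rev (drop (Suc i) p)"
  have t: "take (Suc i) p \<noteq> []" "drop (Suc i) p \<noteq> []"
    "last (take (Suc i) p) = p ! i" "hd (drop (Suc i) p) = p ! Suc i"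
    "last (drop (Suc i) p) = last p" "hd (take (Suc i) p) = hd p"
  proof -
    show a: "take (Suc i) p \<noteq> []" using pne by simp
    show "drop (Suc i) p \<noteq> []" using i(1) by simp
    show "last (take (Suc i) p) = p ! i" using i(1) by (simp add: take_Suc_conv_app_nth)
    show "hd (drop (Suc i) p) = p ! Suc i" by (rule hd_drop_conv_nth[OF i(1)])
    show "last (drop (Suc i) p) = last p" using i(1) by simp
    show "hd (take (Suc i) p) = hd p" by simp
  qed
  have sc: "set c = set p"
    unfolding c_def by (metis append_take_drop_id set_append set_rev)
  have pc: "path c"
  proof -
    have "set (take (Suc i) p) \<inter> set (drop (Suc i) p) = {}"
      using pp(3) by (metis append_take_drop_id distinct_append)
    then show ?thesis
      unfolding c_def path_append
      using pp t i by (auto simp: path_take path_drop hd_rev adj_sym[of _ "last p"])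
  qed
  have close: "adj (last c) (hd c)"
    unfolding c_def using t i by (simp add: last_rev adj_sym[of _ "hd p"])
  have rot: "\<exists>r. path r \<and> set r = set p \<and> hd r = w" if w: "w \<in> set p" for w
  proof -
    have "w \<in> set c" using w sc by simp
    then obtain xs ys where xy: "c = xs @ w # ys" by (meson split_list)
    have "path (w # ys @ xs)"
    proof (cases "xs = []")
      case True
      then show ?thesis using pc xy by simp
    next
      case False
      then have 1: "path xs" "path (w # ys)" "set xs \<inter> set (w # ys) = {}"
        using pc[unfolded xy path_append] by simp_all
      have 2: "adj (last (w # ys)) (hd xs)"
        using close[unfolded xy] False by (simp only: last_append hd_append if_False list.simps)
      have "path ((w # ys) @ xs)" unfolding path_append using 1 2 by (simp add: Int_commute)
      then show ?thesis by simp
    qed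
    moreover have "set (w # ys @ xs) = set p" using sc xy by auto
    moreover have "hd (w # ys @ xs) = w" by simp
    ultimately show ?thesis by blast
  qed
  show thesis
  proof (rule that[of "set p"])
    show "set p \<subseteq> X" "set p \<noteq> {}" using pp pne by auto
    show "\<exists>r. path r \<and> set r = set p \<and> hd r = w" if "w \<in> set p" for w using rot that .
    show "nb X x \<subseteq> set p" if x: "x \<in> set p" for x
    proof
      fix y assume y: "y \<in> nb X x"
      show "y \<in> set p"
      proof (rule ccontr)
        assume ny: "y \<notin> set p"
        obtain r where r: "path r" "set r = set p" "hd r = x" using rot[OF x] by auto
        have "Q (y # r)" using y ny r pp by (auto simp: Q_def path_Cons nb_def adj_sym[of y])
        from pmax[OF this] have "Suc (length r) \<le> length p" by simp
        moreover have "length r = length p" using r pp path_length by metis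
        ultimately show False by simp
      qed
    qed
  qed
qed

section \<open>The Erdos-Gallai bound\<close>

lemma ne_closed:
  assumes fin: "finite X" and K: "K \<subseteq> X" "\<And>x. x \<in> K \<Longrightarrow> nb X x \<subseteq> K"
  shows "ne X = ne K + ne (X - K)"
proof -
  have "nb K y = {}" if "y \<in> X - K" for y
  proof -
    have False if z: "z \<in> nb K y" for z
    proof -
      have "z \<in> K" "adj z y" using z adj_sym[of y z] by (auto simp: nb_def)
      then have "y \<in> nb X z" using \<open>y \<in> X - K\<close> by (auto simp: nb_def)
      with \<open>z \<in> K\<close> show False using K(2) \<open>y \<in> X - K\<close> by blast
    qed
    then show ?thesis by blast
  qed
  then have "(\<Sum>y\<in>X - K. card (nb K y)) = 0" by simp
  moreover have "ne (K \<union> (X - K)) = ne K + ne (X - K) + (\<Sum>y\<in>X - K. card (nb K y))"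
    using fin K(1) by (intro ne_Un) (auto intro: finite_subset)
  moreover have "K \<union> (X - K) = X" using K(1) by auto
  ultimately show ?thesis by simp
qed

text \<open>A vertex with at most \<open>(p - 2) div 2\<close> neighbours can be deleted; if there
  is none, a component \<open>K\<close> on fewer than \<open>p\<close> vertices splits off, and
  there even the complete graph obeys the bound.\<close>

lemma erdos_gallai:
  assumes "finite X" "2 \<le> p" "\<And>q. path q \<Longrightarrow> set q \<subseteq> X \<Longrightarrow> length q \<noteq> p"
  shows "2 * ne X \<le> (p - 2) * card X"
  using assms(1,3)
proof (induction "card X" arbitrary: X rule: less_induct)
  case less
  show ?case
  proof (cases "X = {}")
    case True
    then show ?thesis by simp
  next
    case ne: False
    \<comment> \<open>The least integer above \<open>(p - 2) / 2\<close>. For either parity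
      \<open>p - 1 \<le> 2 * ?d\<close>, as the component lemma asks of path lengths.\<close>
    let ?d = "(p - 2) div 2 + 1"
    have short: "length q < p" if "path q" "set q \<subseteq> X" for q
    proof (rule ccontr)
      assume "\<not> length q < p"
      then have "length (take p q) = p" by simp
      moreover have "set (take p q) \<subseteq> X" using that set_take_subset[of p q] by auto
      ultimately show False using less.prems(2) path_take that by blast
    qed
    show ?thesis
    proof (cases "\<exists>x\<in>X. card (nb X x) < ?d")
      case True
      then obtain x where x: "x \<in> X" "card (nb X x) < ?d" by auto
      have "card (X - {x}) < card X" using x less.prems by (meson card_Diff1_less)
      then have "2 * ne (X - {x}) \<le> (p - 2) * card (X - {x})"
        using less by (meson Diff_subset finite_Diff subset_trans)
      moreover have "ne X = ne (X - {x}) + card (nb X x)"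
        using ne_remove[of X x] x less.prems by (simp add: nb_remove_self)
      moreover have "2 * card (nb X x) \<le> p - 2" using x(2) by linarith
      moreover have "card X = Suc (card (X - {x}))"
        using x less.prems by (metis card.remove)
      ultimately show ?thesis by simp
    next
      case False
      then have deg: "\<And>x. x \<in> X \<Longrightarrow> ?d \<le> card (nb X x)" by (auto simp: not_less)
      have sh: "length q \<le> 2 * ?d" if "path q" "set q \<subseteq> X" for q
        using short[OF that] assms(2) by presburger
      obtain K where K: "K \<subseteq> X" "K \<noteq> {}" "\<And>x. x \<in> K \<Longrightarrow> nb X x \<subseteq> K"
        "\<And>w. w \<in> K \<Longrightarrow> \<exists>p. path p \<and> set p = K \<and> hd p = w"
        using component_of_short_paths[OF ne deg sh] by metis
      have fK: "finite K" using K(1) less.prems(1) finite_subset by blast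
      obtain w where "w \<in> K" using K(2) by auto
      then obtain r where r: "path r" "set r = K" using K(4) by blast
      then have cK: "card K < p" using short K(1) path_length by metis
      have "card (X - K) < card X"
        using K(1,2) less.prems(1) by (metis Diff_subset card_seteq double_diff finite_Diff leI subset_refl Diff_empty Diff_disjoint inf.absorb2)
      then have "2 * ne (X - K) \<le> (p - 2) * card (X - K)"
        using less by (meson Diff_subset finite_Diff subset_trans)
      moreover have "2 * ne K \<le> (p - 2) * card K"
      proof -
        have "2 * ne K \<le> card K * (card K - 1)" using ne_le[OF fK] .
        also have "\<dots> \<le> card K * (p - 2)" using cK by (intro mult_le_mono2) linarith
        finally show ?thesis by (simp add: mult.commute)
      qed
      moreover have "ne X = ne K + ne (X - K)" using ne_closed[OF less.prems(1) K(1,3)] .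
      moreover have "card X = card K + card (X - K)"
        using K(1) less.prems(1) fK by (metis card_Diff_subset card_mono le_add_diff_inverse)
      ultimately show ?thesis by (simp add: algebra_simps)
    qed
  qed
qed

end

section \<open>Disjoint paths through vertices with common neighbours\<close>

lemma ex_in_not_in:
  assumes "finite X" "card X < card A"
  shows "\<exists>w. w \<in> A \<and> w \<notin> X"
  using assms card_mono[of X A] by (metis leD subsetI)

primrec packs :: "('v list \<Rightarrow> bool) \<Rightarrow> nat \<Rightarrow> 'v set \<Rightarrow> bool" where
  "packs Q 0 Y \<longleftrightarrow> True"
| "packs Q (Suc j) Y \<longleftrightarrow> (\<exists>p. Q p \<and> set p \<subseteq> Y \<and> packs Q j (Y - set p))"

lemma packs_mono: "packs Q j Y \<Longrightarrow> Y \<subseteq> Y' \<Longrightarrow> packs Q j Y'"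
proof (induction j arbitrary: Y Y')
  case 0
  then show ?case by simp
next
  case (Suc j)
  then obtain p where "Q p" "set p \<subseteq> Y" "packs Q j (Y - set p)" by auto
  moreover have "Y - set p \<subseteq> Y' - set p" using Suc.prems by auto
  ultimately show ?case using Suc by (auto intro!: exI[of _ p])
qed

lemma packs_Suc_imp: "packs Q (Suc j) Y \<Longrightarrow> packs Q j Y"
  using packs_mono[of Q j "Y - set p" Y for p] by auto

lemma packs_le: "packs Q j Y \<Longrightarrow> i \<le> j \<Longrightarrow> packs Q i Y"
proof (induction j)
  case (Suc j)
  then show ?case using packs_Suc_imp by (metis le_SucE)
qed simp

lemma packs_weaken: "packs Q j Y \<Longrightarrow> (\<And>p. Q p \<Longrightarrow> set p \<subseteq> Y \<Longrightarrow> Q' p) \<Longrightarrow> packs Q' j Y"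
proof (induction j arbitrary: Y)
  case (Suc j)
  then obtain p where p: "Q p" "set p \<subseteq> Y" "packs Q j (Y - set p)" by auto
  have "packs Q' j (Y - set p)" using Suc.IH[OF p(3)] Suc.prems(2) by blast
  then show ?case using p Suc.prems(2) by auto
qed simp

text \<open>A packing occupies few vertices, so a further path can be routed around it inside a
  large common neighbourhood, whatever the packing looks like.\<close>

lemma packs_support:
  "packs Q j Y \<Longrightarrow> (\<And>p. Q p \<Longrightarrow> length p \<le> c) \<Longrightarrow>
    \<exists>S\<subseteq>Y. finite S \<and> card S \<le> j * c \<and> packs Q j S"
proof (induction j arbitrary: Y)
  case 0
  then show ?case by (intro exI[of _ "{}"]) auto
next
  case (Suc j)
  then obtain p where p: "Q p" "set p \<subseteq> Y" "packs Q j (Y - set p)" by auto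
  obtain S where S: "S \<subseteq> Y - set p" "finite S" "card S \<le> j * c" "packs Q j S"
    using Suc.IH[OF p(3) Suc.prems(2)] by auto
  have "card (S \<union> set p) \<le> j * c + c"
    using card_Un_le[of S "set p"] S(3) Suc.prems(2)[OF p(1)] card_length[of p] by linarith
  moreover have "S \<union> set p - set p = S" using S by auto
  ultimately have "S \<union> set p \<subseteq> Y \<and> finite (S \<union> set p) \<and> card (S \<union> set p) \<le> Suc j * c
      \<and> packs Q (Suc j) (S \<union> set p)"
    using S p by (auto intro!: exI[of _ p])
  then show ?case by blast
qed

section \<open>Packings of paths built from linkers\<close>

context sgraph
begin

abbreviation lpath :: "nat \<Rightarrow> 'v list \<Rightarrow> bool" where
  "lpath l p \<equiv> path p \<and> length p = l"

abbreviation kpaths :: "nat \<Rightarrow> nat \<Rightarrow> 'v set \<Rightarrow> bool" where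
  "kpaths l \<equiv> packs (lpath l)"

text \<open>The constructions often deliver paths on \<open>2 * m + 1\<close> vertices regardless of
  parity; for even \<open>l\<close> the surplus is cut off here.\<close>

lemma kpaths_Suc:
  assumes "path p" "l \<le> length p" "set p \<subseteq> Y" "kpaths l j (Y - set p)"
  shows "kpaths l (Suc j) Y"
proof -
  have s: "set (take l p) \<subseteq> set p" by (rule set_take_subset)
  then have "kpaths l j (Y - set (take l p))" using packs_mono[OF assms(4)] by (simp add: Diff_mono)
  moreover have "lpath l (take l p)" using assms by (simp add: path_take)
  ultimately show ?thesis
    using s assms(3) unfolding packs.simps by (intro exI[of _ "take l p"]) blast
qed

text \<open>Only consecutive vertices must share neighbours. This matters: two vertices of
  \<open>B\<close> may have no common neighbour, and a vertex of \<open>U\<close> is then placed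
  between them.\<close>

definition linked :: "nat \<Rightarrow> 'v set \<Rightarrow> 'v list \<Rightarrow> bool" where
  "linked N W = successively (\<lambda>a b. N \<le> card (nb W a \<inter> nb W b))"

text \<open>Connectors are chosen greedily from the last vertex backwards. Fewer than
  \<open>length as\<close> connectors and the set \<open>X \<inter> W\<close> are blocked, so
  \<open>N\<close> candidates suffice. \<open>X\<close> records what other paths occupy.\<close>

lemma chain:
  assumes "as \<noteq> []" "distinct as" "finite W" "set as \<inter> W = {}" "linked N W as"
    "finite X" "card (X \<inter> W) + length as \<le> N"
  shows "\<exists>p. path p \<and> hd p = hd as \<and> last p = last as \<and> length p = 2 * length as - 1 \<and>
    set as \<subseteq> set p \<and> set p \<subseteq> set as \<union> (W - X)"
  using assms
proof (induction as)
  case Nil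
  then show ?case by simp
next
  case (Cons a bs)
  show ?case
  proof (cases bs)
    case Nil
    then show ?thesis by (intro exI[of _ "[a]"]) auto
  next
    case (Cons b cs)
    have l: "linked N W bs" "N \<le> card (nb W a \<inter> nb W b)"
      using Cons.prems(5) unfolding Cons linked_def by auto
    obtain q where q: "path q" "hd q = hd bs" "last q = last bs" "length q = 2 * length bs - 1"
      "set bs \<subseteq> set q" "set q \<subseteq> set bs \<union> (W - X)"
      using Cons.IH Cons.prems l(1) Cons by auto
    have qne: "q \<noteq> []" using q(4) Cons by auto
    have "card (set q \<inter> W) + card (set bs) \<le> card (set q)"
    proof -
      have "card (set q \<inter> W) + card (set bs) = card ((set q \<inter> W) \<union> set bs)"
        using Cons.prems by (subst card_Un_disjoint) auto
      also have "\<dots> \<le> card (set q)" using q(5) by (intro card_mono) auto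
      finally show ?thesis .
    qed
    moreover have "card (set bs) = length bs" using Cons.prems by (simp add: distinct_card)
    moreover have "card (set q) = 2 * length bs - 1" using q path_length by metis
    ultimately have cq: "card (set q \<inter> W) < length bs" using Cons by simp
    have "card ((X \<inter> W) \<union> (set q \<inter> W)) < card (nb W a \<inter> nb W b)"
      using card_Un_le[of "X \<inter> W" "set q \<inter> W"] cq l(2) Cons.prems(7) by simp
    then obtain w where w: "w \<in> nb W a \<inter> nb W b" "w \<notin> (X \<inter> W) \<union> (set q \<inter> W)"
      using ex_in_not_in[of "(X \<inter> W) \<union> (set q \<inter> W)" "nb W a \<inter> nb W b"] Cons.prems(6) by auto
    then have w': "w \<in> W" "adj a w" "adj w b" "w \<notin> X" "w \<notin> set q"
      using adj_sym[of b w] by (auto simp: nb_def)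
    have "a \<notin> set q" using q(6) Cons.prems(2,4) by auto
    then have "path (a # w # q)" using w' q qne Cons Cons.prems(4) by (auto simp: path_Cons)
    moreover have "last (a # w # q) = last (a # bs)" using q qne Cons by simp
    moreover have "length (a # w # q) = 2 * length (a # bs) - 1" using q Cons by simp
    moreover have "set (a # bs) \<subseteq> set (a # w # q)" "set (a # w # q) \<subseteq> set (a # bs) \<union> (W - X)"
      using q w' by auto
    ultimately show ?thesis by (intro exI[of _ "a # w # q"]) simp
  qed
qed

text \<open>A free vertex of \<open>W\<close> is added at either end; with \<open>m\<close> linkers
  the result has \<open>2 * m + 1\<close> vertices.\<close>

lemma chain_ends:
  assumes "as \<noteq> []" "distinct as" "finite W" "set as \<inter> W = {}" "linked N W as"
    "finite X" "card (X \<inter> W) + length as + 1 \<le> N"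
    "\<And>a. a \<in> set as \<Longrightarrow> N \<le> card (nb W a)"
  shows "\<exists>p. path p \<and> length p = 2 * length as + 1 \<and>
    set as \<subseteq> set p \<and> set p \<subseteq> set as \<union> (W - X)"
proof -
  obtain p where p: "path p" "hd p = hd as" "last p = last as" "length p = 2 * length as - 1"
      "set as \<subseteq> set p" "set p \<subseteq> set as \<union> (W - X)"
    using chain[OF assms(1-6)] assms(7) by auto
  have pne: "p \<noteq> []" using p(4) assms(1) by (cases as) auto
  have "card (set p \<inter> W) + card (set as) \<le> card (set p)"
  proof -
    have "card (set p \<inter> W) + card (set as) = card ((set p \<inter> W) \<union> set as)"
      using assms by (subst card_Un_disjoint) auto
    also have "\<dots> \<le> card (set p)" using p(5) by (intro card_mono) auto
    finally show ?thesis .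
  qed
  moreover have "card (set as) = length as" using assms by (simp add: distinct_card)
  moreover have "card (set p) = 2 * length as - 1" using p path_length by metis
  ultimately have cp: "card (set p \<inter> W) + 1 \<le> length as" using assms(1) by (cases as) auto
  let ?Z = "(X \<inter> W) \<union> (set p \<inter> W)"
  have cZ: "card ?Z + 2 \<le> N" using card_Un_le[of "X \<inter> W" "set p \<inter> W"] cp assms(7) by linarith
  have fZ: "finite ?Z" using assms(6) by auto
  have "hd as \<in> set as" "last as \<in> set as" using assms(1) by auto
  then have N: "N \<le> card (nb W (hd as))" "N \<le> card (nb W (last as))" using assms(8) by auto
  obtain w where w: "w \<in> nb W (hd as)" "w \<notin> ?Z"
    using ex_in_not_in[OF fZ, of "nb W (hd as)"] cZ N by auto
  have "card (insert w ?Z) < card (nb W (last as))"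
    using cZ N fZ card_insert_le_m1[of "card ?Z + 1" ?Z w] by (simp add: card_insert_if)
  then obtain w' where w': "w' \<in> nb W (last as)" "w' \<notin> insert w ?Z"
    using ex_in_not_in[of "insert w ?Z" "nb W (last as)"] fZ by auto
  have ww: "w \<in> W" "w \<notin> X" "w \<notin> set p" "adj (hd as) w" "w' \<in> W" "w' \<notin> X" "w' \<notin> set p"
    "adj (last as) w'" "w \<noteq> w'"
    using w w' by (auto simp: nb_def)
  then have "path (w # p @ [w'])"
    using p pne adj_sym[of "hd as" w] by (auto simp: path_Cons path_append)
  then show ?thesis
    using p ww assms(1) by (intro exI[of _ "w # p @ [w']"]) (cases as; auto)
qed

text \<open>The list is cut into consecutive blocks of \<open>m\<close>. Each consumes at most
  \<open>m + 1\<close> vertices of \<open>W\<close>, which accounts for the reserve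
  \<open>j * (m + 1)\<close>.\<close>

lemma blocks:
  assumes "length as = j * m" "1 \<le> m" "l \<le> 2 * m + 1" "distinct as" "finite W"
    "set as \<inter> W = {}" "linked N W as" "\<And>a. a \<in> set as \<Longrightarrow> N \<le> card (nb W a)"
    "finite X" "set as \<inter> X = {}" "card (X \<inter> W) + j * (m + 1) \<le> N"
  shows "kpaths l j ((set as \<union> W) - X)"
  using assms(1,4,6-11)
proof (induction j arbitrary: as X)
  case 0
  then show ?case by simp
next
  case (Suc j)
  let ?a = "take m as" and ?b = "drop m as"
  have la: "length ?a = m" "length ?b = j * m" using Suc.prems(1) by auto
  have ab: "as = ?a @ ?b" by simp
  have sub: "set ?a \<subseteq> set as" "set ?b \<subseteq> set as" by (auto dest: in_set_takeD in_set_dropD)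
  have dis: "set ?a \<inter> set ?b = {}" "distinct ?a" "distinct ?b"
    using Suc.prems(2) ab by (metis distinct_append)+
  have lk: "linked N W ?a" "linked N W ?b"
    using Suc.prems(4) ab unfolding linked_def by (metis successively_append_iff)+
  have "\<exists>p. path p \<and> length p = 2 * length ?a + 1 \<and> set ?a \<subseteq> set p \<and> set p \<subseteq> set ?a \<union> (W - X)"
  proof (rule chain_ends[OF _ dis(2) assms(5) _ lk(1) Suc.prems(6)])
    show "?a \<noteq> []" using la(1) assms(2) by auto
    show "set ?a \<inter> W = {}" using sub Suc.prems(3) by auto
    show "card (X \<inter> W) + length ?a + 1 \<le> N" using Suc.prems(8) la by simp
    show "N \<le> card (nb W a)" if "a \<in> set ?a" for a using that sub Suc.prems(5) by blast
  qed
  then obtain p where p: "path p" "length p = 2 * m + 1" "set ?a \<subseteq> set p"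
    "set p \<subseteq> set ?a \<union> (W - X)" using la(1) by auto
  have cp: "card (set p \<inter> W) \<le> m + 1"
  proof -
    have "card (set p \<inter> W) + card (set ?a) = card ((set p \<inter> W) \<union> set ?a)"
      using Suc.prems(3) sub by (subst card_Un_disjoint) auto
    also have "\<dots> \<le> card (set p)" using p(3) by (intro card_mono) auto
    finally have "card (set p \<inter> W) + card (set ?a) \<le> 2 * m + 1"
      using p path_length by metis
    moreover have "card (set ?a) = m" using la(1) dis(2) by (simp only: distinct_card)
    ultimately show ?thesis by simp
  qed
  have "kpaths l j ((set ?b \<union> W) - (X \<union> set p))"
  proof (rule Suc.IH[OF la(2) dis(3) _ lk(2)])
    show "set ?b \<inter> W = {}" using sub Suc.prems(3) by auto
    show "N \<le> card (nb W a)" if "a \<in> set ?b" for a using that sub Suc.prems(5) by blast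
    show "finite (X \<union> set p)" using Suc.prems(6) by simp
    show "set ?b \<inter> (X \<union> set p) = {}" using sub p(4) dis(1) Suc.prems(3,7) by blast
    have "(X \<union> set p) \<inter> W = (X \<inter> W) \<union> (set p \<inter> W)" by auto
    then show "card ((X \<union> set p) \<inter> W) + j * (m + 1) \<le> N"
      using card_Un_le[of "X \<inter> W" "set p \<inter> W"] cp Suc.prems(8) by simp
  qed
  then have "kpaths l j (((set as \<union> W) - X) - set p)"
    by (rule packs_mono) (use sub in auto)
  moreover have "set p \<subseteq> (set as \<union> W) - X" using p(4) sub Suc.prems(7) by auto
  ultimately show ?case using kpaths_Suc[of p l] p assms(3) by auto
qed

lemma path_kpaths:
  assumes "path p" "length p = j * l" "set p \<subseteq> Y"
  shows "kpaths l j Y"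
  using assms
proof (induction j arbitrary: p Y)
  case 0
  then show ?case by simp
next
  case (Suc j)
  let ?a = "take l p" and ?b = "drop l p"
  have ab: "p = ?a @ ?b" by simp
  have dis: "set ?a \<inter> set ?b = {}" using Suc.prems(1) ab by (metis path_append)
  have "kpaths l j (Y - set ?a)"
    using Suc.prems dis by (intro Suc.IH[of ?b]) (auto simp: path_drop dest: in_set_dropD)
  moreover have "set ?a \<subseteq> Y" using Suc.prems by (auto dest: in_set_takeD)
  ultimately show ?case using Suc.prems by (auto simp: path_take intro!: exI[of _ ?a])
qed

section \<open>Common neighbourhoods and greedy packing\<close>

definition cn :: "'v set \<Rightarrow> 'v set \<Rightarrow> 'v set" where
  "cn Z S = {z \<in> Z. \<forall>s\<in>S. adj s z}"

text \<open>Pigeonhole: each vertex of \<open>Z\<close> with \<open>m\<close> neighbours in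
  \<open>P\<close> is a common neighbour of some \<open>m\<close>-subset of \<open>P\<close>, and
  there are only \<open>card P choose m\<close> of these.\<close>

lemma common_neighbours:
  assumes "finite P" "finite Z" "m \<le> card P"
    "h * (card P choose m) \<le> card {z \<in> Z. m \<le> card (nb P z)}"
  shows "\<exists>S\<subseteq>P. card S = m \<and> h \<le> card (cn Z S)"
proof (rule ccontr)
  assume neg: "\<not> ?thesis"
  define Z1 where "Z1 = {z \<in> Z. m \<le> card (nb P z)}"
  define F where "F = {S. S \<subseteq> P \<and> card S = m}"
  have fF: "finite F" unfolding F_def using assms(1) by auto
  have cF: "card F = card P choose m" unfolding F_def using n_subsets[OF assms(1)] .
  have fZ1: "finite Z1" using assms(2) by (simp add: Z1_def)
  have small: "card (cn Z S) < h" if "S \<in> F" for S using neg that by (auto simp: F_def)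
  have "Z1 \<subseteq> (\<Union>S\<in>F. cn Z S)"
  proof
    fix z assume z: "z \<in> Z1"
    then obtain S where S: "S \<subseteq> nb P z" "card S = m"
      unfolding Z1_def by (metis (mono_tags, lifting) mem_Collect_eq obtain_subset_with_card_n)
    then have "S \<in> F" "z \<in> cn Z S" using z adj_sym[of z] by (auto simp: F_def nb_def cn_def Z1_def)
    then show "z \<in> (\<Union>S\<in>F. cn Z S)" by blast
  qed
  then have "card Z1 \<le> card (\<Union>S\<in>F. cn Z S)"
    using assms(2) fF by (intro card_mono) (auto simp: cn_def)
  also have "\<dots> \<le> (\<Sum>S\<in>F. card (cn Z S))" by (rule card_UN_le[OF fF])
  also have "\<dots> < (\<Sum>S\<in>F. h)"
  proof (rule sum_strict_mono[OF fF])
    have "card F > 0" using cF assms(3) by simp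
    then show "F \<noteq> {}" by auto
  qed (use small in auto)
  finally show False using assms(4) cF by (simp add: Z1_def mult.commute)
qed

lemma ne_remove_deg:
  assumes "finite X" "S \<subseteq> X" "\<And>x. x \<in> S \<Longrightarrow> card (nb X x) \<le> D"
  shows "ne X \<le> ne (X - S) + D * card S"
proof -
  have "finite S" using assms finite_subset by blast
  then show ?thesis using assms(2,3)
  proof (induction S rule: finite_induct)
    case empty
    then show ?case by simp
  next
    case (insert x S)
    have "ne (X - S) = ne (X - S - {x}) + card (nb (X - S - {x}) x)"
      using insert assms(1) by (intro ne_remove) auto
    moreover have "card (nb (X - S - {x}) x) \<le> card (nb X x)"
      by (rule card_nb_mono[OF assms(1)]) auto
    moreover have "X - S - {x} = X - insert x S" by auto
    moreover have "card (nb X x) \<le> D" "ne X \<le> ne (X - S) + D * card S" using insert by auto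
    ultimately show ?case using insert.hyps by simp
  qed
qed

lemma ne_remove_set:
  assumes "finite X" "S \<subseteq> X"
  shows "ne X \<le> ne (X - S) + card S * card X"
  using ne_remove_deg[OF assms card_nb_le[OF assms(1)]] by (simp add: mult.commute)

text \<open>Deleting a path on \<open>q\<close> vertices costs at most \<open>q * D\<close> edges;
  the surplus \<open>2 * j * q * D\<close> over the doubled Erdos-Gallai bound pays for
  \<open>j\<close> deletions.\<close>

lemma bounded_degree_packs:
  assumes "finite X" "\<And>x. x \<in> X \<Longrightarrow> card (nb X x) \<le> D" "2 \<le> q"
    "(q - 2) * card X + 2 * j * q * D < 2 * ne X"
  shows "kpaths q j X"
  using assms(1,2,4)
proof (induction j arbitrary: X)
  case 0
  then show ?case by simp
next
  case (Suc j)
  have "\<not> 2 * ne X \<le> (q - 2) * card X" using Suc.prems(3) by linarith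
  then obtain p where p: "path p" "set p \<subseteq> X" "length p = q"
    using erdos_gallai[OF Suc.prems(1) assms(3)] by blast
  have "ne X \<le> ne (X - set p) + D * card (set p)"
    using Suc.prems(1,2) p(2) by (intro ne_remove_deg) auto
  moreover have "card (set p) = q" using p path_length by metis
  moreover have "(q - 2) * card (X - set p) \<le> (q - 2) * card X"
    using Suc.prems(1) by (intro mult_le_mono2 card_mono) auto
  ultimately have "(q - 2) * card (X - set p) + 2 * j * q * D < 2 * ne (X - set p)"
    using Suc.prems(3) by (simp add: algebra_simps)
  moreover have "card (nb (X - set p) x) \<le> D" if "x \<in> X - set p" for x
    using Suc.prems(2)[of x] that card_nb_mono[OF Suc.prems(1), of "X - set p" x] by simp
  ultimately have "kpaths q j (X - set p)" using Suc.IH[of "X - set p"] Suc.prems(1) by simp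
  then show ?case using p by auto
qed

lemma linkedI:
  assumes "\<And>a b. a \<in> set as \<Longrightarrow> b \<in> set as \<Longrightarrow> N \<le> card (nb W a \<inter> nb W b)"
  shows "linked N W as"
  unfolding linked_def using assms
proof (induction as)
  case (Cons a as)
  then show ?case by (cases as) auto
qed simp

lemma nb_full: "(\<And>w. w \<in> W \<Longrightarrow> adj a w) \<Longrightarrow> nb W a = W"
  by (auto simp: nb_def)

text \<open>Each vertex of \<open>us\<close> glues two rooted paths at their heads into
  \<open>rev p1 @ u # p2\<close>, a path on \<open>2 * q + 1\<close> vertices; hence the packing has
  twice as many members as \<open>us\<close>.\<close>

lemma kpaths_join:
  assumes "l \<le> 2 * q + 1" "1 \<le> q" "\<And>u w. u \<in> set us \<Longrightarrow> w \<in> W \<Longrightarrow> adj u w"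
    "distinct us" "set us \<inter> Y = {}" "packs (\<lambda>p. lpath q p \<and> hd p \<in> W) (2 * length us) Y"
  shows "kpaths l (length us) (Y \<union> set us)"
  using assms(3-6)
proof (induction us arbitrary: Y)
  case Nil
  then show ?case by simp
next
  case (Cons u us)
  obtain p1 p2 where p: "lpath q p1" "hd p1 \<in> W" "lpath q p2" "hd p2 \<in> W" "set p1 \<subseteq> Y"
    "set p2 \<subseteq> Y - set p1" "packs (\<lambda>p. lpath q p \<and> hd p \<in> W) (2 * length us) (Y - set p1 - set p2)"
    using Cons.prems(4) by auto
  have ne: "p1 \<noteq> []" "p2 \<noteq> []" using p assms(2) by auto
  have a: "adj u (hd p1)" "adj u (hd p2)" using Cons.prems(1) p by auto
  let ?p = "rev p1 @ u # p2"
  have u: "u \<notin> set p1" "u \<notin> set p2" "set p1 \<inter> set p2 = {}" using Cons.prems(3) p by auto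
  have "path (u # p2)" using p a u by (simp add: path_Cons)
  moreover have "adj (last (rev p1)) (hd (u # p2))"
    using a(1) adj_sym[of u "hd p1"] ne by (simp add: last_rev)
  ultimately have 1: "path ?p"
    unfolding path_append using p(1) u by simp
  have "kpaths l (length us) ((Y - set p1 - set p2) \<union> set us)"
    using Cons.prems p by (intro Cons.IH) auto
  then have 2: "kpaths l (length us) ((Y \<union> set (u # us)) - set ?p)"
    by (rule packs_mono) (use Cons.prems p in auto)
  have 3: "set ?p \<subseteq> Y \<union> set (u # us)" using p by auto
  have 4: "l \<le> length ?p" using p assms(1) by auto
  show ?case using kpaths_Suc[OF 1 4 3 2] by simp
qed

end

section \<open>Graphs without k disjoint paths on l vertices\<close>

locale sgraph_kl = sgraph E for E :: "'v set set" +
  fixes k l m :: nat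
  assumes k2: "2 \<le> k" and l4: "4 \<le> l" and m_eq: "m = l div 2"
begin

lemma m_bounds: "2 \<le> m" "2 * m \<le> l" "l \<le> 2 * m + 1"
  using l4 m_eq by auto

text \<open>Below this order the Erdos-Gallai bound for a path on \<open>k * l\<close> vertices suffices; above it
  a dense path has \<open>m\<close> vertices with \<open>k * l\<close> common neighbours.\<close>
definition Nk :: nat where "Nk = k * l * (m + 2) * (l choose m)"

lemma choose_pos: "1 \<le> l choose m"
  using m_bounds by (simp add: Suc_leI)

lemma Nk_ge: "l * l \<le> Nk"
proof -
  have "l \<le> 2 * (m + 2)" using m_bounds by simp
  also have "\<dots> \<le> k * (m + 2)" by (rule mult_le_mono1[OF k2])
  finally have "l \<le> k * (m + 2)" .
  then have "l * l * 1 \<le> k * (m + 2) * l * (l choose m)"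
    using choose_pos by (intro mult_le_mono) auto
  moreover have "k * (m + 2) * l * (l choose m) = Nk" by (simp only: Nk_def ac_simps)
  ultimately show ?thesis by linarith
qed

text \<open>For odd \<open>l\<close> this is Erdos-Gallai itself; for even \<open>l\<close> it is
  weakened by half an edge per vertex so that both parities share one formula.\<close>

lemma no_path_ne:
  assumes "finite Y" "\<not> kpaths l 1 Y"
  shows "2 * ne Y + card Y \<le> 2 * m * card Y"
proof -
  have "2 * ne Y \<le> (l - 2) * card Y"
    using assms l4 by (intro erdos_gallai) auto
  also have "\<dots> \<le> (2 * m - 1) * card Y" using m_bounds by (intro mult_le_mono1) linarith
  finally have "2 * ne Y + card Y \<le> (2 * m - 1) * card Y + card Y" by simp
  also have "\<dots> = 2 * m * card Y"
  proof -
    obtain m' where "2 * m = Suc m'" using m_bounds by (cases "2 * m") auto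
    then show ?thesis by simp
  qed
  finally show ?thesis .
qed

text \<open>The given paths block at most \<open>i * l\<close> of the common neighbours of
  \<open>S\<close>; at least \<open>l\<close> remain, and \<open>m + 1 \<le> l\<close> suffice for
  one more path through \<open>S\<close>.\<close>

lemma kpaths_extend:
  assumes "finite Y" "S \<subseteq> Y" "card S = m" "kpaths l i (Y - S)" "(i + 1) * l \<le> card (cn Y S)"
  shows "kpaths l (Suc i) Y"
proof -
  obtain T where T: "T \<subseteq> Y - S" "finite T" "card T \<le> i * l" "kpaths l i T"
    using packs_support[OF assms(4), of l] by auto
  define W where "W = cn Y S - T"
  have fW: "finite W" using assms(1) by (simp add: W_def cn_def)
  have WS: "W \<inter> S = {}" using adj_irrefl by (auto simp: W_def cn_def)
  have "card (cn Y S) \<le> card W + card T"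
    using card_Un_le[of W T] card_mono[of "W \<union> T" "cn Y S"] fW T(2) by (auto simp: W_def)
  then have cW: "l \<le> card W" using assms(5) T(3) by simp
  obtain as where as: "set as = S" "distinct as"
    using finite_distinct_list[of S] assms finite_subset by metis
  have full: "nb W a = W" if "a \<in> S" for a using that by (intro nb_full) (auto simp: W_def cn_def)
  have "kpaths l 1 ((set as \<union> W) - {})"
  proof (rule blocks[where N = l and m = m])
    show "length as = 1 * m" using as assms(3) distinct_card by fastforce
    show "linked l W as" using as full cW by (intro linkedI) auto
    show "card ({} \<inter> W) + 1 * (m + 1) \<le> l" using m_bounds by simp
  qed (use m_bounds as fW WS full cW in auto)
  then obtain p where p: "lpath l p" "set p \<subseteq> S \<union> W" using as by auto
  have "T \<subseteq> Y - set p" using T(1) p(2) by (auto simp: W_def)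
  then have "kpaths l i (Y - set p)" using T(4) packs_mono by blast
  moreover have "set p \<subseteq> Y" using p(2) assms(2) by (auto simp: W_def cn_def)
  ultimately show ?thesis using p by auto
qed

text \<open>If deleting the path destroys more than about \<open>(m - 1) * card Y + Nk\<close>
  edges, many outside vertices see at least \<open>m\<close> vertices of it, and pigeonhole
  applies.\<close>

lemma dense_path_subset:
  assumes "finite Y" "lpath l p" "set p \<subseteq> Y"
    "2 * ne (Y - set p) + l * l + 2 * m * card Y + 2 * Nk < 2 * ne Y + 2 * card Y"
  shows "\<exists>S\<subseteq>Y. card S = m \<and> k * l \<le> card (cn Y S)"
proof -
  let ?P = "set p" and ?Z = "Y - set p"
  define x where "x = card {z \<in> ?Z. m \<le> card (nb ?P z)}"
  have cP: "card ?P = l" using assms(2) path_length by metis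
  have fZ: "finite ?Z" using assms(1) by simp
  have "ne (?P \<union> ?Z) = ne ?P + ne ?Z + (\<Sum>z\<in>?Z. card (nb ?P z))"
    using assms(1) by (intro ne_Un) auto
  moreover have "?P \<union> ?Z = Y" using assms(3) by auto
  ultimately have e: "ne Y = ne ?P + ne ?Z + (\<Sum>z\<in>?Z. card (nb ?P z))" by simp
  have "2 * ne ?P \<le> l * (l - 1)" using ne_le[of ?P] cP by simp
  then have eP: "2 * ne ?P \<le> l * l" using mult_le_mono2[of "l - 1" l l] by linarith
  \<comment> \<open>A vertex sees at most \<open>l \<le> 2 * m + 1 = (m - 1) + (m + 2)\<close>
    vertices of the path; this is the origin of the factor \<open>m + 2\<close> in
    \<open>Nk\<close>.\<close>
  have "(\<Sum>z\<in>?Z. card (nb ?P z)) \<le> (\<Sum>z\<in>?Z. (m - 1) + (if m \<le> card (nb ?P z) then m + 2 else 0))"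
  proof (rule sum_mono)
    fix z
    have "card (nb ?P z) \<le> l" using card_nb_le[of ?P z] cP by simp
    then show "card (nb ?P z) \<le> (m - 1) + (if m \<le> card (nb ?P z) then m + 2 else 0)"
      using m_bounds by auto
  qed
  also have "\<dots> = (m - 1) * card ?Z + (m + 2) * x"
    using fZ by (simp add: sum.distrib sum.If_cases x_def Int_def)
  also have "\<dots> \<le> (m - 1) * card Y + (m + 2) * x"
    using assms(1) by (intro add_mono mult_le_mono2 card_mono) auto
  finally have "2 * ne Y \<le> l * l + 2 * ne ?Z + 2 * (m - 1) * card Y + 2 * (m + 2) * x"
    using e eP by simp
  moreover have "2 * (m - 1) * card Y + 2 * card Y = 2 * m * card Y"
  proof -
    obtain m' where "m = Suc m'" using m_bounds by (cases m) auto
    then show ?thesis by simp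
  qed
  ultimately have "Nk < (m + 2) * x" using assms(4) by linarith
  moreover have "Nk = (m + 2) * (k * l * (l choose m))" by (simp only: Nk_def ac_simps)
  ultimately have "(m + 2) * (k * l * (l choose m)) < (m + 2) * x" by (simp only:)
  then have "k * l * (l choose m) \<le> x" by (metis less_imp_le mult_less_cancel1)
  then have "\<exists>S\<subseteq>?P. card S = m \<and> k * l \<le> card (cn ?Z S)"
    using m_bounds fZ by (intro common_neighbours) (auto simp: cP x_def)
  then obtain S where S: "S \<subseteq> ?P" "card S = m" "k * l \<le> card (cn ?Z S)" by auto
  have "card (cn ?Z S) \<le> card (cn Y S)"
    using assms(1) by (intro card_mono) (auto simp: cn_def)
  then show ?thesis using S assms(3) by (intro exI[of _ S]) auto
qed

text \<open>If \<open>Y\<close> is large and has too many edges, deleting one path must destroy so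
  many that a linker set \<open>S\<close> appears. By \<open>kpaths_extend\<close>, deleting
  \<open>S\<close> leaves no \<open>i\<close> disjoint paths, while only \<open>m * card Y\<close>
  edges are lost, and the induction hypothesis applies.\<close>

lemma kpaths_free_ne:
  assumes "1 \<le> i" "i \<le> k" "finite Y" "\<not> kpaths l i Y"
  shows "2 * ne Y + card Y \<le> 2 * i * m * card Y + (i - 1) * Nk"
  using assms
proof (induction i arbitrary: Y rule: nat_induct_at_least)
  case base
  then show ?case using no_path_ne[of Y] by simp
next
  case (Suc i)
  show ?case
  proof (cases "card Y \<le> Nk")
    case True
    \<comment> \<open>A path on \<open>Suc i * l\<close> vertices would split into all the paths.
      Its Erdos-Gallai bound exceeds the leading term by at most \<open>i * card Y\<close>, which
      \<open>i * Nk\<close> absorbs for small \<open>Y\<close>.\<close>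
    have "2 * ne Y \<le> (Suc i * l - 2) * card Y"
    proof (rule erdos_gallai[OF Suc.prems(2)])
      show "2 \<le> Suc i * l" using l4 by simp
      show "length q \<noteq> Suc i * l" if "path q" "set q \<subseteq> Y" for q
        using path_kpaths[of q "Suc i" l Y] that Suc.prems(3) by metis
    qed
    moreover obtain c where "Suc i * l = c + 2" using l4 
    proof -
      have "2 \<le> Suc i * l" using l4 by simp
      then show ?thesis by (metis le_add_diff_inverse2 that)
    qed
    ultimately have "2 * ne Y + 2 * card Y \<le> (Suc i * l) * card Y"
      by (simp only: diff_add_inverse2 add_mult_distrib)
    also have "\<dots> \<le> (Suc i * (2 * m + 1)) * card Y"
      using m_bounds by (intro mult_le_mono mult_le_mono2) auto
    also have "\<dots> = 2 * Suc i * m * card Y + card Y + i * card Y" by (simp add: algebra_simps)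
    finally show ?thesis using mult_le_mono2[OF True, of i] unfolding diff_Suc_1 by linarith
  next
    case False
    show ?thesis
    proof (rule ccontr)
      assume "\<not> ?thesis"
      then have big: "2 * Suc i * m * card Y + i * Nk < 2 * ne Y + card Y" by simp
      have "kpaths l 1 Y"
      proof (rule ccontr)
        assume "\<not> kpaths l 1 Y"
        then have "2 * ne Y + card Y \<le> 2 * m * card Y" using no_path_ne Suc.prems by blast
        then show False using big by (simp add: algebra_simps)
      qed
      then obtain p where p: "lpath l p" "set p \<subseteq> Y" by auto
      have "\<not> kpaths l i (Y - set p)" using Suc.prems(3) p by auto
      then have "2 * ne (Y - set p) + card (Y - set p)
          \<le> 2 * i * m * card (Y - set p) + (i - 1) * Nk"
        using Suc by simp
      moreover have cYp: "card (Y - set p) \<le> card Y" "card Y \<le> card (Y - set p) + l"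
        using Suc.prems(2) p path_length[of p] card_mono[of Y "Y - set p"]
        by (auto simp: card_Diff_subset)
      moreover have "2 * i * m * card (Y - set p) + card Y
          \<le> 2 * i * m * card Y + card (Y - set p)"
      proof -
        have "1 \<le> 2 * i * m" using Suc.hyps m_bounds by simp
        then obtain c where "2 * i * m = Suc c" by (cases "2 * i * m") auto
        then show ?thesis using mult_le_mono2[OF cYp(1), of c] by simp
      qed
      ultimately have "2 * ne (Y - set p) + card Y \<le> 2 * i * m * card Y + (i - 1) * Nk" by linarith
      moreover have "(i - 1) * Nk + Nk = i * Nk"
        using Suc.hyps by (metis Suc_diff_1 add.commute less_le_trans mult_Suc zero_less_one)
      ultimately have "2 * ne (Y - set p) + l * l + 2 * m * card Y + 2 * Nk < 2 * ne Y + 2 * card Y"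
        using big False Nk_ge by (simp add: algebra_simps)
      then obtain S where S: "S \<subseteq> Y" "card S = m" "k * l \<le> card (cn Y S)"
        using dense_path_subset[OF Suc.prems(2) p] by auto
      have "(i + 1) * l \<le> k * l" using Suc.prems(1) by (intro mult_le_mono1) simp
      then have "(i + 1) * l \<le> card (cn Y S)" using S(3) by linarith
      then have "\<not> kpaths l i (Y - S)"
        using kpaths_extend[OF Suc.prems(2) S(1,2)] Suc.prems(3) by blast
      then have "2 * ne (Y - S) + card (Y - S) \<le> 2 * i * m * card (Y - S) + (i - 1) * Nk"
        using Suc by simp
      moreover have cYS: "card (Y - S) \<le> card Y" "card Y = card (Y - S) + m"
        using Suc.prems(2) S finite_subset[OF S(1)] card_mono[of Y S] card_mono[of Y "Y - S"]
        by (auto simp: card_Diff_subset)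
      moreover have "2 * i * m * card (Y - S) + card Y \<le> 2 * i * m * card Y + card (Y - S)"
      proof -
        have "1 \<le> 2 * i * m" using Suc.hyps m_bounds by simp
        then obtain c where "2 * i * m = Suc c" by (cases "2 * i * m") auto
        then show ?thesis using mult_le_mono2[OF cYS(1), of c] by simp
      qed
      moreover have "(i - 1) * Nk \<le> i * Nk" by simp
      ultimately have "2 * ne (Y - S) + card Y \<le> 2 * i * m * card Y + i * Nk" by linarith
      moreover have "ne Y \<le> ne (Y - S) + m * card Y"
        using ne_remove_set[OF Suc.prems(2) S(1)] S(2) by simp
      ultimately show False using big by (simp add: algebra_simps)
    qed
  qed
qed

text \<open>The order \<open>n\<close> stays fixed while \<open>Y\<close> shrinks: removing
  \<open>m\<close> vertices costs at most \<open>m * n\<close> edges, and doubled this is exactly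
  what the left side drops when \<open>i\<close> decreases. So the error \<open>c\<close> does not
  grow over the rounds.\<close>

lemma linker_set:
  assumes "1 \<le> i" "i \<le> k" "finite Y" "card Y \<le> n" "\<not> kpaths l i Y"
    "2 * i * m * n \<le> 2 * ne Y + c + 2 * n" "c + (k + 1) * Nk + l * l < n"
  shows "\<exists>U\<subseteq>Y. card U = (i - 1) * m \<and> \<not> kpaths l 1 (Y - U)"
  using assms(1-6)
proof (induction i arbitrary: Y rule: nat_induct_at_least)
  case base
  then show ?case by (intro exI[of _ "{}"]) auto
next
  case (Suc i)
  have im: "m * n \<le> i * (m * n)" using Suc.hyps by simp
  have "kpaths l 1 Y"
  proof (rule ccontr)
    assume "\<not> kpaths l 1 Y"
    then have "2 * ne Y + card Y \<le> 2 * m * card Y" using no_path_ne Suc.prems by blast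
    also have "\<dots> \<le> 2 * m * n" using Suc.prems by simp
    finally have "2 * Suc i * m * n \<le> 2 * m * n + c + 2 * n" using Suc.prems by linarith
    then have "2 * (i * (m * n)) \<le> c + 2 * n" by (simp add: algebra_simps)
    then have "2 * (m * n) \<le> c + 2 * n" using im by linarith
    moreover have "2 * n \<le> m * n" using m_bounds by simp
    ultimately show False using assms(7) by linarith
  qed
  then obtain p where p: "lpath l p" "set p \<subseteq> Y" by auto
  have "\<not> kpaths l i (Y - set p)" using Suc.prems(4) p by auto
  then have "2 * ne (Y - set p) + card (Y - set p)
      \<le> 2 * i * m * card (Y - set p) + (i - 1) * Nk"
    using kpaths_free_ne[of i "Y - set p"] Suc by simp
  moreover have cYp: "card (Y - set p) \<le> n"
    using card_mono[of Y "Y - set p"] Suc.prems by auto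
  moreover have "2 * i * m * card (Y - set p) + n \<le> 2 * i * m * n + card (Y - set p)"
  proof -
    have "1 \<le> 2 * i * m" using Suc.hyps m_bounds by simp
    then obtain c where "2 * i * m = Suc c" by (cases "2 * i * m") auto
    then show ?thesis using mult_le_mono2[OF cYp, of c] by simp
  qed
  moreover have "(i - 1) * Nk + 2 * Nk = i * Nk + Nk"
    using Suc.hyps by (cases i) auto
  moreover have "i * Nk + Nk \<le> (k + 1) * Nk" using Suc.prems(1) by (simp del: mult_le_cancel2 add: mult_le_mono1)
  ultimately have "2 * ne (Y - set p) + 2 * Nk + n \<le> 2 * i * m * n + (k + 1) * Nk" by linarith
  then have "2 * ne (Y - set p) + l * l + 2 * m * n + 2 * Nk < 2 * ne Y + 2 * n"
    using Suc.prems(5) assms(7) by (simp add: algebra_simps)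
  moreover have "2 * m * card Y + 2 * n \<le> 2 * m * n + 2 * card Y"
  proof -
    obtain m' where "m = Suc m'" using m_bounds by (cases m) auto
    then show ?thesis using mult_le_mono2[OF Suc.prems(3), of m'] by simp
  qed
  ultimately have "2 * ne (Y - set p) + l * l + 2 * m * card Y + 2 * Nk < 2 * ne Y + 2 * card Y"
    by linarith
  then obtain S where S: "S \<subseteq> Y" "card S = m" "k * l \<le> card (cn Y S)"
    using dense_path_subset[OF Suc.prems(2) p] by auto
  have "(i + 1) * l \<le> k * l" using Suc.prems(1) by (intro mult_le_mono1) simp
  then have "(i + 1) * l \<le> card (cn Y S)" using S(3) by linarith
  then have free: "\<not> kpaths l i (Y - S)"
    using kpaths_extend[OF Suc.prems(2) S(1,2)] Suc.prems(4) by blast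
  have "ne Y \<le> ne (Y - S) + m * n"
    using ne_remove_set[OF Suc.prems(2) S(1)] mult_le_mono2[OF Suc.prems(3), of m]
    unfolding S(2) by linarith
  then have "2 * i * m * n \<le> 2 * ne (Y - S) + c + 2 * n"
    using Suc.prems(5) by (simp add: algebra_simps)
  moreover have "card (Y - S) \<le> n" using card_mono[of Y "Y - S"] Suc.prems by auto
  ultimately obtain U where U: "U \<subseteq> Y - S" "card U = (i - 1) * m" "\<not> kpaths l 1 (Y - S - U)"
    using Suc.IH[of "Y - S"] Suc.prems free by auto
  have fin: "finite S" "finite U" using S(1) U(1) Suc.prems(2) finite_subset by blast+
  have "card (S \<union> U) = m + (i - 1) * m" using U S fin by (subst card_Un_disjoint) auto
  also have "\<dots> = (Suc i - 1) * m" using Suc.hyps by (cases i) auto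
  finally show ?case using U S by (intro exI[of _ "S \<union> U"]) (auto simp: Diff_Diff_Int set_diff_eq Collect_conj_eq)
qed

text \<open>Outside \<open>W\<close> the path-free bound \<open>m - 1/2\<close> per vertex is all one can hope for; the point is
  that vertices of \<open>W\<close> only contribute \<open>m - 1\<close>.\<close>
lemma few_rooted_paths_ne:
  assumes "finite X" "\<not> kpaths l 1 X" "\<not> packs (\<lambda>p. lpath m p \<and> hd p \<in> W) t X"
  shows "2 * ne X + 2 * card (X \<inter> W) + card (X - W) \<le> 2 * m * card X + 4 * m * m * t"
  using assms
proof (induction "card X" arbitrary: X t rule: less_induct)
  case less
  let ?Q = "\<lambda>p. lpath m p \<and> hd p \<in> W"
  have fX: "finite X" using less.prems by simp
  show ?case
  proof (cases "X = {}")
    case True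
    then show ?thesis by simp
  next
    case ne: False
    show ?thesis
    proof (cases "\<exists>x\<in>X. card (nb X x) < m")
      case True
      then obtain x where x: "x \<in> X" "card (nb X x) < m" by auto
      have c1: "card X = Suc (card (X - {x}))" using x fX by (metis card.remove)
      have "\<not> kpaths l 1 (X - {x})" "\<not> packs ?Q t (X - {x})"
        using less.prems packs_mono[of _ _ "X - {x}" X] by blast+
      then have IH: "2 * ne (X - {x}) + 2 * card ((X - {x}) \<inter> W) + card ((X - {x}) - W)
          \<le> 2 * m * card (X - {x}) + 4 * m * m * t"
        using less.hyps[of "X - {x}" t] c1 fX by simp
      have e: "ne X = ne (X - {x}) + card (nb X x)"
        using ne_remove[of X x] x fX by (simp add: nb_remove_self)
      \<comment> \<open>The deleted vertex adds at most 2 to the weights and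
        \<open>2 * (m - 1)\<close> to the doubled edge count, together the \<open>2 * m\<close>
        granted per vertex.\<close>
      have "2 * card (X \<inter> W) + card (X - W) \<le> 2 * card ((X - {x}) \<inter> W) + card ((X - {x}) - W) + 2"
      proof (cases "x \<in> W")
        case True
        then have "X \<inter> W = insert x ((X - {x}) \<inter> W)" "X - W = (X - {x}) - W" using x by auto
        then show ?thesis using fX by (simp add: card_insert_if)
      next
        case False
        then have "X \<inter> W = (X - {x}) \<inter> W" "X - W = insert x ((X - {x}) - W)" using x by auto
        then show ?thesis using fX by (simp add: card_insert_if)
      qed
      then show ?thesis using IH e x(2) c1 by (simp add: algebra_simps)
    next
      case False
      then have deg: "\<And>x. x \<in> X \<Longrightarrow> m \<le> card (nb X x)" by (auto simp: not_less)
      have short: "length q \<le> 2 * m" if "path q" "set q \<subseteq> X" for q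
      proof (rule ccontr)
        assume "\<not> length q \<le> 2 * m"
        then have "lpath l (take l q)" "set (take l q) \<subseteq> X"
          using that m_bounds set_take_subset[of l q] by (auto simp: path_take)
        then show False using less.prems(2) by auto
      qed
      obtain K where K: "K \<subseteq> X" "K \<noteq> {}" "\<And>x. x \<in> K \<Longrightarrow> nb X x \<subseteq> K"
        "\<And>w. w \<in> K \<Longrightarrow> \<exists>p. path p \<and> set p = K \<and> hd p = w"
        using component_of_short_paths[OF ne deg short] by metis
      have fK: "finite K" using K(1) fX finite_subset by blast
      have cK: "card K \<le> 2 * m" using K(1,2,4) short path_length by (metis ex_in_conv)
      have cXK: "card X = card K + card (X - K)" "0 < card K"
        using K(1,2) fX fK card_mono[of X K] by (auto simp: card_Diff_subset card_gt_0_iff)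
      have e: "ne X = ne K + ne (X - K)" using ne_closed[OF fX K(1,3)] .
      have i1: "card (X \<inter> W) = card (K \<inter> W) + card ((X - K) \<inter> W)"
        using fX fK K(1) by (subst card_Un_disjoint[symmetric]) (auto intro: arg_cong[where f = card])
      have i2: "card (X - W) = card (K - W) + card ((X - K) - W)"
        using fX fK K(1) by (subst card_Un_disjoint[symmetric]) (auto intro: arg_cong[where f = card])
      have i3: "card K = card (K \<inter> W) + card (K - W)"
        using fK by (subst card_Un_disjoint[symmetric]) (auto intro: arg_cong[where f = card])
      have eK: "2 * ne K + card K \<le> card K * card K"
        using ne_le[OF fK] cXK(2) by (cases "card K") auto
      have free: "\<not> kpaths l 1 (X - K)"
        using less.prems(2) packs_mono[of _ _ "X - K" X] by blast
      show ?thesis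
      proof (cases "K \<inter> W = {}")
        case True
        have "\<not> packs ?Q t (X - K)" using less.prems(3) packs_mono[of ?Q t "X - K" X] by blast
        then have "2 * ne (X - K) + 2 * card ((X - K) \<inter> W) + card ((X - K) - W)
            \<le> 2 * m * card (X - K) + 4 * m * m * t"
          using less.hyps[of "X - K" t] cXK fX free by simp
        moreover have "card K * card K \<le> 2 * m * card K" using cK by simp
        moreover have "2 * m * card X = 2 * m * card K + 2 * m * card (X - K)"
          using cXK by (simp add: algebra_simps)
        moreover have "card (K \<inter> W) = 0" using True by simp
        ultimately show ?thesis using eK e i1 i2 i3 by linarith
      next
        case False
        \<comment> \<open>Such a component can be traversed from \<open>w\<close> and has at least
          \<open>m\<close> vertices, so it uses up one of fewer than \<open>t\<close> rooted paths.
          Its excess is at most \<open>card K \<le> 2 * m\<close>, covered by one share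
          \<open>4 * m * m\<close>.\<close>
        then obtain w where w: "w \<in> K" "w \<in> W" by auto
        obtain r where r: "path r" "set r = K" "hd r = w" using K(4) w by blast
        have "m \<le> card K" using deg[of w] K(1,3) w card_mono[OF fK K(3)[OF w(1)]] by force
        then have lr: "m \<le> length r" using r path_length by metis
        then have rne: "r \<noteq> []" using m_bounds by auto
        have Qr: "?Q (take m r)" "set (take m r) \<subseteq> K"
          using r lr w rne m_bounds set_take_subset[of m r] by (auto simp: path_take)
        obtain t' where t: "t = Suc t'" using less.prems(3) by (cases t) auto
        have "\<not> packs ?Q t' (X - K)"
        proof
          assume "packs ?Q t' (X - K)"
          then have "packs ?Q t' (X - set (take m r))"
            by (rule packs_mono) (use Qr(2) in auto)
          then have "packs ?Q t X" unfolding t packs.simps using Qr K(1) by blast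
          then show False using less.prems(3) by simp
        qed
        then have "2 * ne (X - K) + 2 * card ((X - K) \<inter> W) + card ((X - K) - W)
            \<le> 2 * m * card (X - K) + 4 * m * m * t'"
          using less.hyps[of "X - K" t'] cXK fX free by simp
        moreover have "card K * card K \<le> 2 * m * card K" using cK by simp
        moreover have "2 * m \<le> 4 * m * m" by simp
        moreover have "4 * m * m * t = 4 * m * m * t' + 4 * m * m" using t by simp
        moreover have "2 * m * card X = 2 * m * card K + 2 * m * card (X - K)"
          using cXK by (simp add: algebra_simps)
        ultimately show ?thesis using eK e i1 i2 i3 cXK cK by linarith
      qed
    qed
  qed
qed

end

section \<open>Interleaving two kinds of linkers\<close>

lemma finite_distinct_list_Cons:
  assumes "finite A" "a \<in> A"
  obtains zs where "set (a # zs) = A" "distinct (a # zs)" "length zs = card A - 1"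
proof -
  obtain zs where zs: "set zs = A - {a}" "distinct zs"
    using finite_distinct_list[of "A - {a}"] assms by auto
  show thesis
    by (rule that[of zs]) (use zs assms distinct_card[OF zs(2)] in auto)
qed

text \<open>Members of \<open>us\<close> are compatible with everything, so only two adjacent
  members of \<open>bs\<close> could do harm. The length bounds, which differ according to the list
  that starts, let \<open>us\<close> separate them.\<close>

lemma successively_splice:
  assumes "\<And>u x. u \<in> set us \<Longrightarrow> x \<in> set us \<union> set bs \<Longrightarrow> R u x \<and> R x u"
  shows "length bs \<le> Suc (length us) \<Longrightarrow> successively R (splice bs us)"
    and "length bs \<le> length us \<Longrightarrow> successively R (splice us bs)"
proof -
  have "(length bs \<le> Suc (length us) \<longrightarrow> successively R (splice bs us)) \<and>
      (length bs \<le> length us \<longrightarrow> successively R (splice us bs))"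
    using assms
  proof (induction us arbitrary: bs)
    case Nil
    then show ?case by (cases bs) auto
  next
    case (Cons u us)
    have two: "successively R (splice (u # us) cs)"
      if "length cs \<le> length (u # us)" "set cs \<subseteq> set bs" for cs
    proof -
      have R: "R a x \<and> R x a" if "a \<in> set us" "x \<in> set us \<union> set cs" for a x
        using that Cons.prems \<open>set cs \<subseteq> set bs\<close> by (meson UnE UnI1 UnI2 list.set_intros(2) subsetD)
      have "successively R (splice cs us)" using Cons.IH[of cs, OF R] that(1) by simp
      moreover have "R u (hd (splice cs us))" if "splice cs us \<noteq> []"
      proof -
        have "hd (splice cs us) \<in> set (splice cs us)" using that by (rule hd_in_set)
        then have "hd (splice cs us) \<in> set (u # us) \<union> set bs"
          using set_shuffles[of "splice cs us" cs us] \<open>set cs \<subseteq> set bs\<close> by auto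
        then show ?thesis using Cons.prems[of u "hd (splice cs us)"] by simp
      qed
      ultimately show ?thesis by (cases "splice cs us") auto
    qed
    show ?case
    proof (intro conjI impI)
      show "successively R (splice (u # us) bs)" if "length bs \<le> length (u # us)"
        using two[of bs] that by simp
      show "successively R (splice bs (u # us))" if l: "length bs \<le> Suc (length (u # us))"
      proof (cases bs)
        case Nil
        then show ?thesis using two[of "[]"] by simp
      next
        case (Cons b cs)
        then have "successively R (splice (u # us) cs)" using two[of cs] l by auto
        moreover have "R b u" using Cons.prems[of u b] Cons by simp
        ultimately show ?thesis using Cons by simp
      qed
    qed
  qed
  then show "length bs \<le> Suc (length us) \<Longrightarrow> successively R (splice bs us)"
    and "length bs \<le> length us \<Longrightarrow> successively R (splice us bs)" by auto
qed

lemma last_splice: "length bs < length us \<Longrightarrow> last (splice us bs) \<in> set us"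
proof (induction us arbitrary: bs)
  case (Cons u us)
  show ?case
  proof (cases bs)
    case Nil
    then show ?thesis using last_in_set[of "u # us"] by auto
  next
    case (Cons b cs)
    then have "last (splice us cs) \<in> set us" using Cons.IH[of cs] Cons.prems by simp
    moreover have "us \<noteq> []" using Cons Cons.prems by auto
    ultimately show ?thesis using Cons by simp
  qed
qed simp

lemma hd_splice: "length bs < length us \<Longrightarrow> hd (splice us bs) \<in> set us"
  by (cases us) auto

lemma set_splice: "set (splice xs ys) = set xs \<union> set ys"
  by (rule set_shuffles[OF splice_in_shuffles])

lemma distinct_splice:
  "distinct xs \<Longrightarrow> distinct ys \<Longrightarrow> set xs \<inter> set ys = {} \<Longrightarrow> distinct (splice xs ys)"
  by (rule distinct_disjoint_shuffles[OF _ _ _ splice_in_shuffles])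

context sgraph
begin

lemma finite_cn: "finite Z \<Longrightarrow> finite (cn Z S)"
  by (simp add: cn_def)

lemma cn_subset: "cn Z S \<subseteq> Z"
  by (auto simp: cn_def)

lemma cn_disjoint: "A \<inter> cn Z A = {}"
proof -
  have False if "x \<in> A" "x \<in> cn Z A" for x
    using that adj_irrefl[of x] unfolding cn_def by blast
  then show ?thesis by blast
qed

lemma sum_nb_swap:
  assumes "finite X" "finite Y"
  shows "(\<Sum>y\<in>Y. card (nb X y)) = (\<Sum>x\<in>X. card (nb Y x))"
proof -
  have "(\<Sum>y\<in>Y. card (nb X y)) = (\<Sum>y\<in>Y. \<Sum>x\<in>X. if adj y x then 1 else 0)"
    using assms by (simp add: nb_def sum.If_cases Int_def)
  also have "\<dots> = (\<Sum>x\<in>X. \<Sum>y\<in>Y. if adj x y then 1 else 0)"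
    by (subst sum.swap) (simp add: insert_commute)
  also have "\<dots> = (\<Sum>x\<in>X. card (nb Y x))"
    using assms by (simp add: nb_def sum.If_cases Int_def)
  finally show ?thesis .
qed

lemma card_nb_Diff:
  assumes "finite W" "finite B"
  shows "card (nb W x) \<le> card (nb (W - B) x) + card B"
proof -
  have "nb W x \<subseteq> nb (W - B) x \<union> B" by (auto simp: nb_def)
  then have "card (nb W x) \<le> card (nb (W - B) x \<union> B)"
    using assms by (intro card_mono) (auto simp: finite_nb)
  then show ?thesis using card_Un_le[of "nb (W - B) x" B] by linarith
qed

lemma linked_splice:
  assumes "\<And>u w. u \<in> set us \<Longrightarrow> w \<in> W \<Longrightarrow> adj u w"
    and "\<And>x. x \<in> set us \<union> set bs \<Longrightarrow> N \<le> card (nb W x)"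
  shows "length bs \<le> Suc (length us) \<Longrightarrow> linked N W (splice bs us)"
    and "length bs \<le> length us \<Longrightarrow> linked N W (splice us bs)"
proof -
  have R: "N \<le> card (nb W u \<inter> nb W x) \<and> N \<le> card (nb W x \<inter> nb W u)"
    if "u \<in> set us" "x \<in> set us \<union> set bs" for u x
  proof -
    have "nb W u = W" using assms(1) that by (intro nb_full)
    then have "nb W u \<inter> nb W x = nb W x" "nb W x \<inter> nb W u = nb W x"
      using nb_subset[of W x] by auto
    then show ?thesis using assms(2) that by simp
  qed
  show "length bs \<le> Suc (length us) \<Longrightarrow> linked N W (splice bs us)"
    and "length bs \<le> length us \<Longrightarrow> linked N W (splice us bs)"
    unfolding linked_def
    by (rule successively_splice; use R in blast)+
qed

end

section \<open>From linkers to a hub set\<close>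

context sgraph_kl
begin

text \<open>So \<open>U\<close> can supply one joining vertex per path, and can separate up to
  \<open>m\<close> vertices of \<open>B\<close>.\<close>

lemma linkers_many: "k \<le> (k - 1) * m" "m \<le> (k - 1) * m"
proof -
  have "k \<le> (k - 1) * 2" using k2 by simp
  also have "\<dots> \<le> (k - 1) * m" by (rule mult_le_mono2[OF m_bounds(1)])
  finally show "k \<le> (k - 1) * m" .
  have "1 * m \<le> (k - 1) * m" using k2 by (intro mult_le_mono1) simp
  then show "m \<le> (k - 1) * m" by (simp only: mult_1)
qed

text \<open>The half edge gained by a vertex outside \<open>W\<close> is set against its missing
  edge to \<open>U\<close>. In the doubled comparison the rooted bound contributes
  \<open>8 * k * m * m\<close> and the term \<open>(k * m) * (k * m)\<close> of the assumption a
  further \<open>2 * k * m * m\<close>, whence the 10.\<close>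

lemma few_bad_vertices:
  assumes "finite V" "\<not> kpaths l k V" "U \<subseteq> V" "card U = (k - 1) * m" "\<not> kpaths l 1 (V - U)"
    "k * m * card V \<le> ne V + card V + (k * m) * (k * m)"
  defines "L \<equiv> V - U"
  defines "W \<equiv> cn L U"
  shows "card (L - W) \<le> card U * card U + 2 * card U + 10 * k * m * m"
    and "m * card L \<le> ne L + card L + card U * card U + card U + k * m * m"
proof -
  let ?u = "card U"
  have fL: "finite L" and fU: "finite U" and fW: "finite W"
    using assms(1,3) finite_subset by (auto simp: L_def W_def cn_def)
  have WL: "W \<subseteq> L" by (auto simp: W_def cn_def)
  have km: "k * m = ?u + m" using assms(4) k2 by (cases k) auto
  have kU: "k \<le> ?u" using linkers_many assms(4) by simp
  have np: "\<not> packs (\<lambda>p. lpath m p \<and> hd p \<in> W) (2 * k) L"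
  proof
    assume h: "packs (\<lambda>p. lpath m p \<and> hd p \<in> W) (2 * k) L"
    obtain S where S: "S \<subseteq> U" "card S = k" using kU by (meson obtain_subset_with_card_n)
    obtain us where us: "set us = S" "distinct us"
      using finite_distinct_list[of S] fU S finite_subset by metis
    have lus: "length us = k" using us S distinct_card by fastforce
    have "kpaths l (length us) (L \<union> set us)"
    proof (rule kpaths_join[where q = m and W = W])
      show "adj u w" if "u \<in> set us" "w \<in> W" for u w
        using that us S by (auto simp: W_def cn_def)
      show "set us \<inter> L = {}" using us S by (auto simp: L_def)
    qed (use m_bounds us h lus in auto)
    then have "kpaths l k V" unfolding lus
      by (rule packs_mono) (use us S assms(3) in \<open>auto simp: L_def\<close>)
    then show False using assms(2) by simp
  qed
  have "L \<inter> W = W" using WL by auto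
  then have r: "2 * ne L + 2 * card W + card (L - W) \<le> 2 * m * card L + 8 * k * m * m"
    using few_rooted_paths_ne[OF fL _ np] assms(5) by (simp add: L_def algebra_simps)
  have cL: "card L = card W + card (L - W)"
    using WL fL fW by (simp add: card_Diff_subset card_mono)
  have cV: "card V = ?u + card L"
    using assms(1,3) fU by (simp add: L_def card_Diff_subset card_mono)
  have "ne (U \<union> L) = ne U + ne L + (\<Sum>y\<in>L. card (nb U y))"
    using fU fL by (intro ne_Un) (auto simp: L_def)
  moreover have "U \<union> L = V" using assms(3) by (auto simp: L_def)
  ultimately have e: "ne V = ne U + ne L + (\<Sum>y\<in>L. card (nb U y))" by simp
  have "(\<Sum>y\<in>L. card (nb U y)) + card (L - W) \<le> ?u * card L"
  proof -
    have "card (L - W) = (\<Sum>y\<in>L. if y \<in> W then 0 else 1)"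
      using fL by (simp add: sum.If_cases set_diff_eq Int_def)
    then have "(\<Sum>y\<in>L. card (nb U y)) + card (L - W)
        = (\<Sum>y\<in>L. card (nb U y) + (if y \<in> W then 0 else 1))" by (simp add: sum.distrib)
    also have "\<dots> \<le> (\<Sum>y\<in>L. ?u)"
    proof (rule sum_mono)
      fix y assume y: "y \<in> L"
      show "card (nb U y) + (if y \<in> W then 0 else 1) \<le> ?u"
      proof (cases "y \<in> W")
        case True
        then show ?thesis using card_nb_le[OF fU] by simp
      next
        case False
        then obtain a where "a \<in> U" "\<not> adj a y" using y by (auto simp: W_def cn_def)
        then have "nb U y \<subset> U" using adj_sym[of a y] by (auto simp: nb_def)
        then show ?thesis using psubset_card_mono[OF fU, of "nb U y"] False by simp
      qed
    qed
    finally show ?thesis by (simp add: mult.commute)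
  qed
  moreover have eU: "2 * ne U \<le> ?u * ?u"
    using ne_le[OF fU] mult_le_mono2[of "?u - 1" ?u ?u] by linarith
  ultimately have up: "2 * ne V + 2 * card (L - W) \<le> ?u * ?u + 2 * ne L + 2 * (?u * card L)"
    using e by linarith
  have lo: "(?u + m) * card L \<le> ne V + card L + ?u + (k * m * m)"
  proof -
    have "(k * m) * (k * m) = (?u + m) * ?u + k * m * m"
      using km by (metis distrib_left mult.assoc mult.commute)
    moreover have "(k * m) * card V = (?u + m) * ?u + (?u + m) * card L"
      using km cV by (simp add: algebra_simps)
    ultimately show ?thesis using assms(6) cV by linarith
  qed
  show "card (L - W) \<le> ?u * ?u + 2 * ?u + 10 * k * m * m"
    using up lo r cL by (simp add: algebra_simps)
  show "m * card L \<le> ne L + card L + ?u * ?u + ?u + k * m * m"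
    using up lo by (simp add: algebra_simps)
qed

text \<open>Room for the connecting vertices of \<open>k\<close> paths built from \<open>k * m\<close> linkers, \<open>m\<close> of these vertices
  being blocked in advance.\<close>
definition Nl :: nat where "Nl = k * (m + 1) + m"

text \<open>\<open>m\<close> members of \<open>B\<close> together with \<open>U\<close> would be
  \<open>k * m\<close> linkers. They need not share neighbours with each other, so they are
  interleaved with \<open>U\<close>. The extra \<open>m\<close> in the degree bound makes up for
  removing them from \<open>W\<close>.\<close>

lemma few_hubs:
  assumes "finite V" "\<not> kpaths l k V" "U \<subseteq> V" "card U = (k - 1) * m"
    "W \<subseteq> cn (V - U) U" "B \<subseteq> V - U" "\<And>v. v \<in> B \<Longrightarrow> Nl + m \<le> card (nb W v)"
  shows "card B < m"
proof (rule ccontr)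
  assume "\<not> card B < m"
  then obtain B' where B': "B' \<subseteq> B" "card B' = m"
    by (meson leI obtain_subset_with_card_n)
  define W' where "W' = W - B'"
  have fin: "finite U" "finite B'" "finite W"
    using assms B' finite_subset[of U V] finite_subset[of B' V] finite_subset[of W V]
    by (auto simp: cn_def) blast+
  then have fW': "finite W'" by (simp add: W'_def)
  obtain us where us: "set us = U" "distinct us" using finite_distinct_list[OF fin(1)] by auto
  obtain bs where bs: "set bs = B'" "distinct bs" using finite_distinct_list[OF fin(2)] by auto
  have len: "length us = (k - 1) * m" "length bs = m"
    using us bs assms(4) B'(2) distinct_card by fastforce+
  have nbB: "Nl \<le> card (nb W' v)" if "v \<in> B'" for v
    using card_nb_Diff[OF fin(3,2), of v] assms(7)[of v] that B' by (auto simp: W'_def)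
  have full: "adj u w" if "u \<in> U" "w \<in> W'" for u w
    using that assms(5) by (auto simp: W'_def cn_def)
  have nbU: "Nl \<le> card (nb W' u)" if "u \<in> U" for u
  proof -
    obtain v where "v \<in> B'" using B'(2) m_bounds by (metis card.empty ex_in_conv not_numeral_le_zero)
    then have "Nl \<le> card W'" using nbB card_nb_le[OF fW'] le_trans by blast
    then show ?thesis using nb_full[of W' u] full that by simp
  qed
  have lb: "length bs \<le> Suc (length us)" unfolding len using linkers_many(2) by (rule le_SucI)
  have "kpaths l k ((set (splice bs us) \<union> W') - {})"
  proof (rule blocks[where N = Nl and m = m])
    show "length (splice bs us) = k * m"
      using length_shuffles[OF splice_in_shuffles[of bs us]] len k2 by (cases k) auto
    show "distinct (splice bs us)"
      using us bs B' assms(6) by (intro distinct_splice) auto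
    show "set (splice bs us) \<inter> W' = {}"
      using us bs assms(5) by (auto simp: set_splice W'_def cn_def)
    show "linked Nl W' (splice bs us)"
      using linked_splice(1)[of us W' bs Nl] lb full nbU nbB us bs by auto
    show "Nl \<le> card (nb W' a)" if "a \<in> set (splice bs us)" for a
      using that nbU nbB us bs by (auto simp: set_splice)
  qed (use m_bounds fW' in \<open>auto simp: Nl_def\<close>)
  then have "kpaths l k V"
    by (rule packs_mono)
      (use us bs B' assms(3,5,6) in \<open>auto simp: set_splice W'_def cn_def\<close>)
  then show False using assms(2) by simp
qed

text \<open>With \<open>b = card B\<close> there are only \<open>(k - 1) * m + b\<close> linkers,
  too few for \<open>k\<close> blocks. For \<open>b > 0\<close> one path spends just
  \<open>b\<close> of them on a chain and is completed by two pieces inside \<open>W\<close>: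
  \<open>2 * b - 1 + 2 * (m - b + 1) = 2 * m + 1\<close>. For \<open>b = 0\<close> the pieces are
  glued in pairs at \<open>k\<close> vertices of \<open>U\<close>, and only there all
  \<open>2 * k\<close> are used.\<close>

lemma no_long_end_pieces:
  assumes "finite V" "\<not> kpaths l k V" "U \<subseteq> V" "card U = (k - 1) * m"
    "W \<subseteq> cn (V - U) U" "B \<subseteq> V - U" "B \<inter> W = {}" "card B < m"
    "\<And>v. v \<in> B \<Longrightarrow> Nl \<le> card (nb W v)" "Nl \<le> card W"
  shows "\<not> kpaths (m - card B + 1) (2 * k) W"
proof
  let ?b = "card B"
  assume pk: "kpaths (m - ?b + 1) (2 * k) W"
  have fin: "finite U" "finite B" "finite W"
    using assms finite_subset[of U V] finite_subset[of B V] finite_subset[of W V]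
    by (auto simp: cn_def)
  have full: "adj u w" if "u \<in> U" "w \<in> W" for u w
    using that assms(5) by (auto simp: cn_def)
  obtain us where us: "set us = U" "distinct us" using finite_distinct_list[OF fin(1)] by auto
  obtain bs where bs: "set bs = B" "distinct bs" using finite_distinct_list[OF fin(2)] by auto
  have len: "length us = (k - 1) * m" "length bs = ?b"
    using us bs assms(4) distinct_card by fastforce+
  have WV: "W \<subseteq> V" "W \<inter> U = {}" using assms(5) by (auto simp: cn_def)
  have ku: "k \<le> length us" "m \<le> length us" unfolding len by (rule linkers_many)+
  have nbU: "Nl \<le> card (nb W u)" if "u \<in> U" for u
    using assms(10) nb_full[of W u] full that by simp
  show False
  proof (cases "?b = 0")
    case True
    have "kpaths l (length (take k us)) (W \<union> set (take k us))"
    proof (rule kpaths_join[where q = "m + 1" and W = W])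
      show "adj u w" if "u \<in> set (take k us)" "w \<in> W" for u w
        using that full us by (auto dest: in_set_takeD)
      show "set (take k us) \<inter> W = {}" using us WV by (auto dest: in_set_takeD)
      have "packs (\<lambda>p. lpath (m + 1) p \<and> hd p \<in> W) (2 * k) W"
      proof (rule packs_weaken)
        show "kpaths (m + 1) (2 * k) W" using pk True by simp
        show "lpath (m + 1) p \<and> hd p \<in> W" if "lpath (m + 1) p" "set p \<subseteq> W" for p
        proof -
          have "p \<noteq> []" using that by auto
          then show ?thesis using that hd_in_set by blast
        qed
      qed
      then show "packs (\<lambda>p. lpath (m + 1) p \<and> hd p \<in> W) (2 * length (take k us)) W"
        using ku by (simp add: min_absorb2)
    qed (use m_bounds us in auto)
    then have "kpaths l k (W \<union> set (take k us))" using ku by (simp add: min_absorb2)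
    then have "kpaths l k V"
      by (rule packs_mono) (use us WV assms(3) in \<open>auto dest: in_set_takeD\<close>)
    then show False using assms(2) by simp
  next
    case False
    \<comment> \<open>More than half of the \<open>b\<close> linkers are taken from
      \<open>U\<close>, so the chain has both ends in \<open>U\<close>, where any vertex of
      \<open>W\<close> can be attached. There remain \<open>x\<close> vertices of \<open>B\<close>
      and \<open>(k - 1) * m - x\<close> of \<open>U\<close>, enough to separate them.\<close>
    define x where "x = ?b div 2 + 1"
    define y where "y = ?b - x"
    have xy: "y < x" "x + y = ?b" "x \<le> length us" "2 * x \<le> m + 1" "y \<le> ?b"
    proof -
      have "2 * x \<le> ?b + 2" "?b + 1 \<le> 2 * x" "1 \<le> ?b" using False by (auto simp: x_def)
      then show "y < x" "x + y = ?b" "x \<le> length us" "2 * x \<le> m + 1" "y \<le> ?b"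
        using assms(8) ku unfolding y_def by arith+
    qed
    have "kpaths (m - ?b + 1) 2 W" using packs_le[OF pk, of 2] k2 by simp
    then obtain p1 p2 where pp: "lpath (m - ?b + 1) p1" "lpath (m - ?b + 1) p2"
      "set p1 \<subseteq> W" "set p2 \<subseteq> W - set p1" by (auto simp: numeral_2_eq_2)
    then have pne: "p1 \<noteq> []" "p2 \<noteq> []" by auto
    let ?a1 = "splice (take x us) (take y bs)" and ?a2 = "splice (drop y bs) (drop x us)"
    have tk: "length (take x us) = x" "length (take y bs) = y" "length (drop y bs) = x"
      "length (drop x us) = (k - 1) * m - x" using xy len by auto
    have sub: "set (take x us) \<subseteq> U" "set (take y bs) \<subseteq> B" "set (drop y bs) \<subseteq> B" "set (drop x us) \<subseteq> U"
      using us bs by (auto dest: in_set_takeD in_set_dropD)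
    have dj: "set (take x us) \<inter> set (drop x us) = {}" "set (take y bs) \<inter> set (drop y bs) = {}"
      using us(2) bs(2) by (auto simp: set_take_disj_set_drop_if_distinct)
    have UB: "U \<inter> B = {}" using assms(6) by auto
    have nbs: "Nl \<le> card (nb W a)" if "a \<in> U \<union> B" for a using that nbU assms(9) by auto
    let ?X = "set p1 \<union> set p2"
    have cX: "card (?X \<inter> W) \<le> 2 * (m - ?b + 1)"
    proof -
      have "card (?X \<inter> W) \<le> card ?X" by (intro card_mono) auto
      also have "\<dots> \<le> card (set p1) + card (set p2)" by (rule card_Un_le)
      also have "\<dots> = 2 * (m - ?b + 1)" using pp path_length by (metis mult_2)
      finally show ?thesis .
    qed
    have len1: "length ?a1 = ?b"
      using length_shuffles[OF splice_in_shuffles[of "take x us" "take y bs"]] tk xy by simp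
    have km: "m \<le> (k - 1) * m" "k + (k - 1) * m = k * m + k - m"
      using k2 by (cases k; auto)+
    have Nl: "2 * m + 2 + (k - 1) * (m + 1) \<le> Nl + 1"
      unfolding Nl_def using k2 by (cases k) auto
    have "\<exists>p. path p \<and> hd p = hd ?a1 \<and> last p = last ?a1 \<and> length p = 2 * length ?a1 - 1 \<and>
      set ?a1 \<subseteq> set p \<and> set p \<subseteq> set ?a1 \<union> (W - ?X)"
    proof (rule chain[where N = Nl])
      show "?a1 \<noteq> []" using len1 False by (metis list.size(3))
      show "distinct ?a1" using us bs sub UB by (intro distinct_splice) auto
      show "set ?a1 \<inter> W = {}" using sub WV assms(7) by (auto simp: set_splice)
      show "linked Nl W ?a1"
        using sub tk xy full nbs by (intro linked_splice(2)) (auto simp: subset_iff)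
      show "card (?X \<inter> W) + length ?a1 \<le> Nl" 
      proof -
        have "1 * (m + 1) \<le> k * (m + 1)" using k2 by (intro mult_le_mono1) simp
        then have "2 * m + 1 \<le> Nl" by (simp add: Nl_def)
        moreover have "2 * (m - ?b + 1) + ?b \<le> 2 * m + 1" using False assms(8) by simp
        ultimately show ?thesis using cX len1 by linarith
      qed
    qed (use fin in auto)
    then obtain p where p: "path p" "hd p = hd ?a1" "last p = last ?a1" "length p = 2 * ?b - 1"
      "set p \<subseteq> set ?a1 \<union> (W - ?X)" using len1 by auto
    have pne': "p \<noteq> []" using p(4) False by auto
    let ?P = "rev p1 @ p @ p2"
    have hU: "hd p \<in> U" "last p \<in> U"
      using hd_splice[of "take y bs" "take x us"] last_splice[of "take y bs" "take x us"]
        tk xy sub p by auto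
    have a: "adj (last (rev p1)) (hd (p @ p2))" "adj (last p) (hd p2)"
    proof -
      have "hd p1 \<in> W" "hd p2 \<in> W" using pp pne hd_in_set by blast+
      then show "adj (last (rev p1)) (hd (p @ p2))" "adj (last p) (hd p2)"
        using hU full adj_sym[of "hd p" "hd p1"] pne pne' by (auto simp: last_rev)
    qed
    have a1W: "set ?a1 \<inter> W = {}" using sub WV assms(7) by (auto simp: set_splice)
    have d1: "set p \<inter> set p2 = {}" "set (rev p1) \<inter> set (p @ p2) = {}"
      using p(5) pp a1W by auto
    have "path (p @ p2)" unfolding path_append using p(1) pp(2) a(2) d1(1) by simp
    then have pathP: "path ?P" unfolding path_append[of "rev p1"] using pp(1) a(1) d1(2) by simp
    have lP: "length ?P = 2 * m + 1" using pp p(4) False assms(8) by simp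
    have sP: "set ?P \<subseteq> set ?a1 \<union> W" using p(5) pp by auto
    have "card (set ?P \<inter> W) \<le> 2 * m + 1"
      using card_mono[of "set ?P" "set ?P \<inter> W"] path_length[OF pathP] lP by simp
    moreover have a2: "length ?a2 = (k - 1) * m"
      using length_shuffles[OF splice_in_shuffles[of "drop y bs" "drop x us"]] tk xy km(1) len
      by simp
    moreover have a12: "set ?a2 \<inter> set ?a1 = {}" "set ?a2 \<inter> W = {}"
      using sub dj UB WV assms(7) unfolding set_splice by blast+
    moreover have "kpaths l (k - 1) ((set ?a2 \<union> W) - set ?P)"
    proof (rule blocks[where N = Nl and m = m])
      show "distinct ?a2" using us bs sub UB by (intro distinct_splice) auto
      show "linked Nl W ?a2"
      proof (rule linked_splice(1))
        show "length (drop y bs) \<le> Suc (length (drop x us))" using tk xy km(1) by linarith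
      qed (use sub full nbs in \<open>auto simp: subset_iff\<close>)
      show "Nl \<le> card (nb W a)" if "a \<in> set ?a2" for a
        using that nbs sub unfolding set_splice by blast
      show "set ?a2 \<inter> set ?P = {}" using a12 sP by blast
      show "card (set ?P \<inter> W) + (k - 1) * (m + 1) \<le> Nl"
        using calculation(1) Nl by simp
    qed (use a2 a12 m_bounds fin in auto)
    then have "kpaths l (k - 1) (V - set ?P)"
      by (rule packs_mono)
        (use sub WV assms(3,6) in \<open>auto simp: set_splice\<close>)
    moreover have "set ?P \<subseteq> V"
      using sP sub WV assms(3,6) unfolding set_splice by blast
    ultimately have "kpaths l (Suc (k - 1)) V"
      using kpaths_Suc[OF pathP, of l V] lP m_bounds by simp
    then show False using assms(2) k2 by simp
  qed
qed

text \<open>\<open>Y0\<close> is left open so that the forbidden graph can be embedded later.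
  \<open>q\<close> bounds the vertices of \<open>L\<close> outside \<open>W\<close>;
  \<open>D\<close> is the degree into \<open>W\<close> from which a vertex joins \<open>B\<close>,
  so that all others have bounded degree there.\<close>

lemma exists_hub_set:
  fixes Y0 :: nat
  assumes fV: "finite V" and free: "\<not> kpaths l k V"
    and many: "k * m * card V \<le> ne V + card V + (k * m) * (k * m)"
    and n1: "2 * ((k * m) * (k * m)) + (k + 1) * Nk + l * l < card V"
  defines "u \<equiv> (k - 1) * m" and "q \<equiv> ((k - 1) * m) * ((k - 1) * m) + 2 * ((k - 1) * m) + 10 * k * m * m"
    and "D \<equiv> Nl + m"
  assumes n2: "u + q + m + 2 * (q * D + m * (m + q) + u * u + u + k * m * m) +
      4 * k * (m + 1) * D + Y0 < card V"
  shows "\<exists>A\<subseteq>V. card A = k * m - 1 \<and> Y0 \<le> card (cn V A)"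
proof (rule ccontr)
  assume neg: "\<not> ?thesis"
  have "2 * k * m * card V \<le> 2 * ne V + 2 * ((k * m) * (k * m)) + 2 * card V"
    using many by simp
  then obtain U where U: "U \<subseteq> V" "card U = u" "\<not> kpaths l 1 (V - U)"
    using linker_set[of k V "card V" "2 * ((k * m) * (k * m))"] k2 fV free n1
    by (auto simp: u_def)
  have cU: "card U = (k - 1) * m" using U(2) by (simp add: u_def)
  define L where "L = V - U"
  define W where "W = cn L U"
  have bad: "card (L - W) \<le> q" "m * card L \<le> ne L + card L + u * u + u + k * m * m"
    using few_bad_vertices[OF fV free U(1) cU U(3) many] by (auto simp: L_def W_def q_def u_def cU)
  define B where "B = {v \<in> L. D \<le> card (nb W v)}"
  have BL: "B \<subseteq> V - U" by (auto simp: B_def L_def)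
  have bm: "card B < m"
    by (rule few_hubs[OF fV free U(1) cU _ BL, of W]) (auto simp: W_def L_def B_def D_def)
  let ?b = "card B"
  define W1 where "W1 = W - B"
  define R1 where "R1 = L - W - B"
  have fin: "finite L" "finite W" "finite B" "finite W1" "finite R1" "finite U"
    using fV U(1) finite_subset[of U V]
    by (auto simp: L_def W_def B_def W1_def R1_def cn_def)
  have WL: "W \<subseteq> L" by (auto simp: W_def cn_def)
  have cL: "card L \<le> card W1 + q + m"
  proof -
    have "L \<subseteq> W1 \<union> (L - W) \<union> B" by (auto simp: W1_def)
    then have "card L \<le> card (W1 \<union> (L - W) \<union> B)" using fin by (intro card_mono) auto
    also have "\<dots> \<le> card W1 + card (L - W) + card B"
      using card_Un_le[of "W1 \<union> (L - W)" B] card_Un_le[of W1 "L - W"] by linarith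
    finally show ?thesis using bad(1) bm by linarith
  qed
  have cV: "card V = u + card L"
    using U fV fin card_mono[OF fV U(1)] by (simp add: L_def card_Diff_subset)
  \<comment> \<open>\<open>c1\<close> collects what does not grow with \<open>card W1\<close>: edges
    between \<open>R1\<close> and \<open>W1\<close>, edges inside \<open>B \<union> R1\<close>, and
    the errors of the edge count. \<open>T\<close> bounds the surplus needed to pack
    \<open>2 * k\<close> short paths greedily.\<close>
  define c1 where "c1 = q * D + m * (m + q) + u * u + u + k * m * m"
  define T where "T = 4 * k * (m + 1) * D"
  have W1big: "2 * c1 + T + Y0 < card W1" using n2 cV cL by (simp add: c1_def T_def)
  have "1 * D \<le> 4 * k * (m + 1) * D" by (intro mult_le_mono1) (use k2 in simp)
  then have DT: "D \<le> T" unfolding T_def by (simp only: mult_1)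
  have "\<not> kpaths (m - ?b + 1) (2 * k) W1"
  proof (rule no_long_end_pieces[OF fV free U(1) cU _ BL _ bm])
    show "W1 \<subseteq> cn (V - U) U" by (auto simp: W1_def W_def L_def)
    show "B \<inter> W1 = {}" by (auto simp: W1_def)
    show "Nl \<le> card (nb W1 v)" if "v \<in> B" for v
      using card_nb_Diff[OF fin(2,3), of v] that bm by (auto simp: W1_def B_def D_def)
    show "Nl \<le> card W1" using W1big DT by (simp add: D_def)
  qed
  moreover have dW1: "card (nb W1 w) \<le> D" if "w \<in> L - B" for w
    using that card_nb_mono[OF fin(2), of W1 w] WL by (auto simp: W1_def B_def)
  ultimately have "2 * ne W1 \<le> (m - ?b + 1 - 2) * card W1 + 2 * (2 * k) * (m - ?b + 1) * D"
    using bounded_degree_packs[OF fin(4), of D "m - ?b + 1" "2 * k"] bm WL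
    by (force simp: W1_def)
  moreover have "2 * (2 * k) * (m - ?b + 1) * D \<le> T"
  proof -
    have "4 * k * (m - ?b + 1) * D \<le> T"
      unfolding T_def by (rule mult_le_mono1[OF mult_le_mono2]) simp
    then show ?thesis by (simp add: mult.assoc)
  qed
  ultimately have eW1: "2 * ne W1 \<le> (m - ?b - 1) * card W1 + T" by (simp add: numeral_2_eq_2)
  have "L = (B \<union> R1) \<union> W1" "(B \<union> R1) \<inter> W1 = {}"
    using WL BL by (auto simp: W1_def R1_def L_def)
  then have eL: "ne L = ne (B \<union> R1) + ne W1 + (\<Sum>w\<in>W1. card (nb (B \<union> R1) w))"
    using ne_Un[of "B \<union> R1" W1] fin by simp
  have "\<not> kpaths l 1 (B \<union> R1)"
  proof
    assume "kpaths l 1 (B \<union> R1)"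
    then have "kpaths l 1 (V - U)" by (rule packs_mono) (use BL in \<open>auto simp: R1_def L_def\<close>)
    then show False using U(3) by simp
  qed
  then have "2 * ne (B \<union> R1) + card (B \<union> R1) \<le> 2 * m * card (B \<union> R1)"
    using fin by (intro no_path_ne) auto
  moreover have cR1: "card R1 \<le> q" using bad(1) card_mono[of "L - W" R1] fin by (auto simp: R1_def)
  then have "card (B \<union> R1) \<le> m + q" using card_Un_le[of B R1] bm by linarith
  then have "2 * m * card (B \<union> R1) \<le> 2 * m * (m + q)" by (rule mult_le_mono2)
  ultimately have e1: "ne (B \<union> R1) \<le> m * (m + q)" by linarith
  have "(\<Sum>w\<in>W1. card (nb R1 w)) = (\<Sum>x\<in>R1. card (nb W1 x))" by (rule sum_nb_swap) (use fin in auto)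
  also have "\<dots> \<le> (\<Sum>x\<in>R1. D)" by (intro sum_mono dW1) (auto simp: R1_def)
  also have "\<dots> \<le> q * D" using cR1 by (simp add: mult_le_mono1)
  finally have e2: "(\<Sum>w\<in>W1. card (nb R1 w)) \<le> q * D" .
  have "(\<Sum>w\<in>W1. card (nb (B \<union> R1) w)) \<le> (\<Sum>w\<in>W1. card (nb B w) + card (nb R1 w))"
    using fin by (intro sum_mono card_nb_Un) auto
  then have e3: "(\<Sum>w\<in>W1. card (nb (B \<union> R1) w)) \<le> (\<Sum>w\<in>W1. card (nb B w)) + q * D"
    using e2 by (simp add: sum.distrib)
  have "card W1 \<le> card L" using fin WL by (intro card_mono) (auto simp: W1_def)
  then have "(m - 1) * card W1 \<le> (m - 1) * card L" by (rule mult_le_mono2)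
  moreover have "(m - 1) * card L + card L = m * card L"
    using m_bounds by (cases m) auto
  ultimately have main: "(m - 1) * card W1 \<le> ne W1 + (\<Sum>w\<in>W1. card (nb B w)) + c1"
    using bad(2) eL e1 e3 unfolding c1_def by linarith
  show False
  proof (cases "?b = m - 1")
    \<comment> \<open>On average a vertex of \<open>W1\<close> must account for \<open>m - 1\<close>
      edges, at most \<open>?b\<close> of them to \<open>B\<close>. So nearly
      \<open>m - 1 - ?b\<close> per vertex lie inside \<open>W1\<close>, but the packing bound
      allows only half of that.\<close>
    case False
    then have b: "?b + 1 < m" using bm by linarith
    have "(\<Sum>w\<in>W1. card (nb B w)) \<le> (\<Sum>w\<in>W1. ?b)" by (intro sum_mono card_nb_le fin)
    then have "(\<Sum>w\<in>W1. card (nb B w)) \<le> ?b * card W1" by (simp add: mult.commute)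
    moreover define c where "c = m - ?b - 1"
    have c: "1 \<le> c" "m - 1 = ?b + c" using b by (auto simp: c_def)
    have "(m - 1) * card W1 = ?b * card W1 + c * card W1" unfolding c(2) by (rule add_mult_distrib)
    ultimately have "c * card W1 \<le> 2 * c1 + T" using main eW1 unfolding c_def[symmetric] by linarith
    moreover have "1 * card W1 \<le> c * card W1" using c(1) by (rule mult_le_mono1)
    ultimately show False using W1big by linarith
  next
    case True
    have UB: "U \<inter> B = {}" using BL by auto
    have "card (U \<union> B) = (k - 1) * m + (m - 1)"
      using UB fin cU True by (simp add: card_Un_disjoint)
    also have "\<dots> = k * m - 1" using k2 m_bounds by (cases k) auto
    finally have cA: "card (U \<union> B) = k * m - 1" .
    have "U \<union> B \<subseteq> V" using U(1) BL by auto
    then have small: "card (cn V (U \<union> B)) < Y0" using neg cA by force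
    \<comment> \<open>Now \<open>ne W1\<close> is bounded by \<open>T / 2\<close>, so all but
      boundedly many vertices of \<open>W1\<close> are joined to all of \<open>B\<close> and hence
      are common neighbours of \<open>U \<union> B\<close>.\<close>
    define F where "F = {w \<in> W1. nb B w = B}"
    have "F \<subseteq> cn V (U \<union> B)"
    proof
      fix w assume w: "w \<in> F"
      then have "\<And>b. b \<in> B \<Longrightarrow> adj b w" unfolding F_def nb_def using adj_sym[of w] by blast
      then show "w \<in> cn V (U \<union> B)"
        using w by (auto simp: F_def W1_def W_def cn_def L_def)
    qed
    then have "card F \<le> card (cn V (U \<union> B))" using fV by (intro card_mono finite_cn)
    then have F: "card F < Y0" using small by simp
    have "(\<Sum>w\<in>W1. card (nb B w)) + card W1 = (\<Sum>w\<in>W1. card (nb B w) + 1)"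
      by (simp only: sum.distrib card_eq_sum)
    also have "\<dots> \<le> (\<Sum>w\<in>W1. ?b + (if w \<in> F then 1 else 0))"
    proof (rule sum_mono)
      fix w assume w: "w \<in> W1"
      show "card (nb B w) + 1 \<le> ?b + (if w \<in> F then 1 else 0)"
      proof (cases "w \<in> F")
        case True
        then show ?thesis using card_nb_le[OF fin(3)] by simp
      next
        case False
        then have "nb B w \<subset> B" using w nb_subset[of B w] by (auto simp: F_def)
        then show ?thesis using psubset_card_mono[OF fin(3), of "nb B w"] False by simp
      qed
    qed
    also have "\<dots> = (m - 1) * card W1 + card F"
    proof -
      have "(\<Sum>w\<in>W1. if w \<in> F then 1 else 0) = card (W1 \<inter> F)"
        using fin by (simp add: sum.If_cases)
      moreover have "W1 \<inter> F = F" by (auto simp: F_def)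
      ultimately show ?thesis using True by (simp add: sum.distrib mult.commute)
    qed
    finally have "card W1 \<le> ne W1 + c1 + card F" using main by linarith
    moreover have "m - ?b - 1 = 0" using True by simp
    ultimately show False using eW1 F W1big by simp
  qed
qed

section \<open>The edge count around a hub set\<close>

lemma hub_blocks:
  assumes "set as \<subseteq> A" "A \<subseteq> V" "distinct as" "length as = (k - 1) * m" "set as \<inter> X = {}"
    "finite X" "finite V" "Nl \<le> card (cn V A)" "card (X \<inter> cn V A) \<le> 2 * m + 1"
  shows "kpaths l (k - 1) (V - X)"
proof -
  let ?W = "cn V A"
  have full: "nb ?W a = ?W" if "a \<in> set as" for a
    using that assms(1) by (intro nb_full) (auto simp: cn_def)
  have "kpaths l (k - 1) ((set as \<union> ?W) - X)"
  proof (rule blocks[where N = Nl and m = m])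
    show "set as \<inter> ?W = {}" using assms(1) cn_disjoint by blast
    show "linked Nl ?W as" using full assms(8) by (intro linkedI) auto
    \<comment> \<open>\<open>Nl\<close> is exactly the need of \<open>k - 1\<close> blocks plus the
      \<open>2 * m + 1\<close> vertices that the remaining path may occupy.\<close>
    have "Nl = (k - 1) * (m + 1) + 2 * m + 1" unfolding Nl_def using k2 by (cases k) auto
    then show "card (X \<inter> ?W) + (k - 1) * (m + 1) \<le> Nl" using assms(9) by simp
  qed (use assms m_bounds full finite_cn in auto)
  then show ?thesis by (rule packs_mono) (use assms in \<open>auto simp: cn_def\<close>)
qed

text \<open>\<open>a\<close> and \<open>m - 2\<close> further hubs carry a chain on
  \<open>2 * m - 3\<close> vertices, prolonged by \<open>p1\<close> at \<open>a\<close> and by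
  \<open>p2\<close> at its far end; the other \<open>(k - 1) * m\<close> hubs give the remaining
  paths. \<open>p1\<close> needs an edge to \<open>a\<close> only, while \<open>p2\<close> starts in
  the common neighbourhood because the far end is arbitrary.\<close>

lemma attach_to_hubs:
  assumes "finite V" "\<not> kpaths l k V" "A \<subseteq> V" "card A = k * m - 1" "Nl \<le> card (cn V A)"
    "a \<in> A" "path p1" "path p2" "set p1 \<subseteq> V - A" "set p2 \<subseteq> V - A" "set p1 \<inter> set p2 = {}"
    "p1 \<noteq> []" "p2 \<noteq> []" "adj a (hd p1)" "hd p2 \<in> cn V A" "length p1 + length p2 \<le> 4"
  shows "length p1 + length p2 + 2 * m < l + 3"
proof (rule ccontr)
  assume len: "\<not> ?thesis"
  let ?W = "cn V A"
  have fA: "finite A" using assms finite_subset by blast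
  obtain zs where zs: "set (a # zs) = A" "distinct (a # zs)" "length zs = card A - 1"
    using finite_distinct_list_Cons[OF fA assms(6)] .
  have AW: "A \<inter> ?W = {}" by (rule cn_disjoint)
  let ?a1 = "a # take (m - 2) zs" and ?a2 = "drop (m - 2) zs"
  have km: "k * m = (k - 1) * m + m" using k2 by (cases k) auto
  have lz: "length ?a1 = m - 1" "length ?a2 = (k - 1) * m"
    using zs(3) assms(4) km m_bounds by auto
  have sub: "set ?a1 \<subseteq> A" "set ?a2 \<subseteq> A" using zs(1) by (auto dest: in_set_takeD in_set_dropD)
  have dj: "set ?a1 \<inter> set ?a2 = {}" "distinct ?a1" "distinct ?a2"
    using zs(2) set_take_disj_set_drop_if_distinct[of zs "m - 2" "m - 2"]
    by (auto dest: in_set_takeD in_set_dropD)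
  have full: "nb ?W b = ?W" if "b \<in> A" for b using that by (intro nb_full) (auto simp: cn_def)
  let ?X = "set p1 \<union> set p2"
  have cX: "card (?X \<inter> ?W) \<le> 4"
  proof -
    have "card (?X \<inter> ?W) \<le> card ?X" by (intro card_mono) auto
    also have "\<dots> \<le> length p1 + length p2"
      using card_Un_le[of "set p1" "set p2"] card_length[of p1] card_length[of p2] by linarith
    finally show ?thesis using assms(16) by linarith
  qed
  have Nl3: "m + 3 \<le> Nl"
  proof -
    have "2 * (m + 1) \<le> k * (m + 1)" by (rule mult_le_mono1[OF k2])
    then show ?thesis using m_bounds by (simp add: Nl_def)
  qed
  have "\<exists>p. path p \<and> hd p = hd ?a1 \<and> last p = last ?a1 \<and> length p = 2 * length ?a1 - 1 \<and>
      set ?a1 \<subseteq> set p \<and> set p \<subseteq> set ?a1 \<union> (?W - ?X)"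
  proof (rule chain[where N = Nl])
    show "set ?a1 \<inter> ?W = {}" using sub AW by blast
    show "linked Nl ?W ?a1" using sub full assms(5) by (intro linkedI) (auto simp: subset_iff)
    show "card (?X \<inter> ?W) + length ?a1 \<le> Nl" using cX lz(1) Nl3 m_bounds by linarith
  qed (use dj assms finite_cn in auto)
  then obtain p where p: "path p" "hd p = a" "last p = last ?a1" "length p = 2 * (m - 1) - 1"
      "set p \<subseteq> set ?a1 \<union> (?W - ?X)" using lz(1) by auto
  have pne: "p \<noteq> []" using p(4) m_bounds by auto
  let ?P = "rev p1 @ p @ p2"
  have "last p \<in> A" using p(3) sub(1) last_in_set[of ?a1] by auto
  then have "adj (last p) (hd p2)" using assms(15) by (auto simp: cn_def)
  moreover have "set p \<inter> set p2 = {}" "set (rev p1) \<inter> set (p @ p2) = {}"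
    using p(5) sub(1) assms(9,10,11) unfolding set_rev set_append by blast+
  moreover have "adj (last (rev p1)) (hd (p @ p2))"
    using assms(12,14) pne p(2) adj_sym[of a "hd p1"] by (simp add: last_rev)
  ultimately have pathP: "path ?P"
    unfolding path_append using p(1) assms(7,8) by auto
  have lP: "length ?P = length p1 + length p2 + 2 * m - 3" using p(4) m_bounds by simp
  have "set p \<subseteq> V" using p(5) sub(1) assms(3) cn_subset[of V A] by blast
  then have sP: "set ?P \<subseteq> V" using assms(9,10) by auto
  have "kpaths l (k - 1) (V - set ?P)"
  proof (rule hub_blocks[OF sub(2) assms(3) dj(3) lz(2) _ _ assms(1,5)])
    have "set p \<subseteq> set ?a1 \<union> (V - A)" using p(5) AW cn_subset[of V A] by blast
    then have "set ?P \<subseteq> set ?a1 \<union> (V - A)"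
      using assms(9,10) unfolding set_append set_rev by blast
    then show "set ?a2 \<inter> set ?P = {}" using sub(2) dj(1) by blast
    have "card (set ?P \<inter> ?W) \<le> card (set ?P)" by (intro card_mono) auto
    also have "\<dots> \<le> length ?P" by (rule card_length)
    also have "\<dots> \<le> 2 * m + 1" using lP assms(16) by linarith
    finally show "card (set ?P \<inter> ?W) \<le> 2 * m + 1" .
  qed auto
  then have "kpaths l (Suc (k - 1)) V"
    using kpaths_Suc[OF pathP _ sP] lP len by simp
  then show False using assms(2) k2 by simp
qed

lemma path_avoiding_hubs:
  assumes "finite V" "\<not> kpaths l k V" "A \<subseteq> V" "card A = k * m - 1" "Nl \<le> card (cn V A)"
  shows "\<not> kpaths l 1 (V - A)"
proof
  assume "kpaths l 1 (V - A)"
  then obtain p where p: "lpath l p" "set p \<subseteq> V - A" by auto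
  obtain zs where zs: "set zs = A" "distinct zs"
    using finite_distinct_list[of A] assms finite_subset by metis
  have "(k - 1) * m \<le> length zs"
  proof -
    have "length zs = k * m - 1" using zs assms(4) distinct_card by metis
    moreover have "k * m = (k - 1) * m + m" using k2 by (cases k) auto
    ultimately show ?thesis using m_bounds by simp
  qed
  then have "length (take ((k - 1) * m) zs) = (k - 1) * m" by simp
  moreover have st: "set (take ((k - 1) * m) zs) \<subseteq> A" using zs by (auto dest: in_set_takeD)
  moreover have "card (set p \<inter> cn V A) \<le> 2 * m + 1"
  proof -
    have "card (set p \<inter> cn V A) \<le> card (set p)" by (intro card_mono) auto
    also have "\<dots> \<le> length p" by (rule card_length)
    finally show ?thesis using p m_bounds by linarith
  qed
  ultimately have "kpaths l (k - 1) (V - set p)"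
    using p zs assms by (intro hub_blocks[where A = A and as = "take ((k - 1) * m) zs"]) auto
  then have "kpaths l (Suc (k - 1)) V" using p by auto
  then show False using assms(2) k2 by simp
qed

text \<open>A vertex kept by the peeling has degree \<open>> k * m - 1\<close>, so it starts (or is the middle of) a
  three-vertex path in the complement of \<open>A\<close>, unless it lies on an isolated edge of the common
  neighbourhood or has no neighbour in \<open>A\<close>.\<close>
lemma hub_set_bound:
  fixes eps :: nat
  assumes fV: "finite V" and free: "\<not> kpaths l k V" and A: "A \<subseteq> V" "card A = k * m - 1"
    and big: "Nl \<le> card (cn V A)" and indep: "\<And>a b. a \<in> A \<Longrightarrow> b \<in> A \<Longrightarrow> \<not> adj a b"
    and eps: "\<And>x y. x \<in> cn V A \<Longrightarrow> y \<in> cn V A \<Longrightarrow> adj x y \<Longrightarrow> 1 \<le> eps"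
  shows "ne V \<le> (k * m - 1) * (card V - (k * m - 1)) + eps"
proof -
  let ?W = "cn V A" and ?s = "k * m - 1" and ?L = "V - A"
  have fA: "finite A" using A(1) fV finite_subset by blast
  have s1: "2 * m \<le> k * m" using k2 by (rule mult_le_mono1)
  have "4 \<le> k * m" using mult_le_mono[OF k2 m_bounds(1)] by simp
  then have A0: "A \<noteq> {}" using A(2) by auto
  have WL: "?W \<subseteq> ?L" using cn_disjoint[of A V] cn_subset[of V A] by blast
  have dA: "card (nb A x) \<le> ?s" for x using card_nb_le[OF fA] A(2) by simp
  have Nl5: "5 \<le> Nl"
  proof -
    have "2 * (m + 1) \<le> k * (m + 1)" by (rule mult_le_mono1[OF k2])
    then show ?thesis using m_bounds by (simp add: Nl_def)
  qed
  have no3: False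
    if "x \<in> ?L" "y \<in> ?L" "z \<in> ?L" "adj x y" "adj y z" "x \<noteq> z" "a \<in> A" "adj a x" for x y z a
  proof -
    have "card {x, y, z} \<le> 3" by (rule card_insert_le_m1; simp add: card_insert_if)+
    then obtain w where w: "w \<in> ?W" "w \<notin> {x, y, z}"
      using ex_in_not_in[of "{x, y, z}" ?W] big Nl5 by auto
    have "x \<noteq> y" "y \<noteq> z" using that adj_irrefl by metis+
    then have p: "path [x, y, z]" using that by (auto simp: path_Cons)
    have "length [x, y, z] + length [w] + 2 * m < l + 3"
      by (rule attach_to_hubs[OF fV free A big that(7) p]) (use that w WL in auto)
    then show False using m_bounds by simp
  qed
  have no22: False
    if "x \<in> ?W" "y \<in> ?W" "x' \<in> ?W" "y' \<in> ?W" "adj x y" "adj x' y'" "{x, y} \<inter> {x', y'} = {}" for x y x' y'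
  proof -
    obtain a where a: "a \<in> A" using A0 by auto
    have "x \<noteq> y" "x' \<noteq> y'" using that adj_irrefl by metis+
    then have p: "path [x, y]" "path [x', y']" using that by (auto simp: path_Cons)
    have "length [x, y] + length [x', y'] + 2 * m < l + 3"
      by (rule attach_to_hubs[OF fV free A big a p]) (use that WL a in \<open>auto simp: cn_def\<close>)
    then show False using m_bounds by simp
  qed
  \<comment> \<open>The left side counts edges inside \<open>X\<close> and between \<open>X\<close>
    and \<open>A\<close>; for \<open>X = ?L\<close> these are all edges, \<open>A\<close> being
    independent.\<close>
  have peel: "ne X + (\<Sum>x\<in>X. card (nb A x)) \<le> ?s * card X + eps" if "X \<subseteq> ?L" for X
    using that
  proof (induction "card X" arbitrary: X rule: less_induct)
    case less
    have fX: "finite X" using less.prems fV finite_subset by blast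
    show ?case
    proof (cases "\<exists>x\<in>X. card (nb X x) + card (nb A x) \<le> ?s")
      case True
      then obtain x where x: "x \<in> X" "card (nb X x) + card (nb A x) \<le> ?s" by auto
      have c: "card X = Suc (card (X - {x}))" using fX x by (metis card.remove)
      then have "ne (X - {x}) + (\<Sum>x\<in>X - {x}. card (nb A x)) \<le> ?s * card (X - {x}) + eps"
        using less by auto
      moreover have "ne X = ne (X - {x}) + card (nb X x)"
        using ne_remove[OF fX x(1)] by (simp add: nb_remove_self)
      moreover have "(\<Sum>x\<in>X. card (nb A x)) = card (nb A x) + (\<Sum>x\<in>X - {x}. card (nb A x))"
        by (rule sum.remove[OF fX x(1)])
      ultimately show ?thesis using c x(2) by simp
    next
      case False
      then have deg: "\<And>x. x \<in> X \<Longrightarrow> ?s < card (nb X x) + card (nb A x)" by (auto simp: not_le)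
      have deg1: "1 \<le> card (nb X x)" if "x \<in> X" for x using deg[OF that] dA[of x] by linarith
      have deg2: "2 \<le> card (nb X x)" if "x \<in> X" "x \<notin> ?W" for x
      proof -
        have "\<exists>a\<in>A. \<not> adj a x" using that less.prems by (auto simp: cn_def)
        then have "nb A x \<subset> A" using adj_sym[of x] by (auto simp: nb_def)
        then have "card (nb A x) < ?s" using psubset_card_mono[OF fA] A(2) by metis
        then show ?thesis using deg[OF that(1)] by linarith
      qed
      have other: "\<exists>z. z \<in> nb X x \<and> z \<noteq> y" if "2 \<le> card (nb X x)" for x y
        using ex_in_not_in[of "{y}" "nb X x"] that by auto
      \<comment> \<open>A three-vertex path is needed whose first vertex sees \<open>A\<close>. It
        is \<open>x, y, z\<close> if \<open>y\<close> has a second neighbour; otherwise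
        \<open>y\<close> lies in the common neighbourhood by \<open>deg2\<close>, and
        \<open>y, x, y'\<close> serves.\<close>
      have noA: "nb A x = {}" if x: "x \<in> X" "x \<notin> ?W" for x
      proof (rule ccontr)
        assume "nb A x \<noteq> {}"
        then obtain a where a: "a \<in> A" "adj a x" using adj_sym[of x] by (auto simp: nb_def)
        have "nb X x \<noteq> {}" using deg1[OF x(1)] by auto
        then obtain y where y: "y \<in> nb X x" by auto
        obtain y' where y': "y' \<in> nb X x" "y' \<noteq> y" using other deg2[OF x] by blast
        have X: "x \<in> ?L" "y \<in> ?L" "y' \<in> ?L" "adj x y" "adj x y'" "y \<in> X"
          using x y y' less.prems by (auto simp: nb_def)
        show False
        proof (cases "\<exists>z. z \<in> nb X y \<and> z \<noteq> x")
          case True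
          then obtain z where "z \<in> nb X y" "z \<noteq> x" by auto
          then show False using no3[of x y z a] X a less.prems by (auto simp: nb_def)
        next
          case False
          then have "y \<in> ?W" using deg2[OF X(6)] other by blast
          then have "adj a y" using a by (auto simp: cn_def)
          then show False using no3[of y x y' a] X a y' adj_sym[of x y] by auto
        qed
      qed
      have WW: "nb X w \<subseteq> X \<inter> ?W" if w: "w \<in> X \<inter> ?W" for w
      proof
        fix y assume y: "y \<in> nb X w"
        obtain a where a: "a \<in> A" using A0 by auto
        show "y \<in> X \<inter> ?W"
        proof (rule ccontr)
          assume "y \<notin> X \<inter> ?W"
          then have "2 \<le> card (nb X y)" using deg2 y by (auto simp: nb_def)
          then obtain z where "z \<in> nb X y" "z \<noteq> w" using other by blast
          then show False
            using no3[of w y z a] a w y less.prems WL by (auto simp: nb_def cn_def)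
        qed
      qed
      have e: "ne X = ne (X \<inter> ?W) + ne (X - X \<inter> ?W)"
        by (rule ne_closed[OF fX _ WW]) auto
      have eW: "ne (X \<inter> ?W) \<le> eps"
      proof (cases "{e \<in> E. e \<subseteq> X \<inter> ?W} = {}")
        case True
        then show ?thesis unfolding ne_def by (metis card.empty le0)
      next
        case False
        then obtain e0 where e0: "e0 \<in> E" "e0 \<subseteq> X \<inter> ?W" by auto
        obtain x y where xy: "e0 = {x, y}" "x \<noteq> y" using card2[OF e0(1)] by (auto simp: card_2_iff)
        have uniq: "e' = e0" if e': "e' \<in> E" "e' \<subseteq> X \<inter> ?W" for e'
        proof (rule ccontr)
          assume ne: "e' \<noteq> e0"
          obtain x' y' where xy': "e' = {x', y'}" "x' \<noteq> y'"
            using card2[OF e'(1)] by (auto simp: card_2_iff)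
          obtain a where a: "a \<in> A" using A0 by auto
          have inW: "x \<in> ?W" "y \<in> ?W" "x' \<in> ?W" "y' \<in> ?W" using xy xy' e0 e' by auto
          then have aa: "adj a x" "adj a y" "adj a x'" "adj a y'" using a by (auto simp: cn_def)
          have inL: "x \<in> ?L" "y \<in> ?L" "x' \<in> ?L" "y' \<in> ?L" using inW WL by auto
          have ad: "adj x y" "adj y x" "adj x' y'" "adj y' x'"
            using e0 e' xy xy' adj_sym[of x y] adj_sym[of x' y'] by auto
          show False
          proof (cases "{x, y} \<inter> {x', y'} = {}")
            case True
            then show False using no22[OF inW ad(1,3)] by blast
          next
            case False
            then consider "x = x'" | "x = y'" | "y = x'" | "y = y'" by auto
            then show False
            proof cases
              case 1
              then have "y \<noteq> y'" using ne xy xy' by auto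
              then show False using no3[of y x y' a] inL ad aa 1 a by auto
            next
              case 2
              then have "y \<noteq> x'" using ne xy xy' by auto
              then show False using no3[of y x x' a] inL ad aa 2 a by auto
            next
              case 3
              then have "x \<noteq> y'" using ne xy xy' by auto
              then show False using no3[of x y y' a] inL ad aa 3 a by auto
            next
              case 4
              then have "x \<noteq> x'" using ne xy xy' by auto
              then show False using no3[of x y x' a] inL ad aa 4 a by auto
            qed
          qed
        qed
        have "{e \<in> E. e \<subseteq> X \<inter> ?W} \<subseteq> {e0}" using uniq by blast
        then have "ne (X \<inter> ?W) \<le> card {e0}" unfolding ne_def by (intro card_mono) simp_all
        moreover have "1 \<le> eps" using eps[of x y] e0 xy by auto
        ultimately show ?thesis by simp
      qed
      \<comment> \<open>The survivors outside the common neighbourhood send no edge to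
        \<open>A\<close>, and \<open>m - 1/2\<close> edges per vertex is within \<open>?s\<close>
        because \<open>2 * m \<le> k * m\<close>.\<close>
      have "\<not> kpaths l 1 (X - X \<inter> ?W)"
        using path_avoiding_hubs[OF fV free A big] packs_mono[of _ 1 "X - X \<inter> ?W" ?L] less.prems
        by blast
      then have "2 * ne (X - X \<inter> ?W) + card (X - X \<inter> ?W) \<le> 2 * m * card (X - X \<inter> ?W)"
        using fX by (intro no_path_ne) auto
      also have "\<dots> \<le> (k * m) * card (X - X \<inter> ?W)" using s1 by (rule mult_le_mono1)
      also have "\<dots> = ?s * card (X - X \<inter> ?W) + card (X - X \<inter> ?W)"
        using s1 m_bounds by (cases "k * m") auto
      finally have eR: "ne (X - X \<inter> ?W) \<le> ?s * card (X - X \<inter> ?W)" by linarith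
      have "(\<Sum>x\<in>X. card (nb A x)) = (\<Sum>x\<in>X. if x \<in> ?W then card (nb A x) else 0)"
        by (rule sum.cong) (use noA in auto)
      also have "\<dots> = (\<Sum>x\<in>X \<inter> ?W. card (nb A x))" using fX by (simp add: sum.inter_restrict)
      also have "\<dots> \<le> (\<Sum>x\<in>X \<inter> ?W. ?s)" by (intro sum_mono dA)
      finally have eA: "(\<Sum>x\<in>X. card (nb A x)) \<le> ?s * card (X \<inter> ?W)" by (simp add: mult.commute)
      have "card X = card (X \<inter> ?W) + card (X - X \<inter> ?W)"
      proof -
        have "X - X \<inter> ?W = X - ?W" by auto
        then show ?thesis using card_Int_Diff[OF fX, of ?W] by simp
      qed
      then have "?s * card X = ?s * card (X \<inter> ?W) + ?s * card (X - X \<inter> ?W)"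
        by (simp only: add_mult_distrib2)
      then show ?thesis using e eW eR eA by linarith
    qed
  qed
  have "ne (A \<union> ?L) = ne A + ne ?L + (\<Sum>x\<in>?L. card (nb A x))"
    using fA fV by (intro ne_Un) auto
  moreover have "A \<union> ?L = V" using A(1) by auto
  moreover have "ne A = 0"
  proof -
    have "{e \<in> E. e \<subseteq> A} = {}"
    proof (rule ccontr)
      assume "{e \<in> E. e \<subseteq> A} \<noteq> {}"
      then obtain e where e: "e \<in> E" "e \<subseteq> A" by auto
      then obtain x y where "e = {x, y}" using card2[OF e(1)] by (auto simp: card_2_iff)
      then show False using indep[of x y] e by auto
    qed
    then show ?thesis unfolding ne_def by (metis card.empty)
  qed
  moreover have "card ?L = card V - ?s" using A fA by (simp add: card_Diff_subset)
  ultimately show ?thesis using peel[of ?L] by simp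
qed

end

section \<open>The forbidden graph\<close>

lemma edge_controlled:
  "edge_control_set E {{u, v}} \<longleftrightarrow> {u, v} \<in> E \<and> (\<forall>e\<in>E. u \<in> e \<or> v \<in> e)"
  by (auto simp: edge_control_set_def)

lemma beta1_one:
  assumes "graph V E" "beta1 E = 1"
  obtains u v where "u \<noteq> v" "edge_control_set E {{u, v}}"
proof -
  have "\<exists>S. edge_control_set E S \<and> card S = card E"
    by (intro exI[of _ E]) (simp add: edge_control_set_def)
  then have "\<exists>S. edge_control_set E S \<and> card S = beta1 E"
    unfolding beta1_def by (rule LeastI)
  then obtain e where e: "edge_control_set E {e}" using assms(2) by (auto simp: card_1_singleton_iff)
  then have "card e = 2" using assms(1) by (auto simp: edge_control_set_def graph_def)
  then obtain u v where "e = {u, v}" "u \<noteq> v" by (auto simp: card_2_iff)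
  then show thesis using that e by auto
qed

locale edge_dominated =
  fixes V :: "'a set" and E :: "'a set set" and u v :: 'a
  assumes graph: "graph V E" and uv: "u \<noteq> v" "edge_control_set E {{u, v}}"
begin

lemma finV: "finite V" and edge_card: "e \<in> E \<Longrightarrow> card e = 2" and edge_sub: "e \<in> E \<Longrightarrow> e \<subseteq> V"
  using graph by (auto simp: graph_def)

lemma uvE: "{u, v} \<in> E" and touch: "e \<in> E \<Longrightarrow> u \<in> e \<or> v \<in> e"
  using edge_controlled[THEN iffD1, OF uv(2)] by auto

lemma uvV: "u \<in> V" "v \<in> V"
  using edge_sub[OF uvE] by auto

lemma no_loop: "{x, x} \<notin> E"
  using edge_card by fastforce

lemma edge_cases:
  assumes "e \<in> E"
  shows "e = {u, v} \<or> (\<exists>x\<in>V - {u, v}. e = {u, x} \<or> e = {v, x})"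
proof -
  obtain a b where ab: "e = {a, b}" "a \<noteq> b" using edge_card[OF assms] by (meson card_2_iff)
  have V: "a \<in> V" "b \<in> V" using edge_sub[OF assms] ab by auto
  have "\<exists>x\<in>V. (e = {u, x} \<and> x \<noteq> u) \<or> (e = {v, x} \<and> x \<noteq> v)"
  proof -
    consider "a = u" | "b = u" | "a = v" | "b = v" using touch[OF assms] ab by auto
    then show ?thesis
    proof cases
      case 1 then show ?thesis using ab V by blast
    next
      case 2 then show ?thesis using ab V by (metis insert_commute)
    next
      case 3 then show ?thesis using ab V by blast
    next
      case 4 then show ?thesis using ab V by (metis insert_commute)
    qed
  qed
  then obtain x where "x \<in> V" "(e = {u, x} \<and> x \<noteq> u) \<or> (e = {v, x} \<and> x \<noteq> v)" by auto
  then show ?thesis by (cases "x \<in> {u, v}") (auto simp: insert_commute)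
qed

lemma contains_if:
  assumes "inj_on \<phi> V" "\<phi> ` V \<subseteq> Y" "{\<phi> u, \<phi> v} \<in> H"
    "\<And>x. x \<in> V - {u, v} \<Longrightarrow> {u, x} \<in> E \<Longrightarrow> {\<phi> u, \<phi> x} \<in> H"
    "\<And>x. x \<in> V - {u, v} \<Longrightarrow> {v, x} \<in> E \<Longrightarrow> {\<phi> v, \<phi> x} \<in> H"
  shows "contains Y H V E"
  unfolding contains_def
proof (intro exI[of _ \<phi>] conjI ballI)
  fix e assume e: "e \<in> E"
  show "\<phi> ` e \<in> H"
  proof (cases "e = {u, v}")
    case True
    then show ?thesis using assms(3) by simp
  next
    case False
    then obtain x where x: "x \<in> V - {u, v}" "e = {u, x} \<or> e = {v, x}" using edge_cases[OF e] by blast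
    from x(2) show ?thesis
    proof
      assume "e = {u, x}"
      then show ?thesis using assms(4)[OF x(1)] e by simp
    next
      assume "e = {v, x}"
      then show ?thesis using assms(5)[OF x(1)] e by simp
    qed
  qed
qed (use assms in auto)

text \<open>Vertices other than \<open>u\<close> and \<open>v\<close> are pairwise nonadjacent, so
  any injection into \<open>W\<close> works. It serves an edge inside \<open>A\<close> with
  \<open>W\<close> its common neighbourhood, and also an edge of that neighbourhood with
  \<open>A\<close> as \<open>W\<close>; there the size condition is case (2) of the
  property.\<close>

lemma contains_join:
  assumes "finite W" "card V \<le> card W + 2" "a \<notin> W" "b \<notin> W" "a \<noteq> b" "insert a (insert b W) \<subseteq> Y"
    "{a, b} \<in> H" "\<And>w. w \<in> W \<Longrightarrow> {a, w} \<in> H" "\<And>w. w \<in> W \<Longrightarrow> {b, w} \<in> H"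
  shows "contains Y H V E"
proof -
  have "card (V - {u, v}) \<le> card W" using assms(2) uv(1) uvV finV by (simp add: card_Diff_subset)
  then obtain f where f: "f ` (V - {u, v}) \<subseteq> W" "inj_on f (V - {u, v})"
    using inj_on_iff_card_le[of "V - {u, v}" W] finV assms(1) by auto
  define \<phi> where "\<phi> x = (if x = u then a else if x = v then b else f x)" for x
  have fW: "f x \<in> W" if "x \<in> V" "x \<noteq> u" "x \<noteq> v" for x using f(1) that by auto
  show ?thesis
  proof (rule contains_if)
    show "inj_on \<phi> V"
    proof (rule inj_onI)
      fix x y assume xy: "x \<in> V" "y \<in> V" "\<phi> x = \<phi> y"
      show "x = y"
        using xy fW[of x] fW[of y] assms(3-5) inj_onD[OF f(2), of x y] uv(1)
        unfolding \<phi>_def by (auto split: if_splits)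
    qed
    show "\<phi> ` V \<subseteq> Y" using fW assms(6) by (auto simp: \<phi>_def)
    show "{\<phi> u, \<phi> v} \<in> H" using assms(7) uv(1) by (simp add: \<phi>_def)
    show "{\<phi> u, \<phi> x} \<in> H" if "x \<in> V - {u, v}" for x
      using that fW[of x] assms(8) by (simp add: \<phi>_def)
    show "{\<phi> v, \<phi> x} \<in> H" if "x \<in> V - {u, v}" for x
      using that fW[of x] assms(9) uv(1) by (simp add: \<phi>_def)
  qed
qed

text \<open>\<open>u\<close> or \<open>v\<close> alone would leave the opposite edge of the triangle
  untouched.\<close>

lemma triangle_iff:
  "T \<subseteq> V \<and> card T = 3 \<and> (\<forall>a\<in>T. \<forall>b\<in>T. a \<noteq> b \<longrightarrow> {a, b} \<in> E) \<longleftrightarrow>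
    (\<exists>x. T = {u, v, x} \<and> {u, x} \<in> E \<and> {v, x} \<in> E)" (is "?L \<longleftrightarrow> ?R")
proof
  assume L: ?L
  then have T: "T \<subseteq> V" "card T = 3" "\<And>a b. a \<in> T \<Longrightarrow> b \<in> T \<Longrightarrow> a \<noteq> b \<Longrightarrow> {a, b} \<in> E" by auto
  obtain a b c where abc: "T = {a, b, c}" "a \<noteq> b" "b \<noteq> c" "a \<noteq> c" using T(2) by (auto simp: card_3_iff)
  have e: "{a, b} \<in> E" "{b, c} \<in> E" "{a, c} \<in> E" using T(3) abc by auto
  have t: "u \<in> {a, b} \<or> v \<in> {a, b}" "u \<in> {b, c} \<or> v \<in> {b, c}" "u \<in> {a, c} \<or> v \<in> {a, c}"
    using touch e by blast+
  have "u \<in> T \<and> v \<in> T" using t abc uv(1) by auto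
  then have "\<exists>x. T = {u, v, x} \<and> x \<noteq> u \<and> x \<noteq> v" using abc uv(1) by auto
  then show ?R using T(3) by auto
next
  assume ?R
  then obtain x where x: "T = {u, v, x}" "{u, x} \<in> E" "{v, x} \<in> E" by auto
  have "x \<noteq> u" "x \<noteq> v" using x no_loop by auto
  then show ?L using x uvE uv(1) uvV edge_sub[OF x(2)] by (auto simp: insert_commute)
qed

lemma num_triangles_eq: "num_triangles V E = card {x. {u, x} \<in> E \<and> {v, x} \<in> E}"
proof -
  have "{T. T \<subseteq> V \<and> card T = 3 \<and> (\<forall>a\<in>T. \<forall>b\<in>T. a \<noteq> b \<longrightarrow> {a, b} \<in> E)}
      = (\<lambda>x. {u, v, x}) ` {x. {u, x} \<in> E \<and> {v, x} \<in> E}"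
    unfolding triangle_iff by (auto simp: image_iff)
  moreover have "inj_on (\<lambda>x. {u, v, x}) {x. {u, x} \<in> E \<and> {v, x} \<in> E}"
  proof (rule inj_onI)
    fix x y
    assume h: "x \<in> {x. {u, x} \<in> E \<and> {v, x} \<in> E}" "{u, v, x} = {u, v, y}"
    then have "x \<noteq> u" "x \<noteq> v" using no_loop by auto
    then show "x = y" using h(2) by blast
  qed
  ultimately show ?thesis unfolding num_triangles_def by (simp add: card_image)
qed

lemma degree_eq: "degree E w = card {x. {w, x} \<in> E}"
proof -
  have "{e \<in> E. w \<in> e} = (\<lambda>x. {w, x}) ` {x. {w, x} \<in> E}"
  proof
    show "{e \<in> E. w \<in> e} \<subseteq> (\<lambda>x. {w, x}) ` {x. {w, x} \<in> E}"
    proof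
      fix e assume e: "e \<in> {e \<in> E. w \<in> e}"
      then have "card e = 2" using edge_card by blast
      then obtain a b where "e = {a, b}" by (meson card_2_iff)
      then show "e \<in> (\<lambda>x. {w, x}) ` {x. {w, x} \<in> E}" using e by (auto simp: insert_commute)
    qed
  qed auto
  moreover have "inj_on (\<lambda>x. {w, x}) {x. {w, x} \<in> E}" by (auto simp: inj_on_def doubleton_eq_iff)
  ultimately show ?thesis unfolding degree_def by (simp add: card_image)
qed

text \<open>The triangle \<open>u, v, x\<close> goes to \<open>a, w, w'\<close>, so the given edge
  carries \<open>vx\<close>. The \<open>degree E v - 2\<close> other neighbours of \<open>v\<close>
  go to \<open>A\<close>, where \<open>card A - 1\<close> places are left, and the rest goes to
  \<open>W\<close>. As the triangle is unique, no other neighbour of \<open>u\<close> is forced into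
  \<open>A\<close>.\<close>

lemma contains_one_triangle:
  assumes "num_triangles V E = 1" "degree E v \<le> card A + 1" "finite A" "finite W"
    "card V \<le> card W" "A \<inter> W = {}" "A \<union> W \<subseteq> Y" "a \<in> A" "w \<in> W" "w' \<in> W" "w \<noteq> w'" "{w, w'} \<in> H"
    "\<And>b z. b \<in> A \<Longrightarrow> z \<in> W \<Longrightarrow> {b, z} \<in> H"
  shows "contains Y H V E"
proof -
  obtain x where x: "{x. {u, x} \<in> E \<and> {v, x} \<in> E} = {x}"
    using assms(1) num_triangles_eq by (auto simp: card_1_singleton_iff)
  have xE: "{u, x} \<in> E" "{v, x} \<in> E" and xu: "\<And>y. {u, y} \<in> E \<Longrightarrow> {v, y} \<in> E \<Longrightarrow> y = x"
    using x by auto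
  have xne: "x \<noteq> u" "x \<noteq> v" using xE no_loop by auto
  have xV: "x \<in> V" using edge_sub[OF xE(1)] by auto
  define Q where "Q = {y. {v, y} \<in> E} - {u, x}"
  define P where "P = V - {u, v, x} - Q"
  have QV: "{y. {v, y} \<in> E} \<subseteq> V" using edge_sub by auto
  have fin: "finite Q" "finite P" "finite {y. {v, y} \<in> E}"
    using finV finite_subset[OF QV] by (auto simp: Q_def P_def)
  have "{u, x} \<subseteq> {y. {v, y} \<in> E}" using xE uvE by (auto simp: insert_commute)
  then have "card Q + 2 = degree E v"
    unfolding Q_def degree_eq using fin xne card_mono[OF fin(3), of "{u, x}"]
    by (simp add: card_Diff_subset)
  then have "card Q \<le> card (A - {a})" using assms(2,3,8) by simp
  then obtain f where f: "f ` Q \<subseteq> A - {a}" "inj_on f Q"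
    using inj_on_iff_card_le[of Q "A - {a}"] fin assms(3) by auto
  have "card P + 3 \<le> card V"
  proof -
    have "card (P \<union> {u, v, x}) \<le> card V" using xV uvV finV by (intro card_mono) (auto simp: P_def)
    moreover have "card (P \<union> {u, v, x}) = card P + card {u, v, x}"
      using fin by (intro card_Un_disjoint) (auto simp: P_def)
    ultimately show ?thesis using uv(1) xne by simp
  qed
  then have "card P \<le> card (W - {w, w'})" using assms by (simp add: card_Diff_subset)
  then obtain g where g: "g ` P \<subseteq> W - {w, w'}" "inj_on g P"
    using inj_on_iff_card_le[of P "W - {w, w'}"] fin assms(4) by auto
  have uvQ: "u \<notin> Q" "v \<notin> Q" "x \<notin> Q" using no_loop[of v] by (auto simp: Q_def)
  define \<phi> where "\<phi> y = (if y = u then a else if y = v then w else if y = x then w'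
      else if y \<in> Q then f y else g y)" for y
  have fQ: "f y \<in> A" "f y \<noteq> a" if "y \<in> Q" for y using f(1) that by auto
  have gP: "g y \<in> W" "g y \<noteq> w" "g y \<noteq> w'" if "y \<in> V" "y \<noteq> u" "y \<noteq> v" "y \<noteq> x" "y \<notin> Q" for y
    using g(1) that by (auto simp: P_def)
  have dis: "\<And>b. b \<in> A \<Longrightarrow> b \<notin> W" using assms(6) by auto
  show ?thesis
  proof (rule contains_if)
    have val: "\<phi> u = a" "\<phi> v = w" "\<phi> x = w'" "\<And>y. y \<in> Q \<Longrightarrow> \<phi> y = f y"
      "\<And>y. y \<in> P \<Longrightarrow> \<phi> y = g y"
      using uv(1) xne uvQ by (auto simp: \<phi>_def P_def)
    have img: "\<phi> ` Q \<subseteq> A - {a}" "\<phi> ` P \<subseteq> W - {w, w'}" using f g val by auto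
    have "inj_on \<phi> Q" "inj_on \<phi> P"
      using f(2) g(2) val(4,5) by (simp_all add: inj_on_def)
    moreover have "\<phi> ` (Q - P) \<inter> \<phi> ` (P - Q) = {}" using img assms(6) by blast
    ultimately have "inj_on \<phi> (Q \<union> P)" unfolding inj_on_Un by blast
    moreover have "a \<notin> \<phi> ` (Q \<union> P)" "w \<notin> \<phi> ` (Q \<union> P)" "w' \<notin> \<phi> ` (Q \<union> P)" "a \<noteq> w" "a \<noteq> w'"
      using img assms(6,8,9,10) by blast+
    ultimately have "inj_on \<phi> (insert u (insert v (insert x (Q \<union> P))))"
      unfolding inj_on_insert image_insert insert_Diff_if
      using val(1-3) assms(11) by (auto intro: inj_on_subset)
    moreover have "V \<subseteq> insert u (insert v (insert x (Q \<union> P)))" by (auto simp: P_def)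
    ultimately show "inj_on \<phi> V" by (rule inj_on_subset)
    show "\<phi> ` V \<subseteq> Y"
      using assms(7-10) fQ gP by (auto simp: \<phi>_def)
    show "{\<phi> u, \<phi> v} \<in> H" using assms(8,9,13) uv(1) by (simp add: \<phi>_def)
    show "{\<phi> u, \<phi> y} \<in> H" if y: "y \<in> V - {u, v}" "{u, y} \<in> E" for y
    proof (cases "y = x")
      case True
      then show ?thesis using y assms(8,10,13) uv(1) xne by (simp add: \<phi>_def)
    next
      case False
      then have "y \<notin> Q" using xu y(2) by (auto simp: Q_def)
      then show ?thesis using y False gP[of y] assms(8,13) by (simp add: \<phi>_def)
    qed
    show "{\<phi> v, \<phi> y} \<in> H" if y: "y \<in> V - {u, v}" "{v, y} \<in> E" for y
    proof (cases "y = x")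
      case True
      then show ?thesis using y assms(12) uv(1) xne by (simp add: \<phi>_def)
    next
      case False
      then have "y \<in> Q" using y by (auto simp: Q_def)
      then show ?thesis
        using y False fQ[of y] assms(9) assms(13)[of "f y" w] uv(1)
        by (simp add: \<phi>_def insert_commute)
    qed
  qed
qed

text \<open>Otherwise the neighbours of \<open>v\<close> form one colour class and the rest the
  other: an edge between two neighbours of \<open>v\<close> would contain \<open>u\<close> and close
  a triangle.\<close>

lemma exists_triangle:
  assumes "\<not> colorable V E 2"
  shows "\<exists>x. {u, x} \<in> E \<and> {v, x} \<in> E"
proof (rule ccontr)
  assume neg: "\<not> ?thesis"
  define c where "c x = (if x = u \<or> (x \<noteq> v \<and> {v, x} \<in> E) then 0 else 1 :: nat)" for x
  have edge: "c a \<noteq> c b" if "{a, b} \<in> E" "a = u \<or> a = v" for a b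
  proof -
    have "a \<noteq> b" using that no_loop by auto
    moreover have "\<not> ({u, b} \<in> E \<and> {v, b} \<in> E)" using neg by auto
    ultimately show ?thesis using that uv(1) unfolding c_def by (auto simp: insert_commute)
  qed
  have "colorable V E 2"
    unfolding colorable_def
  proof (intro exI[of _ c] conjI ballI impI)
    show "c x < 2" for x by (simp add: c_def)
    fix e a b assume e: "e \<in> E" "a \<in> e" "b \<in> e" "a \<noteq> b"
    obtain p q where "e = {p, q}" using edge_card[OF e(1)] by (auto simp: card_2_iff)
    then have eab: "e = {a, b}" using e by auto
    have "u \<in> {a, b} \<or> v \<in> {a, b}" using touch[OF e(1)] eab by simp
    then consider "a = u \<or> a = v" | "b = u \<or> b = v" by auto
    then show "c a \<noteq> c b"
    proof cases
      case 1
      then show ?thesis using edge e eab by blast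
    next
      case 2
      have "{b, a} \<in> E" using e eab by (simp add: insert_commute)
      then show ?thesis using edge 2 by metis
    qed
  qed
  then show False using assms by simp
qed

end

lemma chromatic_number_not_colorable:
  "m < chromatic_number V E \<Longrightarrow> \<not> colorable V E m"
  unfolding chromatic_number_def by (rule not_less_Least)

lemma f_val_le:
  assumes "graph V E" "u \<noteq> v" "edge_control_set E {{u, v}}"
  shows "f_val E \<le> min (degree E u) (degree E v)"
    and "\<exists>u v. u \<noteq> v \<and> edge_control_set E {{u, v}} \<and> f_val E = min (degree E u) (degree E v)"
proof -
  let ?S = "{min (degree E u) (degree E v) | u v. u \<noteq> v \<and> edge_control_set E {{u, v}}}"
  have "?S \<subseteq> (\<lambda>(u, v). min (degree E u) (degree E v)) ` (V \<times> V)"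
  proof
    fix d assume "d \<in> ?S"
    then obtain u v where uv: "d = min (degree E u) (degree E v)" "edge_control_set E {{u, v}}" by blast
    have "{u, v} \<in> E" using uv(2) unfolding edge_control_set_def by simp
    then have "(u, v) \<in> V \<times> V" using assms(1) unfolding graph_def by blast
    then show "d \<in> (\<lambda>(u, v). min (degree E u) (degree E v)) ` (V \<times> V)"
      unfolding uv(1) by (rule rev_image_eqI) simp
  qed
  moreover have "finite V" using assms(1) by (simp add: graph_def)
  ultimately have fin: "finite ?S" by (meson finite_SigmaI finite_imageI finite_subset)
  have ne: "min (degree E u) (degree E v) \<in> ?S" using assms(2,3) by blast
  show "f_val E \<le> min (degree E u) (degree E v)"
    unfolding f_val_def by (rule Min_le[OF fin ne])
  have "f_val E \<in> ?S" unfolding f_val_def by (rule Min_in[OF fin]) (use ne in blast)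
  then show "\<exists>u v. u \<noteq> v \<and> edge_control_set E {{u, v}} \<and> f_val E = min (degree E u) (degree E v)"
    by blast
qed

lemma (in sgraph) kpaths_contains:
  "kpaths l j Y \<Longrightarrow> contains Y E (kP_verts j l) (kP_edges j l)"
proof (induction j arbitrary: Y)
  case 0
  then show ?case by (auto simp: contains_def kP_verts_def kP_edges_def)
next
  case (Suc j)
  then obtain p where p: "path p" "length p = l" "set p \<subseteq> Y" "kpaths l j (Y - set p)" by auto
  obtain \<phi> where \<phi>: "inj_on \<phi> (kP_verts j l)" "\<phi> ` kP_verts j l \<subseteq> Y - set p"
    "\<And>e. e \<in> kP_edges j l \<Longrightarrow> \<phi> ` e \<in> E"
    using Suc.IH[OF p(4)] unfolding contains_def by auto
  define \<psi> where "\<psi> x = (if fst x = j then p ! snd x else \<phi> x)" for x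
  have dp: "distinct p" "successively adj p" using p(1) by (auto simp: path_def)
  have old: "\<psi> x = \<phi> x" "\<psi> x \<in> Y - set p" if "x \<in> kP_verts j l" for x
    using that \<phi>(2) by (auto simp: \<psi>_def kP_verts_def)
  have V: "kP_verts (Suc j) l = kP_verts j l \<union> {j} \<times> {0..<l}" by (auto simp: kP_verts_def)
  show ?case
    unfolding contains_def
  proof (intro exI[of _ \<psi>] conjI ballI)
    have "inj_on \<psi> (kP_verts j l)" using \<phi>(1) old(1) by (metis inj_on_cong)
    moreover have "inj_on \<psi> ({j} \<times> {0..<l})"
      using dp(1) p(2) by (auto simp: inj_on_def \<psi>_def nth_eq_iff_index_eq)
    moreover have "\<psi> ` ({j} \<times> {0..<l}) \<subseteq> set p" using p(2) by (auto simp: \<psi>_def)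
    ultimately show "inj_on \<psi> (kP_verts (Suc j) l)"
      unfolding V inj_on_Un using old(2) by blast
    show "\<psi> ` kP_verts (Suc j) l \<subseteq> Y"
      unfolding V using old(2) \<open>\<psi> ` ({j} \<times> {0..<l}) \<subseteq> set p\<close> p(3) by blast
    fix e assume "e \<in> kP_edges (Suc j) l"
    then obtain j' i where e: "e = {(j', i), (j', Suc i)}" "j' < Suc j" "Suc i < l"
      by (auto simp: kP_edges_def)
    show "\<psi> ` e \<in> E"
    proof (cases "j' = j")
      case True
      then have "\<psi> ` e = {p ! i, p ! Suc i}" using e by (auto simp: \<psi>_def)
      then show ?thesis using dp(2) e(3) p(2) by (simp add: successively_conv_nth)
    next
      case False
      then have "e \<in> kP_edges j l" using e unfolding kP_edges_def by fastforce
      moreover have "\<psi> ` e = \<phi> ` e" using e False by (auto simp: \<psi>_def)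
      ultimately show ?thesis using \<phi>(3) by simp
    qed
  qed
qed

section \<open>The extremal graphs\<close>

text \<open>A path on \<open>l\<close> vertices has \<open>l div 2\<close> disjoint edges, and for
  odd \<open>l\<close> a spare vertex lets them be chosen around one exceptional edge. This makes
  the extra edge of the extremal graph harmless for odd \<open>l\<close>.\<close>

lemma path_cover_size:
  assumes "inj_on f {..<l}"
    and "\<And>i. Suc i < l \<Longrightarrow> f i \<in> A \<or> f (Suc i) \<in> A \<or> odd l \<and> {f i, f (Suc i)} = xe"
  shows "l div 2 \<le> card {i. i < l \<and> f i \<in> A}"
proof -
  \<comment> \<open>a maximum matching of the path avoiding the exceptional edge\<close>
  have "\<exists>t. \<forall>i < l div 2. Suc (t i) < l \<and> (f (t i) \<in> A \<or> f (Suc (t i)) \<in> A) \<and>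
      (\<forall>i'>i. Suc (t i) < t i')"
  proof (cases "\<exists>c. Suc (2 * c) < l \<and> f (2 * c) \<notin> A \<and> f (Suc (2 * c)) \<notin> A")
    case True
    then obtain c where c: "Suc (2 * c) < l" "f (2 * c) \<notin> A" "f (Suc (2 * c)) \<notin> A" by auto
    then have o: "odd l" and xe: "{f (2 * c), f (Suc (2 * c))} = xe" using assms(2)[of "2 * c"] by auto
    \<comment> \<open>From \<open>c\<close> on the pairs shift by one position, so the exceptional
      pair at \<open>2 * c\<close> is never selected; the spare vertex of an odd path gives room for
      the shift.\<close>
    define t where "t i = (if i < c then 2 * i else Suc (2 * i))" for i
    have "Suc (t i) < l \<and> (f (t i) \<in> A \<or> f (Suc (t i)) \<in> A) \<and> (\<forall>i'>i. Suc (t i) < t i')"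
      if i: "i < l div 2" for i
    proof (intro conjI allI impI)
      show b: "Suc (t i) < l"
      proof -
        have "Suc (2 * (l div 2)) = l" using o by (metis Suc_eq_plus1 odd_two_times_div_two_succ)
        then show ?thesis using i by (simp add: t_def)
      qed
      show "f (t i) \<in> A \<or> f (Suc (t i)) \<in> A"
      proof (rule ccontr)
        assume "\<not> ?thesis"
        then have "{f (t i), f (Suc (t i))} = {f (2 * c), f (Suc (2 * c))}"
          using assms(2)[OF b] xe by auto
        then have "f (t i) = f (2 * c) \<or> f (t i) = f (Suc (2 * c)) \<and> f (Suc (t i)) = f (2 * c)"
          by (auto simp: doubleton_eq_iff)
        then have "t i = 2 * c \<or> t i = Suc (2 * c) \<and> Suc (t i) = 2 * c"
          using inj_onD[OF assms(1)] b c(1) by (metis Suc_lessD lessThan_iff)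
        then have "t i = 2 * c" by linarith
        then show False unfolding t_def by (cases "i < c"; simp; presburger)
      qed
      show "Suc (t i) < t i'" if "i < i'" for i' using that by (simp add: t_def)
    qed
    then show ?thesis by blast
  next
    case False
    then have "Suc (2 * i) < l \<and> (f (2 * i) \<in> A \<or> f (Suc (2 * i)) \<in> A) \<and> (\<forall>i'>i. Suc (2 * i) < 2 * i')"
      if "i < l div 2" for i using that by auto
    then show ?thesis by (intro exI[of _ "\<lambda>i. 2 * i"]) blast
  qed
  then obtain t where t: "\<And>i. i < l div 2 \<Longrightarrow> Suc (t i) < l"
    "\<And>i. i < l div 2 \<Longrightarrow> f (t i) \<in> A \<or> f (Suc (t i)) \<in> A"
    "\<And>i i'. i < l div 2 \<Longrightarrow> i < i' \<Longrightarrow> Suc (t i) < t i'" by blast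
  define x where "x i = (if f (t i) \<in> A then t i else Suc (t i))" for i
  have lt: "x i < x i'" if "i < l div 2" "i < i'" for i i'
    using t(3)[OF that] by (auto simp: x_def)
  have "inj_on x {..<l div 2}"
    by (rule inj_onI) (metis lessThan_iff lt nat_neq_iff)
  moreover have "x ` {..<l div 2} \<subseteq> {i. i < l \<and> f i \<in> A}"
    using t(1,2) by (auto simp: x_def dest: Suc_lessD)
  ultimately have "card {..<l div 2} \<le> card {i. i < l \<and> f i \<in> A}"
    by (intro card_inj_on_le) auto
  then show ?thesis by simp
qed

lemma not_contains_kP:
  assumes "finite A" "card A < k * (l div 2)"
    and "\<And>x y. {x, y} \<in> H \<Longrightarrow> x \<in> A \<or> y \<in> A \<or> odd l \<and> {x, y} = e0"
  shows "\<not> contains Y H (kP_verts k l) (kP_edges k l)"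
proof
  assume "contains Y H (kP_verts k l) (kP_edges k l)"
  then obtain \<phi> where \<phi>: "inj_on \<phi> (kP_verts k l)" "\<And>e. e \<in> kP_edges k l \<Longrightarrow> \<phi> ` e \<in> H"
    unfolding contains_def by blast
  define S where "S j = {i. i < l \<and> \<phi> (j, i) \<in> A}" for j
  have S: "l div 2 \<le> card (S j)" if "j < k" for j
    unfolding S_def
  proof (rule path_cover_size[where xe = e0])
    show "inj_on (\<lambda>i. \<phi> (j, i)) {..<l}"
    proof (rule inj_onI)
      fix a b assume ab: "a \<in> {..<l}" "b \<in> {..<l}" "\<phi> (j, a) = \<phi> (j, b)"
      then have "(j, a) \<in> kP_verts k l" "(j, b) \<in> kP_verts k l" using that by (auto simp: kP_verts_def)
      then show "a = b" using inj_onD[OF \<phi>(1) ab(3)] by simp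
    qed
    fix i assume i: "Suc i < l"
    then have "{(j, i), (j, Suc i)} \<in> kP_edges k l" using that by (auto simp: kP_edges_def)
    from \<phi>(2)[OF this] have "{\<phi> (j, i), \<phi> (j, Suc i)} \<in> H" by simp
    then show "\<phi> (j, i) \<in> A \<or> \<phi> (j, Suc i) \<in> A \<or> odd l \<and> {\<phi> (j, i), \<phi> (j, Suc i)} = e0"
      by (rule assms(3))
  qed
  have sub: "Sigma {..<k} S \<subseteq> kP_verts k l" by (auto simp: S_def kP_verts_def)
  have "k * (l div 2) = (\<Sum>j<k. l div 2)" by simp
  also have "\<dots> \<le> (\<Sum>j<k. card (S j))" by (intro sum_mono S) simp
  also have "\<dots> = card (Sigma {..<k} S)" by (subst card_SigmaI) (auto simp: S_def)
  also have "\<dots> \<le> card A"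
    by (rule card_inj_on_le[OF inj_on_subset[OF \<phi>(1) sub] _ assms(1)]) (auto simp: S_def)
  finally show False using assms(2) by simp
qed

lemma not_contains_if_bipartite:
  assumes "\<not> colorable V E 2"
    and edge: "\<And>e. e \<in> E \<Longrightarrow> card e = 2"
    and "\<And>x y. {x, y} \<in> H \<Longrightarrow> x \<in> A \<longleftrightarrow> y \<notin> A"
  shows "\<not> contains Y H V E"
proof
  assume "contains Y H V E"
  then obtain \<phi> where \<phi>: "\<And>e. e \<in> E \<Longrightarrow> \<phi> ` e \<in> H" unfolding contains_def by blast
  have "colorable V E 2"
    unfolding colorable_def
  proof (intro exI[of _ "\<lambda>x. if \<phi> x \<in> A then 0 else 1 :: nat"] conjI ballI impI)
    fix e a b assume e: "e \<in> E" "a \<in> e" "b \<in> e" "a \<noteq> b"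
    obtain p q where "e = {p, q}" using edge[OF e(1)] by (auto simp: card_2_iff)
    then have "e = {a, b}" using e by auto
    then have "{\<phi> a, \<phi> b} \<in> H" using \<phi>[OF e(1)] by simp
    then show "(if \<phi> a \<in> A then 0 else 1 :: nat) \<noteq> (if \<phi> b \<in> A then 0 else 1)"
      using assms(3) by simp
  qed auto
  then show False using assms(1) by simp
qed

section \<open>Copies of the forbidden graph in a bipartite graph plus an edge\<close>

context edge_dominated
begin

lemma swap_ends: "edge_dominated V E v u"
  using graph uv by (unfold_locales) (simp_all add: insert_commute)

text \<open>The extra edge carries \<open>ux\<close>. Another triangle \<open>u, v, y\<close> would
  need it as well, forcing \<open>y = x\<close>; and all neighbours of \<open>u\<close> except
  \<open>x\<close> must land in \<open>A\<close>, opposite to \<open>u\<close>.\<close>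

lemma degree_bound_if_contains:
  assumes "inj_on \<phi> V" "\<And>e. e \<in> E \<Longrightarrow> \<phi> ` e \<in> H" "finite A"
    and H: "\<And>x y. {x, y} \<in> H \<Longrightarrow> (x \<in> A \<longleftrightarrow> y \<notin> A) \<or> {x, y} = {w, w'}"
    and w: "w \<notin> A" "w' \<notin> A"
    and x: "{u, x} \<in> E" "{v, x} \<in> E" "{\<phi> u, \<phi> x} = {w, w'}"
  shows "num_triangles V E = 1 \<and> degree E u \<le> card A + 1"
proof
  have HE: "{\<phi> a, \<phi> b} \<in> H" if "{a, b} \<in> E" for a b using assms(2)[OF that] by simp
  have inj: "a = b" if "a \<in> V" "b \<in> V" "\<phi> a = \<phi> b" for a b using inj_onD[OF assms(1)] that by blast
  have xV: "x \<in> V" using edge_sub[OF x(1)] by auto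
  have xne: "x \<noteq> u" "x \<noteq> v" using x no_loop by auto
  have "y = x" if y: "{u, y} \<in> E" "{v, y} \<in> E" for y
  proof -
    have yV: "y \<in> V" using edge_sub[OF y(1)] by auto
    have yne: "y \<noteq> u" "y \<noteq> v" using y no_loop by auto
    have "{\<phi> u, \<phi> v} = {\<phi> u, \<phi> x} \<or> {\<phi> u, \<phi> y} = {\<phi> u, \<phi> x} \<or> {\<phi> v, \<phi> y} = {\<phi> u, \<phi> x}"
      unfolding x(3) using H[OF HE[OF uvE]] H[OF HE[OF y(1)]] H[OF HE[OF y(2)]] by argo
    then have "\<phi> v = \<phi> x \<or> \<phi> v = \<phi> u \<or> \<phi> y = \<phi> x"
      unfolding doubleton_eq_iff by argo
    then show ?thesis using inj[OF uvV(2) xV] inj[OF uvV(2,1)] inj[OF yV xV] xne uv(1) by argo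
  qed
  then have "{y. {u, y} \<in> E \<and> {v, y} \<in> E} = {x}" using x(1,2) by blast
  then show "num_triangles V E = 1" by (simp add: num_triangles_eq)
  have wu: "\<phi> u \<notin> A"
  proof -
    have "\<phi> u = w \<or> \<phi> u = w'" using x(3) unfolding doubleton_eq_iff by argo
    then show ?thesis using w by metis
  qed
  let ?N = "{y. {u, y} \<in> E}"
  have NV: "?N \<subseteq> V" using edge_sub by auto
  have "\<phi> ` ?N \<subseteq> insert (\<phi> x) A"
  proof
    fix z assume "z \<in> \<phi> ` ?N"
    then obtain y where y: "z = \<phi> y" "{u, y} \<in> E" by auto
    show "z \<in> insert (\<phi> x) A"
    proof (cases "z \<in> A")
      case False
      then have "{\<phi> u, \<phi> y} = {\<phi> u, \<phi> x}"
        unfolding x(3) using H[OF HE[OF y(2)]] wu y(1) by argo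
      then have "\<phi> y = \<phi> x" unfolding doubleton_eq_iff by argo
      then show ?thesis using y(1) by simp
    qed simp
  qed
  then have "card ?N \<le> card (insert (\<phi> x) A)"
    using card_inj_on_le[OF inj_on_subset[OF assms(1) NV]] assms(3) by blast
  also have "\<dots> \<le> card A + 1" using assms(3) by (simp add: card_insert_if)
  finally show "degree E u \<le> card A + 1" by (simp add: degree_eq)
qed

text \<open>Some edge of a triangle \<open>u, v, x\<close> lands on \<open>ww'\<close>. If it is
  \<open>uv\<close>, all other vertices, none being isolated, fall into \<open>A\<close>; otherwise
  the degree bound applies at \<open>u\<close> or \<open>v\<close>.\<close>

lemma contains_bipartite_plus_edge:
  assumes "contains Y H V E" "\<not> colorable V E 2" "finite A"
    and H: "\<And>x y. {x, y} \<in> H \<Longrightarrow> (x \<in> A \<longleftrightarrow> y \<notin> A) \<or> {x, y} = {w, w'}"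
    and w: "w \<notin> A" "w' \<notin> A" and isol: "\<forall>x\<in>V. \<exists>e\<in>E. x \<in> e"
  shows "card V \<le> card A + 2 \<or> num_triangles V E = 1 \<and> f_val E \<le> card A + 1"
proof -
  obtain \<phi> where \<phi>: "inj_on \<phi> V" "\<And>e. e \<in> E \<Longrightarrow> \<phi> ` e \<in> H"
    using assms(1) unfolding contains_def by blast
  have HE: "{\<phi> a, \<phi> b} \<in> H" if "{a, b} \<in> E" for a b using \<phi>(2)[OF that] by simp
  obtain x where x: "{u, x} \<in> E" "{v, x} \<in> E" using exists_triangle[OF assms(2)] by auto
  consider "{\<phi> u, \<phi> v} = {w, w'}" | "{\<phi> u, \<phi> x} = {w, w'}" | "{\<phi> v, \<phi> x} = {w, w'}"
    using H[OF HE[OF uvE]] H[OF HE[OF x(1)]] H[OF HE[OF x(2)]] by argo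
  then show ?thesis
  proof cases
    case 1
    have "\<phi> ` (V - {u, v}) \<subseteq> A"
    proof
      fix z assume "z \<in> \<phi> ` (V - {u, v})"
      then obtain y where y: "z = \<phi> y" "y \<in> V" "y \<noteq> u" "y \<noteq> v" by auto
      have ny: "\<phi> y \<notin> {w, w'}"
      proof -
        have "\<phi> y \<noteq> \<phi> u" "\<phi> y \<noteq> \<phi> v" using inj_onD[OF \<phi>(1)] y uvV by blast+
        then show ?thesis unfolding 1[symmetric] by simp
      qed
      obtain e where e: "e \<in> E" "y \<in> e" using isol y(2) by auto
      then have "e = {u, y} \<or> e = {v, y}" using edge_cases[OF e(1)] y by auto
      then have yH: "{\<phi> u, \<phi> y} \<in> H \<or> {\<phi> v, \<phi> y} \<in> H" using HE e(1) by metis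
      have uA: "\<phi> u \<notin> A" "\<phi> v \<notin> A"
      proof -
        have "\<phi> u = w \<or> \<phi> u = w'" "\<phi> v = w \<or> \<phi> v = w'"
          using 1 unfolding doubleton_eq_iff by argo+
        then show "\<phi> u \<notin> A" "\<phi> v \<notin> A" using w by metis+
      qed
      have "\<phi> y \<in> A" if "p \<notin> A" "{p, \<phi> y} \<in> H" for p
        using H[OF that(2)]
      proof
        show "\<phi> y \<in> A" if "p \<in> A \<longleftrightarrow> \<phi> y \<notin> A" using that \<open>p \<notin> A\<close> by simp
        show "\<phi> y \<in> A" if "{p, \<phi> y} = {w, w'}" using that ny by blast
      qed
      then show "z \<in> A" unfolding y(1) using yH uA by metis
    qed
    then have "card (V - {u, v}) \<le> card A"
      by (rule card_inj_on_le[OF inj_on_subset[OF \<phi>(1) Diff_subset] _ assms(3)])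
    moreover have "card (V - {u, v}) + 2 = card V"
      using uv(1) uvV finV card_mono[OF finV, of "{u, v}"] by (simp add: card_Diff_subset)
    ultimately show ?thesis by linarith
  next
    case 2
    have "num_triangles V E = 1 \<and> degree E u \<le> card A + 1"
      by (rule degree_bound_if_contains[OF \<phi> assms(3) H w x 2])
    then show ?thesis using f_val_le(1)[OF graph uv] by linarith
  next
    case 3
    interpret sw: edge_dominated V E v u by (rule swap_ends)
    have "num_triangles V E = 1 \<and> degree E v \<le> card A + 1"
      by (rule sw.degree_bound_if_contains[OF \<phi> assms(3) H w x(2,1) 3])
    then show ?thesis using f_val_le(1)[OF graph uv] by linarith
  qed
qed

end

section \<open>The threshold for n and the two bounds\<close>

context sgraph_kl
begin

text \<open>The second claim is the requirement of \<open>exists_hub_set\<close> with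
  \<open>Y0 = Nl + r\<close>: \<open>Nl\<close> common neighbours for the path constructions and
  \<open>r\<close> for the forbidden graph.\<close>

lemma threshold:
  assumes n: "4 * k\<^sup>2 * l\<^sup>2 * (k * l + r) * (m + 1) * (l choose m) \<le> n"
  shows "2 * ((k * m) * (k * m)) + (k + 1) * Nk + l * l < n"
    and "(k - 1) * m + (((k - 1) * m) * ((k - 1) * m) + 2 * ((k - 1) * m) + 10 * k * m * m) + m +
      2 * ((((k - 1) * m) * ((k - 1) * m) + 2 * ((k - 1) * m) + 10 * k * m * m) * (Nl + m) +
        m * (m + (((k - 1) * m) * ((k - 1) * m) + 2 * ((k - 1) * m) + 10 * k * m * m)) +
        ((k - 1) * m) * ((k - 1) * m) + (k - 1) * m + k * m * m) +
      4 * k * (m + 1) * (Nl + m) + (Nl + r) < n"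
proof -
  define z where "z = k * l"
  define C where "C = (l choose m)"
  define u where "u = (k - 1) * m"
  define q where "q = u * u + 2 * u + 10 * k * m * m"
  have z8: "8 \<le> z" unfolding z_def using mult_le_mono[OF k2 l4] by simp
  have C2: "2 \<le> C"
  proof -
    obtain l' m' where lm: "l = Suc l'" "m = Suc m'" using l4 m_bounds by (cases l; cases m) auto
    have "(l' choose m') \<noteq> 0" "(l' choose Suc m') \<noteq> 0"
      using lm m_bounds l4 by (simp_all add: binomial_eq_0_iff)
    moreover have "C = (l' choose m') + (l' choose Suc m')" unfolding C_def lm by simp
    ultimately show ?thesis by (metis One_nat_def add_mono less_one linorder_not_le one_add_one)
  qed
  have km: "2 * (k * m) \<le> z" unfolding z_def using mult_le_mono2[OF m_bounds(2), of k] by simp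
  have m4: "4 * m \<le> z"
    unfolding z_def using mult_le_mono[OF k2 m_bounds(2)] by simp
  have k4: "4 * k \<le> z" unfolding z_def using mult_le_mono2[OF l4, of k] by simp
  have l2: "2 * l \<le> z" unfolding z_def using mult_le_mono1[OF k2] .
  have "u \<le> k * m" unfolding u_def by (intro mult_le_mono1) simp
  then have u: "2 * u \<le> z" using km by linarith
  have zz: "8 * z \<le> z * z" using z8 by (rule mult_le_mono1)
  have zzz: "8 * (z * z) \<le> z * z * z" using mult_le_mono2[OF z8, of "z * z"] by (simp add: mult.commute)
  have nn: "4 * (z * z) * (z + r) * (m + 1) * C \<le> n"
    using n by (simp add: z_def C_def power2_eq_square ac_simps)
  have mC: "1 \<le> (m + 1) * C" using C2 by simp
  show "2 * ((k * m) * (k * m)) + (k + 1) * Nk + l * l < n"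
  proof -
    have a: "4 * ((k * m) * (k * m)) \<le> z * z" using mult_le_mono[OF km km] by simp
    have b: "4 * (l * l) \<le> z * z" using mult_le_mono[OF l2 l2] by simp
    have "2 * (k + 1) * (m + 2) \<le> z * (2 * (m + 1))"
      using k4 z8 by (intro mult_le_mono) auto
    then have "(k + 1) * (m + 2) \<le> z * (m + 1)" by simp
    then have "(k + 1) * (m + 2) * (z * C) \<le> z * (m + 1) * (z * C)" by (rule mult_le_mono1)
    moreover have "(k + 1) * Nk = (k + 1) * (m + 2) * (z * C)"
      by (simp only: Nk_def z_def C_def ac_simps)
    moreover have "z * (m + 1) * (z * C) = z * z * ((m + 1) * C)" by (simp only: ac_simps)
    ultimately have c: "(k + 1) * Nk \<le> z * z * ((m + 1) * C)" by (simp only:)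
    have d: "z * z \<le> z * z * ((m + 1) * C)" using mult_le_mono2[OF mC, of "z * z"] by simp
    have "z * z * ((m + 1) * C) * 32 \<le> z * z * ((m + 1) * C) * (4 * (z + r))"
      using z8 by (intro mult_le_mono2) simp
    also have "\<dots> = 4 * (z * z) * (z + r) * (m + 1) * C" by (simp only: ac_simps)
    finally have e: "32 * (z * z * ((m + 1) * C)) \<le> n" using nn by linarith
    have "0 < z * z" using z8 by simp
    then show ?thesis using a b c d e by linarith
  qed
  \<comment> \<open>24 is \<open>4 * 6\<close>, from \<open>m + 1 \<ge> 3\<close> and
    \<open>C \<ge> 2\<close>.\<close>
  have n24: "24 * (z * z * z) + 24 * (z * z * r) \<le> n"
  proof -
    have "6 \<le> (m + 1) * C" using mult_le_mono[of 3 "m + 1" 2 C] m_bounds C2 by simp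
    then have "4 * (z * z) * (z + r) * 6 \<le> 4 * (z * z) * (z + r) * ((m + 1) * C)"
      by (rule mult_le_mono2)
    also have "\<dots> \<le> n" using nn by (simp only: ac_simps)
    finally show ?thesis by (simp add: algebra_simps)
  qed
  have uu: "4 * (u * u) \<le> z * z" using mult_le_mono[OF u u] by simp
  have kmm: "8 * (k * m * m) \<le> z * z" using mult_le_mono[OF km m4] by (simp add: ac_simps)
  have q: "q \<le> 2 * (z * z)" using uu kmm u zz unfolding q_def by linarith
  have Nl: "Nl \<le> z" using km k4 m4 by (simp add: Nl_def algebra_simps)
  have D: "Nl + m \<le> 2 * z" using Nl m4 by linarith
  have qD: "q * (Nl + m) \<le> 4 * (z * z * z)" using mult_le_mono[OF q D] by (simp add: ac_simps)
  have "4 * m * (m + q) \<le> z * (3 * (z * z))" using q m4 zz by (intro mult_le_mono) linarith+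
  then have mq: "4 * (m * (m + q)) \<le> 3 * (z * z * z)" by (simp add: ac_simps)
  have "4 * k * (m + 1) \<le> 3 * z" using km k4 by (simp add: algebra_simps)
  then have kD: "4 * k * (m + 1) * (Nl + m) \<le> 6 * (z * z)" using mult_le_mono[OF _ D] by fastforce
  have z3: "0 < z * z * z" using z8 by simp
  have zr: "r \<le> z * z * r" using z8 by simp
  have linear: "u + q + m + 2 * (qD + mq + uu + u + kmm) + kD + (N + r) < n"
    if h: "2 * u \<le> z" "q \<le> 2 * z2" "4 * m \<le> z" "qD \<le> 4 * z3" "4 * mq \<le> 3 * z3" "4 * uu \<le> z2"
      "8 * kmm \<le> z2" "kD \<le> 6 * z2" "N \<le> z" "24 * z3 + 24 * zr \<le> n" "8 * z \<le> z2" "8 * z2 \<le> z3"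
      "0 < z3" "r \<le> zr"
    for u q m qD mq uu kmm kD N r n z z2 z3 zr :: nat
  proof -
    have "u + m + 2 * u + N \<le> 3 * z" using h(1,3,9) by linarith
    moreover have "q + 2 * uu + 2 * kmm + kD \<le> 9 * z2" using h(2,6,7,8) by linarith
    moreover have "2 * qD + 2 * mq \<le> 10 * z3" using h(4,5) by linarith
    ultimately have "u + q + m + 2 * (qD + mq + uu + u + kmm) + kD + (N + r)
        \<le> 3 * z + 9 * z2 + 10 * z3 + zr" using h(14) by simp
    also have "\<dots> < n" using h(10-13) by linarith
    finally show ?thesis .
  qed
  have "u + q + m + 2 * (q * (Nl + m) + m * (m + q) + u * u + u + k * m * m) +
      4 * k * (m + 1) * (Nl + m) + (Nl + r) < n"
    by (rule linear[OF u q m4 qD mq uu kmm kD Nl n24 zz zzz z3 zr])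
  then show "(k - 1) * m + (((k - 1) * m) * ((k - 1) * m) + 2 * ((k - 1) * m) + 10 * k * m * m) + m +
      2 * ((((k - 1) * m) * ((k - 1) * m) + 2 * ((k - 1) * m) + 10 * k * m * m) * (Nl + m) +
        m * (m + (((k - 1) * m) * ((k - 1) * m) + 2 * ((k - 1) * m) + 10 * k * m * m)) +
        ((k - 1) * m) * ((k - 1) * m) + (k - 1) * m + k * m * m) +
      4 * k * (m + 1) * (Nl + m) + (Nl + r) < n"
    unfolding q_def u_def .
qed

end

lemma upper_bound:
  fixes V :: "'a set" and E :: "'a set set" and H :: "nat set set"
  assumes "graph V E" "beta1 E = 1" "2 \<le> k" "4 \<le> l"
    and n: "4 * k\<^sup>2 * l\<^sup>2 * (k * l + card V) * (l div 2 + 1) * (l choose (l div 2)) \<le> n"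
    and H: "graph {0..<n} H" "\<not> contains {0..<n} H V E"
      "\<not> contains {0..<n} H (kP_verts k l) (kP_edges k l)"
  shows "card H \<le> (n - k * (l div 2) + 1) * (k * (l div 2) - 1) + (if property_P V E k l then 0 else 1)"
proof (rule ccontr)
  let ?m = "l div 2" and ?N = "{0..<n}"
  let ?s = "k * (l div 2)"
  assume big: "\<not> ?thesis"
  interpret G: sgraph_kl H k l ?m
    using H(1) assms(3,4) by unfold_locales (auto simp: graph_def)
  have neH: "G.ne ?N = card H"
    unfolding G.ne_def using H(1) by (auto simp: graph_def intro: arg_cong[where f = card])
  have free: "\<not> G.kpaths l k ?N" using G.kpaths_contains H(3) by blast
  note th = G.threshold[OF n]
  have s4: "4 \<le> ?s" using mult_le_mono[OF assms(3) G.m_bounds(1)] by simp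
  have sn: "?s \<le> n"
  proof -
    have "?s * 1 \<le> ?s * ?s" by (rule mult_le_mono2) (use s4 in linarith)
    then show ?thesis using th(1) by linarith
  qed
  define c where "c = n - ?s"
  obtain s' where s': "?s = Suc s'" using s4 by (cases ?s) auto
  have nc: "n = c + ?s" using sn by (simp add: c_def)
  have "(c + 1) * s' \<le> card H" using big s' by (simp add: c_def)
  \<comment> \<open>With \<open>s = ?s\<close>, the product \<open>(n - s + 1) * (s - 1)\<close> is
    \<open>s * n - n - s * s + 2 * s - 1\<close>; the last two terms, positive together, are
    dropped.\<close>
  then have "?s * n \<le> card H + n + ?s * ?s"
    unfolding nc s' by (simp add: algebra_simps)
  then have many: "?s * card ?N \<le> G.ne ?N + card ?N + ?s * ?s"
    unfolding neH by simp
  have cN: "card ?N = n" by simp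
  have "\<exists>A\<subseteq>?N. card A = ?s - 1 \<and> G.Nl + card V \<le> card (G.cn ?N A)"
    by (rule G.exists_hub_set[of ?N "G.Nl + card V", OF finite_atLeastLessThan free many,
          unfolded cN, OF th])
  then obtain A where A: "A \<subseteq> ?N" "card A = ?s - 1" "G.Nl + card V \<le> card (G.cn ?N A)" by blast
  let ?W = "G.cn ?N A"
  obtain u v where uv: "u \<noteq> v" "edge_control_set E {{u, v}}" using beta1_one[OF assms(1,2)] .
  interpret F: edge_dominated V E u v using assms(1) uv by unfold_locales
  have fW: "finite ?W" by (simp add: G.finite_cn)
  have fA: "finite A" using A(1) finite_subset by blast
  have AW: "A \<inter> ?W = {}" by (rule G.cn_disjoint)
  have WN: "?W \<subseteq> ?N" by (rule G.cn_subset)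
  have full: "{a, w} \<in> H" if "a \<in> A" "w \<in> ?W" for a w using that by (auto simp: G.cn_def)
  have indep: "{a, b} \<notin> H" if ab: "a \<in> A" "b \<in> A" for a b
  proof
    assume h: "{a, b} \<in> H"
    have "a \<noteq> b" using h G.adj_irrefl by auto
    then have "contains ?N H V E"
      using ab h A(1,3) WN AW full fW by (intro F.contains_join[of ?W a b]) auto
    then show False using H(2) by simp
  qed
  have noP: False if P: "property_P V E k l" and xy: "x \<in> ?W" "y \<in> ?W" "{x, y} \<in> H" for x y
  proof -
    have xny: "x \<noteq> y" using xy G.adj_irrefl by auto
    have "A \<noteq> {}" using A(2) s4 by auto
    then obtain a where a: "a \<in> A" by auto
    consider "even l" | "card V \<le> ?s + 1" | "num_triangles V E = 1" "f_val E \<le> ?s"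
      using P unfolding property_P_def by blast
    then show False
    proof cases
      \<comment> \<open>For even \<open>l\<close>, the edge at one end of the hub chain and a single
        vertex at the other already give \<open>2 + 1 + 2 * ?m - 3 = l\<close> vertices.\<close>
      case 1
      have "2 * (?m + 1) \<le> k * (?m + 1)" by (rule mult_le_mono1[OF assms(3)])
      then have "3 \<le> G.Nl" using G.m_bounds by (simp add: G.Nl_def)
      then have "card {x, y} < card ?W" using A(3) card_insert_le_m1[of 2 "{y}" x] by simp
      then obtain w where w: "w \<in> ?W" "w \<notin> {x, y}" using ex_in_not_in[of "{x, y}" ?W] by auto
      have p: "G.path [x, y]" using xy xny by (simp add: G.path_Cons)
      have "length [x, y] + length [w] + 2 * ?m < l + 3"
        by (rule G.attach_to_hubs[OF _ free A(1,2) _ a p])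
          (use A(3) xy w WN AW a full in auto)
      then show False using 1 by simp
    next
      case 2
      then have "contains ?N H V E"
        using xy xny A(1,2) WN AW full fA s4
        by (intro F.contains_join[of A x y]) (auto simp: insert_commute)
      then show False using H(2) by simp
    next
      case 3
      obtain u' v' where f: "u' \<noteq> v'" "edge_control_set E {{u', v'}}"
        "f_val E = min (degree E u') (degree E v')" using f_val_le(2)[OF assms(1) uv] by auto
      \<comment> \<open>\<open>f_val E\<close> may be attained at a controlling edge other than
        \<open>uv\<close>, and at either of its ends, so the embedding is set up for any ordered
        controlling edge.\<close>
      have emb: "contains ?N H V E" if "edge_dominated V E p q" "degree E q \<le> ?s" for p q
      proof -
        interpret F': edge_dominated V E p q by fact
        show ?thesis
          using 3(1) that(2) A fA fW AW WN a xy xny full s4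
          by (intro F'.contains_one_triangle[of A ?W _ a x y]) auto
      qed
      interpret F2: edge_dominated V E u' v' using assms(1) f by unfold_locales
      have "degree E v' \<le> ?s \<or> degree E u' \<le> ?s" using f(3) 3(2) by linarith
      then have "contains ?N H V E"
        using emb[OF F2.edge_dominated_axioms] emb[OF F2.swap_ends] by blast
      then show False using H(2) by simp
    qed
  qed
  have "G.ne ?N \<le> (?s - 1) * (card ?N - (?s - 1)) + (if property_P V E k l then 0 else 1)"
    by (rule G.hub_set_bound[OF _ free A(1,2) _ indep]) (use A(3) noP in auto)
  moreover have "card ?N - (?s - 1) = n - ?s + 1" using sn s4 by simp
  ultimately show False using big neH by (simp add: mult.commute)
qed

definition bip_edges :: "nat \<Rightarrow> nat \<Rightarrow> nat set set" where
  "bip_edges a n = (\<lambda>(x, y). {x, y}) ` ({0..<a} \<times> {a..<n})"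

lemma card_bip_edges: "card (bip_edges a n) = a * (n - a)"
proof -
  have "inj_on (\<lambda>(x, y). {x, y}) ({0..<a} \<times> {a..<n})"
    by (auto simp: inj_on_def doubleton_eq_iff)
  then show ?thesis by (simp add: bip_edges_def card_image card_cartesian_product)
qed

lemma bip_edges_sides:
  "{x, y} \<in> bip_edges a n \<Longrightarrow> x \<in> {0..<a} \<longleftrightarrow> y \<notin> {0..<a}"
  by (auto simp: bip_edges_def doubleton_eq_iff)

lemma graph_bip_edges: "a \<le> n \<Longrightarrow> graph {0..<n} (bip_edges a n)"
  by (auto simp: graph_def bip_edges_def)

lemma lower_bound:
  fixes V :: "'a set" and E :: "'a set set"
  assumes "graph V E" "3 \<le> chromatic_number V E" "beta1 E = 1" "\<forall>x\<in>V. \<exists>e\<in>E. x \<in> e"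
    "1 \<le> k * (l div 2)" "k * (l div 2) < n"
  shows "\<exists>H. graph {0..<n} H \<and> \<not> contains {0..<n} H V E \<and>
    \<not> contains {0..<n} H (kP_verts k l) (kP_edges k l) \<and>
    card H = (n - k * (l div 2) + 1) * (k * (l div 2) - 1) + (if property_P V E k l then 0 else 1)"
proof -
  define a where "a = k * (l div 2) - 1"
  have a: "k * (l div 2) = a + 1" "a + 2 \<le> n" using assms(5,6) by (auto simp: a_def)
  have c: "card (bip_edges a n) = (n - k * (l div 2) + 1) * (k * (l div 2) - 1)"
    using a by (simp add: card_bip_edges mult.commute Suc_diff_Suc)
  have nc: "\<not> colorable V E 2" using assms(2) chromatic_number_not_colorable[of 2 V E] by simp
  show ?thesis
  proof (cases "property_P V E k l")
    case True
    have "\<not> contains {0..<n} (bip_edges a n) V E"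
      by (rule not_contains_if_bipartite[OF nc _ bip_edges_sides]) (use assms(1) in \<open>auto simp: graph_def\<close>)
    moreover have "\<not> contains {0..<n} (bip_edges a n) (kP_verts k l) (kP_edges k l)"
      by (rule not_contains_kP[of "{0..<a}" _ _ _ "{}"]) (use a bip_edges_sides in auto)
    ultimately show ?thesis using True c graph_bip_edges[of a n] a by auto
  next
    case False
    obtain u v where uv: "u \<noteq> v" "edge_control_set E {{u, v}}" using beta1_one[OF assms(1,3)] .
    interpret F: edge_dominated V E u v using assms(1) uv by unfold_locales
    let ?H = "insert {a, a + 1} (bip_edges a n)"
    have H: "(x \<in> {0..<a} \<longleftrightarrow> y \<notin> {0..<a}) \<or> {x, y} = {a, a + 1}" if "{x, y} \<in> ?H" for x y
      using that bip_edges_sides by blast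
    have P: "odd l" "a + 2 < card V" "\<not> (num_triangles V E = 1 \<and> f_val E \<le> a + 1)"
      using False a unfolding property_P_def by auto
    have "\<not> contains {0..<n} ?H V E"
      using F.contains_bipartite_plus_edge[OF _ nc _ H _ _ assms(4), of "{0..<n}"] P by auto
    moreover have "\<not> contains {0..<n} ?H (kP_verts k l) (kP_edges k l)"
      by (rule not_contains_kP[of "{0..<a}" _ _ _ "{a, a + 1}"]) (use a H P(1) in \<open>simp, simp, blast\<close>)
    moreover have "graph {0..<n} ?H" using graph_bip_edges[of a n] a by (auto simp: graph_def)
    moreover have "{a, a + 1} \<notin> bip_edges a n" using bip_edges_sides[of a "a + 1" a n] by auto
    then have "card ?H = card (bip_edges a n) + 1"
      by (simp add: bip_edges_def)
    ultimately show ?thesis using False c by auto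
  qed
qed

theorem theorem1p7:
  fixes V :: "'a set" and E :: "'a set set" and k l n r :: nat
  assumes "graph V E"
    and "card V = r"
    and "chromatic_number V E \<ge> 3"
    and "beta1 E = 1"
    and "\<forall>v\<in>V. \<exists>e\<in>E. v \<in> e"
    and "k \<ge> 2" and "l \<ge> 4" and "r \<ge> 3"
    and "n \<ge> 4 * k^2 * l^2 * (k * l + r) * (l div 2 + 1) * (l choose (l div 2))"
  shows "ex2 n V E (kP_verts k l) (kP_edges k l) =
    (n - k * (l div 2) + 1) * (k * (l div 2) - 1) + (if property_P V E k l then 0 else 1)"
  unfolding ex2_def
proof (rule Max_eqI)
  let ?S = "{card H | H. graph {0..<n} H \<and> \<not> contains {0..<n} H V E \<and>
      \<not> contains {0..<n} H (kP_verts k l) (kP_edges k l)}"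
  have "?S \<subseteq> card ` Pow (Pow {0..<n})" unfolding graph_def by blast
  then show "finite ?S" by (rule finite_subset) simp
  show "y \<le> (n - k * (l div 2) + 1) * (k * (l div 2) - 1) + (if property_P V E k l then 0 else 1)"
    if "y \<in> ?S" for y
    using that upper_bound[OF assms(1,4,6,7)] assms(2,9) by blast
  \<comment> \<open>An edgeless instance gives access to the purely arithmetic facts of the
    locale.\<close>
  interpret G: sgraph_kl "{} :: nat set set" k l "l div 2"
    using assms(6,7) by unfold_locales auto
  have s: "4 \<le> k * (l div 2)" using mult_le_mono[OF assms(6) G.m_bounds(1)] by simp
  have "k * (l div 2) * 1 \<le> k * (l div 2) * (k * (l div 2))" by (rule mult_le_mono2) (use s in linarith)
  then have "k * (l div 2) < n" using G.threshold(1)[OF assms(9)] by linarith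
  then obtain H where H: "graph {0..<n} H" "\<not> contains {0..<n} H V E"
    "\<not> contains {0..<n} H (kP_verts k l) (kP_edges k l)"
    "card H = (n - k * (l div 2) + 1) * (k * (l div 2) - 1) + (if property_P V E k l then 0 else 1)"
    using lower_bound[OF assms(1,3,4,5), of k l n, OF order_trans[OF _ s]] by auto
  show "(n - k * (l div 2) + 1) * (k * (l div 2) - 1) + (if property_P V E k l then 0 else 1) \<in> ?S"
    unfolding H(4)[symmetric] using H(1-3) by blast
qed

end
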